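(* Let $(\mathcal{U},\dim)$ be a modular universe with an additive dimension, and let $V\in\mathrm{Ob}(\mathcal{U})$ be a faithful $\mathrm{Alt}(5)$-module in $\mathcal{U}$. Assume $V$ is dim-connected, $\dim V=3$, and $V$ is without $2$-torsion. Then $V$ is uniquely $2$-divisible, and the following holds. Choose any involution $\alpha\in\mathrm{Alt}(5)$ and either conjugacy class $\mathcal{C}$ of $5$-cycles in $\mathrm{Alt}(5)$. Put $L=\mathrm{tr}_\alpha(V)$, and regard $L$ as a $\mathbb{Z}[\phi]$-module by letting $\phi$ act as the image in $\mathrm{End}(L)$ of $\frac14\sum_{g\in\mathcal{C}}g$ (in particular, this image satisfies $\phi^2=\phi+1$). Then $V\cong\mathrm{Icosa}(L)$ as $\mathrm{Alt}(5)$-modules, where $\mathrm{Icosa}(L)$ is formed with respect to a generating set $\{\alpha,\gamma\}$ of $\mathrm{Alt}(5)$ with $|\gamma|=3$ and $\alpha\gamma\in\mathcal{C}$. Moreover, $\dim L=1$.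
   Context: Modular universe. A modular universe $\mathcal{U}$ consists of a collection $\mathrm{Ob}(\mathcal{U})$ of abelian groups and a collection $\mathrm{Ar}(\mathcal{U})$ of homomorphisms between them (the objects and arrows of a subcategory of the category of abelian groups, so arrows are closed under composition and include identities) satisfying the following closure properties. - [Inverses] If $f\in\mathrm{Ar}(\mathcal{U})$ is an isomorphism, then $f^{-1}\in\mathrm{Ar}(\mathcal{U})$. - [Products] If $V_1,V_2\in\mathrm{Ob}(\mathcal{U})$ and $f_1,f_2\in\mathrm{Ar}(\mathcal{U})$, then $V_1\times V_2\in\mathrm{Ob}(\mathcal{U})$, and $\mathrm{Ar}(\mathcal{U})$ contains $f_1\times f_2$, the projections $\pi_i:V_1\times V_2\to V_i$, and the diagonal embeddings $\Delta_k:V_1\to V_1^k$. - [Sections] If $W\le V$ are in $\mathrm{Ob}(\mathcal{U})$, then $V/W\in\mathrm{Ob}(\mathcal{U})$ and $\mathrm{Ar}(\mathcal{U})$ contains the inclusion $W\to V$ and the quotient map $V\to V/W$. - [Kernels/images] If $f:V_1\to V_2$ is in $\mathrm{Ar}(\mathcal{U})$, then $\ker f,\operatorname{im} f\in\mathrm{Ob}(\mathcal{U})$, and for all $W_1,W_2\in\mathrm{Ob}(\mathcal{U})$: if $W_1\le\ker f$, the induced map $V_1/W_1\to V_2$ is in $\mathrm{Ar}(\mathcal{U})$; if $\operatorname{im} f\le W_2\le V_2$, the induced map $V_1\to W_2$ is in $\mathrm{Ar}(\mathcal{U})$. - [$\mathbb{Z}$-module structure] If $V\in\mathrm{Ob}(\mathcal{U})$,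 then $\mathrm{Ar}(\mathcal{U})$ contains the sum map $V\times V\to V$ and the multiplication-by-$n$ maps $V\to V$ (for $n \in \mathbb{Z}$). The homomorphisms in $\mathrm{Ar}(\mathcal{U})$ are called compatible morphisms. If a group $G$ acts on $V\in\mathrm{Ob}(\mathcal{U})$ by compatible morphisms, $V$ is a $G$-module in $\mathcal{U}$. Additive dimension. An additive dimension on $\mathcal{U}$ is a function $\dim:\mathrm{Ob}(\mathcal{U})\to\mathbb{N}$ (with $0\in\mathbb{N}$) such that for all $f:V_1\to V_2$ in $\mathrm{Ar}(\mathcal{U})$, $\dim V_1=\dim\ker f+\dim\operatorname{im} f$. A module $V\in\mathrm{Ob}(\mathcal{U})$ is dim-connected if for all $W\in\mathrm{Ob}(\mathcal{U})$, $W<V$ (proper subgroup) implies $\dim W<\dim V$. For $g\in G$ of finite order $m$, $\mathrm{tr}_g=1+g+\cdots+g^{m-1}\in\mathrm{End}(V)$. $V$ is uniquely $2$-divisible if for every $v\in V$ there is a unique $w\in V$ with $v=2w$; this makes multiplication by $\frac14$ meaningful. The sum of the elements of a conjugacy class commutes with the action of $\mathrm{Alt}(5)$, so it preserves $\mathrm{tr}_\alpha(V)$. Icosahedral modules. Let $R=\mathbb{Z}[\phi]$ with $\phi$ satisfying $\phi^2=\phi+1$. Fix a generating set $\{\alpha,\gamma\}$ of $\mathrm{Alt}(5)$ with $|\alpha|=2$, $|\gamma|=3$, $|\alpha\gamma|=5$. Then $\mathrm{Icosa}(R)$ (with respect to $\alpha,\gamma$) is the $R[\mathrm{Alt}(5)]$-module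 $Re_1\oplus Re_2\oplus Re_3$, free over $R$ on $e_1,e_2,e_3$, with action $\alpha e_1=-e_1+\phi e_3$, $\alpha e_2=-e_2+\phi e_3$, $\alpha e_3=e_3$, $\gamma e_1=e_3$, $\gamma e_2=e_1$, $\gamma e_3=e_2$. For an $R$-module $L$ without $2$-torsion, $\mathrm{Icosa}(L)=\mathrm{Icosa}(R)\otimes_R L$ with $\mathrm{Alt}(5)$ acting trivially on $L$. *)

theory Defs
  imports "HOL-Algebra.Algebra"
begin

section \<open>Modular universes\<close>

text \<open>
  Abelian groups are HOL-Algebra records, written multiplicatively.  All objects of a universe
  have their carriers in one type \<^typ>\<open>'a\<close>.  Since \<open>V\<^sub>1 \<times> V\<^sub>2\<close> and \<open>V / W\<close> have carriers in other
  types, a universe comes with a copy of each of them in \<^typ>\<open>'a\<close>: the group \<open>Prd V\<^sub>1 V\<^sub>2\<close> with an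
  isomorphism \<open>pcode V\<^sub>1 V\<^sub>2\<close> from the direct product, and the group \<open>Quo V W\<close> with an isomorphism
  \<open>qcode V W\<close> from the factor group.  The encodings are arbitrary.
\<close>

record 'a universe =
  Obj :: "'a monoid set"
  Arr :: "'a monoid \<Rightarrow> 'a monoid \<Rightarrow> ('a \<Rightarrow> 'a) set"
  Prd :: "'a monoid \<Rightarrow> 'a monoid \<Rightarrow> 'a monoid"
  pcode :: "'a monoid \<Rightarrow> 'a monoid \<Rightarrow> 'a \<times> 'a \<Rightarrow> 'a"
  Quo :: "'a monoid \<Rightarrow> 'a monoid \<Rightarrow> 'a monoid"
  qcode :: "'a monoid \<Rightarrow> 'a monoid \<Rightarrow> 'a set \<Rightarrow> 'a"

definition pdecode :: "'a universe \<Rightarrow> 'a monoid \<Rightarrow> 'a monoid \<Rightarrow> 'a \<Rightarrow> 'a \<times> 'a" where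
  "pdecode U V1 V2 = inv_into (carrier (V1 \<times>\<times> V2)) (pcode U V1 V2)"

definition qdecode :: "'a universe \<Rightarrow> 'a monoid \<Rightarrow> 'a monoid \<Rightarrow> 'a \<Rightarrow> 'a set" where
  "qdecode U V W = inv_into (carrier (V Mod carrier W)) (qcode U V W)"

text \<open>Only the values of the operations on the carrier of the smaller group are compared.\<close>

definition subgrp :: "'a monoid \<Rightarrow> 'a monoid \<Rightarrow> bool" where
  "subgrp W V \<longleftrightarrow> subgroup (carrier W) V \<and>
     (\<forall>x\<in>carrier W. \<forall>y\<in>carrier W. x \<otimes>\<^bsub>W\<^esub> y = x \<otimes>\<^bsub>V\<^esub> y)"

definition ker_obj :: "'a monoid \<Rightarrow> 'a monoid \<Rightarrow> ('a \<Rightarrow> 'a) \<Rightarrow> 'a monoid" where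
  "ker_obj V1 V2 f = V1\<lparr>carrier := kernel V1 V2 f\<rparr>"

definition im_obj :: "'a monoid \<Rightarrow> 'a monoid \<Rightarrow> ('a \<Rightarrow> 'a) \<Rightarrow> 'a monoid" where
  "im_obj V1 V2 f = V2\<lparr>carrier := f ` carrier V1\<rparr>"

text \<open>
  \<open>power_obj U V n\<close> is \<open>V\<^sup>k\<close> for \<open>k = n + 1\<close>, bracketed to the left; \<open>diag_map U V n\<close> is the diagonal
  embedding of \<open>V\<close> into it.
\<close>

primrec power_obj :: "'a universe \<Rightarrow> 'a monoid \<Rightarrow> nat \<Rightarrow> 'a monoid" where
  "power_obj U V 0 = V"
| "power_obj U V (Suc n) = Prd U (power_obj U V n) V"

primrec diag_map :: "'a universe \<Rightarrow> 'a monoid \<Rightarrow> nat \<Rightarrow> 'a \<Rightarrow> 'a" where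
  "diag_map U V 0 x = x"
| "diag_map U V (Suc n) x = pcode U (power_obj U V n) V (diag_map U V n x, x)"

text \<open>
  Arrows are maps between carriers, so values off the carrier are irrelevant; this is \<open>arr_cong\<close>.
  In \<open>ker_induced\<close>, \<open>f\<close> is constant on each coset of \<open>W\<^sub>1\<close>, so \<^const>\<open>the_elem\<close> picks its value there.
\<close>

locale modular_universe =
  fixes U :: "'a universe"
  assumes obj_group: "V \<in> Obj U \<Longrightarrow> comm_group V"
    and arr_obj: "f \<in> Arr U V1 V2 \<Longrightarrow> V1 \<in> Obj U \<and> V2 \<in> Obj U"
    and arr_hom: "f \<in> Arr U V1 V2 \<Longrightarrow> f \<in> hom V1 V2"
    and arr_cong: "\<lbrakk>f \<in> Arr U V1 V2; \<forall>x\<in>carrier V1. g x = f x\<rbrakk> \<Longrightarrow> g \<in> Arr U V1 V2"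
    and arr_id: "V \<in> Obj U \<Longrightarrow> (\<lambda>x. x) \<in> Arr U V V"
    and arr_comp: "\<lbrakk>f \<in> Arr U V1 V2; g \<in> Arr U V2 V3\<rbrakk> \<Longrightarrow> g \<circ> f \<in> Arr U V1 V3"
    and arr_inverse:
      "\<lbrakk>f \<in> Arr U V1 V2; f \<in> iso V1 V2\<rbrakk> \<Longrightarrow> inv_into (carrier V1) f \<in> Arr U V2 V1"
    and prd_obj: "\<lbrakk>V1 \<in> Obj U; V2 \<in> Obj U\<rbrakk> \<Longrightarrow> Prd U V1 V2 \<in> Obj U"
    and pcode_iso:
      "\<lbrakk>V1 \<in> Obj U; V2 \<in> Obj U\<rbrakk> \<Longrightarrow> pcode U V1 V2 \<in> iso (V1 \<times>\<times> V2) (Prd U V1 V2)"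
    and prd_arr: "\<lbrakk>f1 \<in> Arr U V1 W1; f2 \<in> Arr U V2 W2\<rbrakk> \<Longrightarrow>
      (\<lambda>p. case pdecode U V1 V2 p of (x, y) \<Rightarrow> pcode U W1 W2 (f1 x, f2 y))
        \<in> Arr U (Prd U V1 V2) (Prd U W1 W2)"
    and proj1: "\<lbrakk>V1 \<in> Obj U; V2 \<in> Obj U\<rbrakk> \<Longrightarrow>
      (\<lambda>p. fst (pdecode U V1 V2 p)) \<in> Arr U (Prd U V1 V2) V1"
    and proj2: "\<lbrakk>V1 \<in> Obj U; V2 \<in> Obj U\<rbrakk> \<Longrightarrow>
      (\<lambda>p. snd (pdecode U V1 V2 p)) \<in> Arr U (Prd U V1 V2) V2"
    and diagonal: "V \<in> Obj U \<Longrightarrow> diag_map U V n \<in> Arr U V (power_obj U V n)"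
    and quo_obj: "\<lbrakk>V \<in> Obj U; W \<in> Obj U; subgrp W V\<rbrakk> \<Longrightarrow> Quo U V W \<in> Obj U"
    and qcode_iso: "\<lbrakk>V \<in> Obj U; W \<in> Obj U; subgrp W V\<rbrakk> \<Longrightarrow>
      qcode U V W \<in> iso (V Mod carrier W) (Quo U V W)"
    and inclusion: "\<lbrakk>V \<in> Obj U; W \<in> Obj U; subgrp W V\<rbrakk> \<Longrightarrow> (\<lambda>x. x) \<in> Arr U W V"
    and quotient_map: "\<lbrakk>V \<in> Obj U; W \<in> Obj U; subgrp W V\<rbrakk> \<Longrightarrow>
      (\<lambda>x. qcode U V W (carrier W #>\<^bsub>V\<^esub> x)) \<in> Arr U V (Quo U V W)"
    and ker_in_obj: "f \<in> Arr U V1 V2 \<Longrightarrow> ker_obj V1 V2 f \<in> Obj U"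
    and im_in_obj: "f \<in> Arr U V1 V2 \<Longrightarrow> im_obj V1 V2 f \<in> Obj U"
    and ker_induced: "\<lbrakk>f \<in> Arr U V1 V2; W1 \<in> Obj U; subgrp W1 (ker_obj V1 V2 f)\<rbrakk> \<Longrightarrow>
      (\<lambda>q. the_elem (f ` qdecode U V1 W1 q)) \<in> Arr U (Quo U V1 W1) V2"
    and im_induced:
      "\<lbrakk>f \<in> Arr U V1 V2; W2 \<in> Obj U; subgrp (im_obj V1 V2 f) W2; subgrp W2 V2\<rbrakk> \<Longrightarrow>
      f \<in> Arr U V1 W2"
    and sum_map: "V \<in> Obj U \<Longrightarrow>
      (\<lambda>p. case pdecode U V V p of (x, y) \<Rightarrow> x \<otimes>\<^bsub>V\<^esub> y) \<in> Arr U (Prd U V V) V"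
    and mult_map: "V \<in> Obj U \<Longrightarrow> (\<lambda>x. x [^]\<^bsub>V\<^esub> (n::int)) \<in> Arr U V V"

text \<open>Values of \<open>dm\<close> outside \<^term>\<open>Obj U\<close> play no role.\<close>

definition additive_dimension :: "'a universe \<Rightarrow> ('a monoid \<Rightarrow> nat) \<Rightarrow> bool" where
  "additive_dimension U dm \<longleftrightarrow> (\<forall>V1 V2. \<forall>f\<in>Arr U V1 V2.
     dm V1 = dm (ker_obj V1 V2 f) + dm (im_obj V1 V2 f))"

definition dim_connected :: "'a universe \<Rightarrow> ('a monoid \<Rightarrow> nat) \<Rightarrow> 'a monoid \<Rightarrow> bool" where
  "dim_connected U dm V \<longleftrightarrow> V \<in> Obj U \<and>
     (\<forall>W\<in>Obj U. subgrp W V \<and> carrier W \<noteq> carrier V \<longrightarrow> dm W < dm V)"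

text \<open>Compatible morphisms are homomorphisms, so such an action is by automorphisms.\<close>

definition module_in ::
    "'a universe \<Rightarrow> ('g, 'c) monoid_scheme \<Rightarrow> 'a monoid \<Rightarrow> ('g \<Rightarrow> 'a \<Rightarrow> 'a) \<Rightarrow> bool" where
  "module_in U G V \<rho> \<longleftrightarrow> V \<in> Obj U \<and> group_action G (carrier V) \<rho> \<and>
     (\<forall>g\<in>carrier G. \<rho> g \<in> Arr U V V)"

definition equivariant_iso ::
    "('g, 'c) monoid_scheme \<Rightarrow> 'a monoid \<Rightarrow> ('g \<Rightarrow> 'a \<Rightarrow> 'a) \<Rightarrow> 'b monoid \<Rightarrow> ('g \<Rightarrow> 'b \<Rightarrow> 'b) \<Rightarrow> bool"
  where
  "equivariant_iso G V \<rho> W \<sigma> \<longleftrightarrow>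
     (\<exists>\<theta>\<in>iso V W. \<forall>g\<in>carrier G. \<forall>v\<in>carrier V. \<theta> (\<rho> g v) = \<sigma> g (\<theta> v))"

section \<open>Divisibility and traces\<close>

definition without_2_torsion :: "'a monoid \<Rightarrow> bool" where
  "without_2_torsion V \<longleftrightarrow> (\<forall>v\<in>carrier V. v [^]\<^bsub>V\<^esub> (2::nat) = \<one>\<^bsub>V\<^esub> \<longrightarrow> v = \<one>\<^bsub>V\<^esub>)"

definition uniquely_2_divisible :: "'a monoid \<Rightarrow> bool" where
  "uniquely_2_divisible V \<longleftrightarrow>
     (\<forall>v\<in>carrier V. \<exists>!w. w \<in> carrier V \<and> v = w [^]\<^bsub>V\<^esub> (2::nat))"

definition half :: "'a monoid \<Rightarrow> 'a \<Rightarrow> 'a" where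
  "half V v = (THE w. w \<in> carrier V \<and> v = w [^]\<^bsub>V\<^esub> (2::nat))"

definition group_trace ::
    "('g, 'c) monoid_scheme \<Rightarrow> 'a monoid \<Rightarrow> ('g \<Rightarrow> 'a \<Rightarrow> 'a) \<Rightarrow> 'g \<Rightarrow> 'a \<Rightarrow> 'a" where
  "group_trace G V \<rho> g v = finprod V (\<lambda>i. \<rho> (g [^]\<^bsub>G\<^esub> (i::nat)) v) {..<group.ord G g}"

text \<open>The action of \<open>(1/4) \<Sum>\<^bsub>g \<in> C\<^esub> g\<close>.\<close>

definition quarter_class_sum :: "'a monoid \<Rightarrow> ('g \<Rightarrow> 'a \<Rightarrow> 'a) \<Rightarrow> 'g set \<Rightarrow> 'a \<Rightarrow> 'a" where
  "quarter_class_sum V \<rho> C v = half V (half V (finprod V (\<lambda>g. \<rho> g v) C))"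

section \<open>The alternating group on five letters\<close>

abbreviation Alt5 :: "(nat \<Rightarrow> nat) monoid" where
  "Alt5 \<equiv> alt_group 5"

definition conj_class :: "('g, 'c) monoid_scheme \<Rightarrow> 'g \<Rightarrow> 'g set" where
  "conj_class G c = {h \<otimes>\<^bsub>G\<^esub> c \<otimes>\<^bsub>G\<^esub> inv\<^bsub>G\<^esub> h | h. h \<in> carrier G}"

definition five_cycle_classes :: "(nat \<Rightarrow> nat) set set" where
  "five_cycle_classes =
     {conj_class Alt5 (cycle_of_list cs) | cs. cycle cs \<and> length cs = 5 \<and> set cs = {1..5}}"

definition icosa_generators :: "(nat \<Rightarrow> nat) \<Rightarrow> (nat \<Rightarrow> nat) \<Rightarrow> bool" where
  "icosa_generators \<alpha> \<gamma> \<longleftrightarrow> \<alpha> \<in> carrier Alt5 \<and> \<gamma> \<in> carrier Alt5 \<and>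
     generate Alt5 {\<alpha>, \<gamma>} = carrier Alt5 \<and>
     group.ord Alt5 \<alpha> = 2 \<and> group.ord Alt5 \<gamma> = 3 \<and> group.ord Alt5 (\<alpha> \<otimes>\<^bsub>Alt5\<^esub> \<gamma>) = 5"

section \<open>The ring \<open>\<int>[\<phi>]\<close> and the module \<open>Icosa(R)\<close>\<close>

text \<open>The pair \<open>(a, b)\<close> stands for \<open>a + b\<phi>\<close>, where \<open>\<phi>\<^sup>2 = \<phi> + 1\<close>.\<close>

definition Zphi :: "(int \<times> int) ring" where
  "Zphi = \<lparr>carrier = UNIV,
     monoid.mult = (\<lambda>(a, b) (c, d). (a * c + b * d, a * d + b * c + b * d)), one = (1, 0),
     ring.zero = (0, 0), ring.add = (\<lambda>(a, b) (c, d). (a + c, b + d))\<rparr>"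

definition phi :: "int \<times> int" where
  "phi = (0, 1)"

lemma cring_Zphi: "cring Zphi"
proof (rule cringI)
  show "abelian_group Zphi"
  proof (rule abelian_groupI)
    fix x assume "x \<in> carrier Zphi"
    show "\<exists>y\<in>carrier Zphi. y \<oplus>\<^bsub>Zphi\<^esub> x = \<zero>\<^bsub>Zphi\<^esub>"
      by (rule bexI[of _ "(- fst x, - snd x)"]) (auto simp: Zphi_def split: prod.splits)
  qed (auto simp: Zphi_def)
  show "comm_monoid Zphi"
    by (rule comm_monoidI) (auto simp: Zphi_def algebra_simps)
qed (auto simp: Zphi_def algebra_simps)

lemma phi_square: "phi \<otimes>\<^bsub>Zphi\<^esub> phi = phi \<oplus>\<^bsub>Zphi\<^esub> \<one>\<^bsub>Zphi\<^esub>"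
  by (simp add: Zphi_def phi_def)

text \<open>
  The abelian group \<open>A\<close> with \<open>\<phi>\<close> acting as the endomorphism \<open>f\<close>.  A module record also has the
  fields \<open>mult\<close> and \<open>one\<close> of a ring; they have no meaning for a module.
\<close>

definition Zphi_module :: "'a monoid \<Rightarrow> ('a \<Rightarrow> 'a) \<Rightarrow> (int \<times> int, 'a) module" where
  "Zphi_module A f = \<lparr>carrier = carrier A, monoid.mult = undefined, one = undefined,
     ring.zero = \<one>\<^bsub>A\<^esub>, ring.add = monoid.mult A,
     smult = (\<lambda>(a, b) x. x [^]\<^bsub>A\<^esub> a \<otimes>\<^bsub>A\<^esub> f x [^]\<^bsub>A\<^esub> b)\<rparr>"

text \<open>The free module on \<open>e\<^sub>1, e\<^sub>2, e\<^sub>3\<close>, as coordinate triples.\<close>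

type_synonym zphi3 = "(int \<times> int) \<times> (int \<times> int) \<times> (int \<times> int)"

definition icosaR :: "(int \<times> int, zphi3) module" where
  "icosaR = \<lparr>carrier = UNIV, monoid.mult = undefined, one = undefined,
     ring.zero = (\<zero>\<^bsub>Zphi\<^esub>, \<zero>\<^bsub>Zphi\<^esub>, \<zero>\<^bsub>Zphi\<^esub>),
     ring.add = (\<lambda>(x, y, z) (x', y', z'). (x \<oplus>\<^bsub>Zphi\<^esub> x', y \<oplus>\<^bsub>Zphi\<^esub> y', z \<oplus>\<^bsub>Zphi\<^esub> z')),
     smult = (\<lambda>r (x, y, z). (r \<otimes>\<^bsub>Zphi\<^esub> x, r \<otimes>\<^bsub>Zphi\<^esub> y, r \<otimes>\<^bsub>Zphi\<^esub> z))\<rparr>"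

lemma module_icosaR: "module Zphi icosaR"
proof (rule moduleI)
  show "cring Zphi" by (rule cring_Zphi)
  show "abelian_group icosaR"
  proof (rule abelian_groupI)
    fix x assume "x \<in> carrier icosaR"
    obtain a b c d e f where x: "x = ((a, b), (c, d), (e, f))"
      by (metis prod.exhaust)
    show "\<exists>y\<in>carrier icosaR. y \<oplus>\<^bsub>icosaR\<^esub> x = \<zero>\<^bsub>icosaR\<^esub>"
      by (rule bexI[of _ "((-a, -b), (-c, -d), (-e, -f))"]) (auto simp: icosaR_def Zphi_def x)
  qed (auto simp: icosaR_def Zphi_def)
qed (auto simp: icosaR_def Zphi_def algebra_simps)

definition e1 :: zphi3 where "e1 = (\<one>\<^bsub>Zphi\<^esub>, \<zero>\<^bsub>Zphi\<^esub>, \<zero>\<^bsub>Zphi\<^esub>)"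
definition e2 :: zphi3 where "e2 = (\<zero>\<^bsub>Zphi\<^esub>, \<one>\<^bsub>Zphi\<^esub>, \<zero>\<^bsub>Zphi\<^esub>)"
definition e3 :: zphi3 where "e3 = (\<zero>\<^bsub>Zphi\<^esub>, \<zero>\<^bsub>Zphi\<^esub>, \<one>\<^bsub>Zphi\<^esub>)"

definition is_icosa_action ::
    "(nat \<Rightarrow> nat) \<Rightarrow> (nat \<Rightarrow> nat) \<Rightarrow> ((nat \<Rightarrow> nat) \<Rightarrow> zphi3 \<Rightarrow> zphi3) \<Rightarrow> bool" where
  "is_icosa_action \<alpha> \<gamma> \<sigma> \<longleftrightarrow>
     \<sigma> \<in> extensional (carrier Alt5) \<and> group_action Alt5 (carrier icosaR) \<sigma> \<and>
     (\<forall>g\<in>carrier Alt5.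
        (\<forall>x\<in>carrier icosaR. \<forall>y\<in>carrier icosaR. \<sigma> g (x \<oplus>\<^bsub>icosaR\<^esub> y) = \<sigma> g x \<oplus>\<^bsub>icosaR\<^esub> \<sigma> g y) \<and>
        (\<forall>r\<in>carrier Zphi. \<forall>x\<in>carrier icosaR. \<sigma> g (r \<odot>\<^bsub>icosaR\<^esub> x) = r \<odot>\<^bsub>icosaR\<^esub> \<sigma> g x)) \<and>
     \<sigma> \<alpha> e1 = \<ominus>\<^bsub>icosaR\<^esub> e1 \<oplus>\<^bsub>icosaR\<^esub> phi \<odot>\<^bsub>icosaR\<^esub> e3 \<and>
     \<sigma> \<alpha> e2 = \<ominus>\<^bsub>icosaR\<^esub> e2 \<oplus>\<^bsub>icosaR\<^esub> phi \<odot>\<^bsub>icosaR\<^esub> e3 \<and>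
     \<sigma> \<alpha> e3 = e3 \<and>
     \<sigma> \<gamma> e1 = e3 \<and> \<sigma> \<gamma> e2 = e1 \<and> \<sigma> \<gamma> e3 = e2"

text \<open>
  The formulas determine the action, because \<open>\<alpha>\<close> and \<open>\<gamma>\<close> generate.  It exists because
  \<open>\<langle>\<alpha>, \<gamma> | \<alpha>\<^sup>2, \<gamma>\<^sup>3, (\<alpha>\<gamma>)\<^sup>5\<rangle>\<close> is a presentation of the group and the matrices satisfy the relations.
\<close>

definition icosa_action :: "(nat \<Rightarrow> nat) \<Rightarrow> (nat \<Rightarrow> nat) \<Rightarrow> (nat \<Rightarrow> nat) \<Rightarrow> zphi3 \<Rightarrow> zphi3" where
  "icosa_action \<alpha> \<gamma> = (THE \<sigma>. is_icosa_action \<alpha> \<gamma> \<sigma>)"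

section \<open>Tensor products and \<open>Icosa(L)\<close>\<close>

text \<open>
  \<open>M \<otimes>\<^sub>R N\<close> is the free abelian group on \<open>M \<times> N\<close> modulo the bilinearity relations; \<open>frag_of (x, n)\<close> is
  the generator belonging to \<open>(x, n)\<close>.
\<close>

definition tensor_relations ::
    "('r, 'c) ring_scheme \<Rightarrow> ('r, 'm) module \<Rightarrow> ('r, 'n) module \<Rightarrow> (('m \<times> 'n) \<Rightarrow>\<^sub>0 int) set" where
  "tensor_relations R M N =
     {frag_of (x \<oplus>\<^bsub>M\<^esub> y, n) - frag_of (x, n) - frag_of (y, n) | x y n.
        x \<in> carrier M \<and> y \<in> carrier M \<and> n \<in> carrier N} \<union>
     {frag_of (x, n \<oplus>\<^bsub>N\<^esub> p) - frag_of (x, n) - frag_of (x, p) | x n p.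
        x \<in> carrier M \<and> n \<in> carrier N \<and> p \<in> carrier N} \<union>
     {frag_of (r \<odot>\<^bsub>M\<^esub> x, n) - frag_of (x, r \<odot>\<^bsub>N\<^esub> n) | r x n.
        r \<in> carrier R \<and> x \<in> carrier M \<and> n \<in> carrier N}"

definition tensor_kernel ::
    "('r, 'c) ring_scheme \<Rightarrow> ('r, 'm) module \<Rightarrow> ('r, 'n) module \<Rightarrow> (('m \<times> 'n) \<Rightarrow>\<^sub>0 int) set" where
  "tensor_kernel R M N =
     generate (free_Abelian_group (carrier M \<times> carrier N)) (tensor_relations R M N)"

definition tensor ::
    "('r, 'c) ring_scheme \<Rightarrow> ('r, 'm) module \<Rightarrow> ('r, 'n) module \<Rightarrow> (('m \<times> 'n) \<Rightarrow>\<^sub>0 int) set monoid"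
  where
  "tensor R M N = free_Abelian_group (carrier M \<times> carrier N) Mod tensor_kernel R M N"

text \<open>
  \<open>f \<otimes> id\<close> on \<open>M \<otimes>\<^sub>R N\<close>, for an \<open>R\<close>-linear map \<open>f\<close> from \<open>M\<close> to \<open>M\<close>; the cosets in the union are all
  equal.
\<close>

definition tensor_map ::
    "('r, 'c) ring_scheme \<Rightarrow> ('r, 'm) module \<Rightarrow> ('r, 'n) module \<Rightarrow> ('m \<Rightarrow> 'm) \<Rightarrow>
     (('m \<times> 'n) \<Rightarrow>\<^sub>0 int) set \<Rightarrow> (('m \<times> 'n) \<Rightarrow>\<^sub>0 int) set" where
  "tensor_map R M N f T =
     (\<Union>c\<in>T. r_coset (free_Abelian_group (carrier M \<times> carrier N)) (tensor_kernel R M N)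
        (frag_extend (\<lambda>(x, n). frag_of (f x, n)) c))"

definition Icosa :: "(int \<times> int, 'a) module \<Rightarrow> ((zphi3 \<times> 'a) \<Rightarrow>\<^sub>0 int) set monoid" where
  "Icosa L = tensor Zphi icosaR L"

definition Icosa_action ::
    "(nat \<Rightarrow> nat) \<Rightarrow> (nat \<Rightarrow> nat) \<Rightarrow> (int \<times> int, 'a) module \<Rightarrow> (nat \<Rightarrow> nat) \<Rightarrow>
     ((zphi3 \<times> 'a) \<Rightarrow>\<^sub>0 int) set \<Rightarrow> ((zphi3 \<times> 'a) \<Rightarrow>\<^sub>0 int) set" where
  "Icosa_action \<alpha> \<gamma> L g = tensor_map Zphi icosaR L (icosa_action \<alpha> \<gamma> g)"

end

theory Submission
  imports Defs
begin

text \<open>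
  Let \<open>c = \<alpha>\<gamma>\<close>, and let \<open>K = {1, \<alpha>, z, \<alpha>z}\<close> be the Klein four-group that contains \<open>\<alpha>\<close>.  The groups
  are written additively in these explanations and multiplicatively in the formal text.

  Doubling is injective on \<open>V\<close>, so its image has full dimension and is \<open>V\<close> by connectedness.
  Because \<open>V\<close> is 2-divisible without 2-torsion, it is the direct sum of the four joint eigenspaces
  of \<open>K\<close>.  An element of order 3 that normalises \<open>K\<close> permutes the three eigenspaces with nontrivial
  character, so these have a common dimension \<open>k\<close>, and \<open>3 = d + 3k\<close> where \<open>d\<close> is the dimension of
  the fixed points of \<open>K\<close>.  If \<open>k = 0\<close>, connectedness makes \<open>\<alpha>\<close> act trivially, against
  faithfulness.  So \<open>k = 1\<close> and \<open>d = 0\<close>; it follows that \<open>1 + \<alpha> + z + \<alpha>z\<close> annihilates \<open>V\<close> and that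
  \<open>L\<close>, the fixed points of \<open>\<alpha>\<close>, is one of the eigenspaces and has dimension 1
  (\<open>klein_decomposition\<close>).

  Apart from divisibility and the absence of 2-torsion, the remaining argument uses only that
  \<open>1 + \<alpha> + z + \<alpha>z = 0\<close> on \<open>V\<close>, for one Klein four-group and hence for its conjugates.  On \<open>L\<close> the involution \<open>z\<close> acts as \<open>-1\<close>.  Put \<open>p = 1 + \<alpha>\<close>; then \<open>pz = -p\<close>, and so
  the restriction of \<open>pg\<close> to \<open>L\<close> depends, up to sign, only on the double coset \<open>KgK\<close>.  The
  equations \<open>p g (1 + \<alpha> + z + \<alpha>z) h = 0\<close> between these operators leave a single
  unknown \<open>\<psi> = pc\<close>: on \<open>L\<close>, \<open>pc\<^sup>-\<^sup>1 = \<psi>\<close>, \<open>pc\<^sup>2 = 1\<close> and \<open>pc\<^sup>-\<^sup>1\<alpha>c = \<psi> - 1\<close>.  From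
  \<open>\<psi>\<^sup>2 = pc(1 + \<alpha>)c\<close> one gets \<open>\<psi>\<^sup>2 = \<psi> + 1\<close>, and adding up the twelve elements of the class of \<open>c\<close>
  gives \<open>4\<psi>\<close> (\<open>class_sum\<close>), so \<open>\<psi>\<close> is the action of \<open>\<phi>\<close>.

  The isomorphism from \<open>L\<^sup>3\<close> to \<open>V\<close> is \<open>\<theta>(x, y, w) = \<gamma>\<^sup>2x + \<gamma>y + w\<close>.  Since \<open>p\<gamma> = p\<gamma>\<^sup>2 = \<psi>\<close> on \<open>L\<close>, it
  carries the formulas that define \<open>Icosa(R)\<close> to the action on \<open>V\<close>.  If \<open>\<theta>(x, y, w) = 0\<close>, applying
  \<open>p\<close> to this equation and its images under \<open>\<gamma>\<close> gives a circulant linear system with determinant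
  \<open>(2 - \<phi>)\<^sup>2(2 + 2\<phi>)\<close>, which is 2 times a unit, so \<open>\<theta>\<close> is injective.  Its image is stable under the
  group and contains \<open>L\<close>, hence all eigenspaces of \<open>K\<close>, so \<open>\<theta>\<close> is surjective.  Finally, every element
  of the tensor product is \<open>e\<^sub>1 \<otimes> x + e\<^sub>2 \<otimes> y + e\<^sub>3 \<otimes> w\<close>, which identifies \<open>L\<^sup>3\<close> with \<open>Icosa(L)\<close>
  (\<open>kernel_eq_N\<close>, \<open>equivariant_iso_tensor\<close>).

  All computations in the group are reduced to the relations \<open>\<alpha>\<^sup>2 = c\<^sup>5 = (\<alpha>c)\<^sup>3 = 1\<close>.  Two maps that
  satisfy them have orbits of at most 60 points (\<open>icosahedral_pair\<close>); comparing this with the order of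
  \<open>Alt(5)\<close> shows that the maps come from an action of \<open>Alt(5)\<close> (\<open>action_of_pair\<close>), which yields the
  action on \<open>Icosa(R)\<close>, and that the listed words for the class of \<open>c\<close> are distinct.
\<close>

section \<open>Pairs of maps satisfying the relations of the icosahedral group\<close>

text \<open>
  The relations are stated for maps instead of group elements, so that they apply to a group acting
  on itself, to a module, and to the two matrices that define \<open>Icosa(R)\<close>.
\<close>
locale icosahedral_pair =
  fixes S :: "'x set" and A P :: "'x \<Rightarrow> 'x"
  assumes A_closed [simp]: "x \<in> S \<Longrightarrow> A x \<in> S"
    and P_closed [simp]: "x \<in> S \<Longrightarrow> P x \<in> S"
    and A_A [simp]: "x \<in> S \<Longrightarrow> A (A x) = x"
    and P_5: "x \<in> S \<Longrightarrow> P (P (P (P (P x)))) = x"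
    and AP_3: "x \<in> S \<Longrightarrow> A (P (A (P (A (P x))))) = x"
begin

definition Q :: "'x \<Rightarrow> 'x" where "Q x = P (P (P (P x)))"

text \<open>
  \<open>Z\<close> is the second generator of the Klein four-group of \<open>A\<close>, and \<open>T\<close> has order 3 and permutes the
  involutions \<open>A\<close>, \<open>Z\<close>, \<open>A Z\<close> cyclically by conjugation (\<open>T_A\<close>, \<open>T_Z\<close>).
\<close>
definition Z :: "'x \<Rightarrow> 'x" where "Z x = P (P (A (Q (Q (A (P (P x)))))))"

definition T :: "'x \<Rightarrow> 'x" where "T x = P (P (A (Q x)))"

lemma Q_closed [simp]: "x \<in> S \<Longrightarrow> Q x \<in> S"
  by (simp add: Q_def)

lemma P_Q [simp]: "x \<in> S \<Longrightarrow> P (Q x) = x" and Q_P [simp]: "x \<in> S \<Longrightarrow> Q (P x) = x"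
  by (simp_all add: Q_def P_5)

lemma PPP: "x \<in> S \<Longrightarrow> P (P (P x)) = Q (Q x)"
  by (simp add: Q_def P_5)

lemma QQQ: "x \<in> S \<Longrightarrow> Q (Q (Q x)) = P (P x)"
  by (metis PPP P_closed Q_P Q_closed)

lemma APA: assumes "x \<in> S" shows "A (P (A x)) = Q (A (Q x))"
proof -
  have "A (P (A (P (A (P (Q x)))))) = Q x"
    using assms by (intro AP_3) simp
  then have "A (P (A (P (A x)))) = Q x" using assms by simp
  then have "P (A (P (A x))) = A (Q x)" using assms by (metis A_A A_closed P_closed)
  then show ?thesis using assms by (metis A_closed P_closed Q_P)
qed

lemma AQA: assumes "x \<in> S" shows "A (Q (A x)) = P (A (P x))"
proof -
  have "Q (A (Q (P x))) = A (P (A (P x)))" using assms by (simp add: APA)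
  then have "Q (A x) = A (P (A (P x)))" using assms by simp
  then show ?thesis using assms by simp
qed

text \<open>
  Together with the previous rules, the next ones complete the relations, as rewrite rules ordered by length and then lexicographically
  with \<open>P < Q < A\<close>, to a confluent system.  Equations between words in \<open>A\<close>, \<open>P\<close>, \<open>Q\<close> are therefore
  decided by simplification with \<open>word_simps\<close>.
\<close>
lemma APPAP: assumes "x \<in> S" shows "A (P (P (A (P x)))) = Q (A (Q (Q (A x))))"
proof -
  have "A (P (P (A (P x)))) = A (P (A (Q (A x))))" using assms by (simp add: AQA)
  also have "\<dots> = Q (A (Q (Q (A x))))" using assms by (simp add: APA)
  finally show ?thesis .
qed

lemma AQQAQ: assumes "x \<in> S" shows "A (Q (Q (A (Q x)))) = P (A (P (P (A x))))"
proof -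
  have "A (Q (Q (A (Q x)))) = A (Q (A (P (A x))))" using assms by (simp add: APA)
  also have "\<dots> = P (A (P (P (A x))))" using assms by (simp add: AQA)
  finally show ?thesis .
qed

lemma PAPPAQQ: assumes "x \<in> S" shows "P (A (P (P (A (Q (Q x)))))) = A (Q (Q (A (P (P x)))))"
proof -
  have "P (A (P (P (A (Q (Q x)))))) = A (Q (Q (A (Q (Q (Q x))))))"
    using assms by (simp add: AQQAQ)
  also have "\<dots> = A (Q (Q (A (P (P x)))))" using assms by (simp add: QQQ)
  finally show ?thesis .
qed

lemma QAQQAPP: assumes "x \<in> S" shows "Q (A (Q (Q (A (P (P x)))))) = A (P (P (A (Q (Q x)))))"
proof -
  have "Q (A (Q (Q (A (P (P x)))))) = A (P (P (A (P (P (P x))))))"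
    using assms by (simp add: APPAP)
  also have "\<dots> = A (P (P (A (Q (Q x)))))" using assms by (simp add: PPP)
  finally show ?thesis .
qed

lemma QQAPPAQQ: assumes "x \<in> S"
  shows "Q (Q (A (P (P (A (Q (Q x))))))) = P (P (A (Q (Q (A (P (P x)))))))"
proof -
  have "Q (Q (A (P (P (A (Q (Q x))))))) = Q (Q (Q (A (Q (Q (A (P (P x))))))))"
    using assms by (simp add: QAQQAPP)
  also have "\<dots> = P (P (A (Q (Q (A (P (P x)))))))" using assms by (simp add: QQQ)
  finally show ?thesis .
qed

lemma APPAQQAP: assumes "x \<in> S"
  shows "A (P (P (A (Q (Q (A (P x))))))) = Q (A (P (P (A (Q (Q (A x)))))))"
proof -
  have "A (P (P (A (Q (Q (A (P x))))))) = Q (A (Q (Q (A (P (P (A (P x))))))))"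
    using assms by (simp add: QAQQAPP)
  also have "\<dots> = Q (A (Q (Q (Q (A (Q (Q (A x))))))))" using assms by (simp add: APPAP)
  also have "\<dots> = Q (A (P (P (A (Q (Q (A x)))))))" using assms by (simp add: QQQ)
  finally show ?thesis .
qed

lemma AQQAPPAQ: assumes "x \<in> S"
  shows "A (Q (Q (A (P (P (A (Q x))))))) = P (A (Q (Q (A (P (P (A x)))))))"
proof -
  have "A (Q (Q (A (P (P (A (Q x))))))) = P (A (P (P (A (Q (Q (A (Q x))))))))"
    using assms by (simp add: PAPPAQQ)
  also have "\<dots> = P (A (P (P (P (A (P (P (A x))))))))" using assms by (simp add: AQQAQ)
  also have "\<dots> = P (A (Q (Q (A (P (P (A x)))))))" using assms by (simp add: PPP)
  finally show ?thesis .
qed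

lemmas word_simps = PPP QQQ APA AQA APPAP AQQAQ PAPPAQQ QAQQAPP QQAPPAQQ APPAQQAP AQQAPPAQ

text \<open>
  With \<open>D\<close> for the cyclic group generated by \<open>P\<close>, of order 5, the icosahedral group is the union of
  the double cosets \<open>D\<close>, \<open>D A D\<close>, \<open>D A P\<^sup>2 A D\<close> and \<open>D A Z\<close>, of sizes 5, 25, 25, 5; the last one is a single coset
  because \<open>A Z\<close> inverts \<open>P\<close>.  The list runs through the corresponding points.
\<close>
definition rotations :: "'x \<Rightarrow> 'x list" where
  "rotations x = [x, P x, P (P x), Q (Q x), Q x]"

definition orbit_list :: "'x \<Rightarrow> 'x list" where
  "orbit_list x =
     rotations x @ concat (map (\<lambda>y. rotations (A y)) (rotations x)) @
     concat (map (\<lambda>y. rotations (A (P (P (A y))))) (rotations x)) @ rotations (A (Z x))"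

lemma length_orbit_list: "length (orbit_list x) = 60"
  by (simp add: orbit_list_def rotations_def)

text \<open>So the orbit of a point has at most 60 elements.\<close>
lemma orbit_list_P: "x \<in> S \<Longrightarrow> \<forall>y\<in>set (orbit_list x). P y \<in> set (orbit_list x)"
  by (simp add: orbit_list_def rotations_def Z_def word_simps)

lemma orbit_list_A: "x \<in> S \<Longrightarrow> \<forall>y\<in>set (orbit_list x). A y \<in> set (orbit_list x)"
  by (simp add: orbit_list_def rotations_def Z_def word_simps)

lemma Z_closed: "x \<in> S \<Longrightarrow> Z x \<in> S"
  by (simp add: Z_def)
lemma Z_Z: "x \<in> S \<Longrightarrow> Z (Z x) = x"
  by (simp add: Z_def word_simps)
lemma A_Z: "x \<in> S \<Longrightarrow> A (Z x) = Z (A x)"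
  by (simp add: Z_def word_simps)
lemma Z_P: "x \<in> S \<Longrightarrow> Z (P x) = A (Q (A (Z x)))"
  by (simp add: Z_def word_simps)
lemma T_A: "x \<in> S \<Longrightarrow> T (A x) = Z (T x)"
  by (simp add: Z_def T_def word_simps)
lemma T_Z: "x \<in> S \<Longrightarrow> T (Z x) = A (Z (T x))"
  by (simp add: Z_def T_def word_simps)
lemma T_T_T: "x \<in> S \<Longrightarrow> T (T (T x)) = x"
  by (simp add: T_def word_simps)

lemma orbit_list_closed: "x \<in> S \<Longrightarrow> set (orbit_list x) \<subseteq> S"
  by (simp add: orbit_list_def rotations_def Z_def)

lemma start_in_orbit_list: "x \<in> set (orbit_list x)"
  by (simp add: orbit_list_def rotations_def)

text \<open>
  The points \<open>g x\<close> for \<open>g\<close> in the class of \<open>P\<close>.  Each line is one orbit of \<open>K\<close> on the class, and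
  neighbouring entries are conjugate under \<open>A\<close>.
\<close>
definition class_list :: "'x \<Rightarrow> 'x list" where
  "class_list x =
     [P x, A (P (A x)), Q x, A (Q (A x)),
      P (P (A x)), A (P (P x)), Q (Q (A x)), A (Q (Q x)),
      P (A (Q (A x))), A (P (A (Q x))), Q (A (P (A x))), A (Q (A (P x)))]"

lemma distinct_class_list:
  assumes x: "x \<in> S" and d: "distinct (orbit_list x)"
  shows "distinct (class_list x)"
proof -
  \<comment> \<open>the positions in \<open>orbit_list x\<close> of the entries of \<open>class_list x\<close>\<close>
  let ?idx = "[1, 29, 4, 11, 7, 15, 8, 20, 12, 24, 28, 16] :: nat list"
  have "class_list x = map ((!) (orbit_list x)) ?idx"
    using x by (simp add: class_list_def orbit_list_def rotations_def word_simps)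
  moreover have "inj_on ((!) (orbit_list x)) (set ?idx)"
    by (rule inj_on_nth[OF d]) (simp add: length_orbit_list)
  ultimately show ?thesis by (simp only: distinct_map) simp
qed

end

section \<open>Groups of order 60 with icosahedral generators\<close>

text \<open>
  It suffices to assume that \<open>c\<close> is nontrivial: the relations then force the exact orders of \<open>\<alpha>\<close>, \<open>c\<close>
  and \<open>\<alpha> c\<close>, and the order 60 forces \<open>\<alpha>\<close> and \<open>c\<close> to generate.
\<close>
locale icosahedral_group = group +
  fixes \<alpha> c
  assumes order_60: "order G = 60"
    and alpha_closed [simp]: "\<alpha> \<in> carrier G" and c_closed [simp]: "c \<in> carrier G"
    and alpha_2: "\<alpha> \<otimes> \<alpha> = \<one>" and c_5: "c [^] (5::nat) = \<one>"
    and alpha_c_3: "(\<alpha> \<otimes> c) [^] (3::nat) = \<one>" and c_ne_one: "c \<noteq> \<one>"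
begin

lemma pair_of_action:
  assumes "\<And>g x. g \<in> carrier G \<Longrightarrow> x \<in> S \<Longrightarrow> \<tau> g x \<in> S"
    and "\<And>x. x \<in> S \<Longrightarrow> \<tau> \<one> x = x"
    and "\<And>g h x. g \<in> carrier G \<Longrightarrow> h \<in> carrier G \<Longrightarrow> x \<in> S \<Longrightarrow> \<tau> (g \<otimes> h) x = \<tau> g (\<tau> h x)"
  shows "icosahedral_pair S (\<tau> \<alpha>) (\<tau> c)"
proof
  fix x assume x: "x \<in> S"
  show "\<tau> \<alpha> x \<in> S" "\<tau> c x \<in> S" using assms(1) x by simp_all
  show "\<tau> \<alpha> (\<tau> \<alpha> x) = x" using assms(2,3) x alpha_2 by (metis alpha_closed)
  have "c [^] (5::nat) = c \<otimes> (c \<otimes> (c \<otimes> (c \<otimes> c)))"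
    by (simp add: numeral_eq_Suc m_assoc)
  then have "\<tau> (c \<otimes> (c \<otimes> (c \<otimes> (c \<otimes> c)))) x = x" using assms(2) c_5 x by simp
  then show "\<tau> c (\<tau> c (\<tau> c (\<tau> c (\<tau> c x)))) = x" using x assms(1,3) by simp
  have "(\<alpha> \<otimes> c) [^] (3::nat) = \<alpha> \<otimes> (c \<otimes> (\<alpha> \<otimes> (c \<otimes> (\<alpha> \<otimes> c))))"
    by (simp add: numeral_eq_Suc m_assoc)
  then have "\<tau> (\<alpha> \<otimes> (c \<otimes> (\<alpha> \<otimes> (c \<otimes> (\<alpha> \<otimes> c))))) x = x" using assms(2) alpha_c_3 x by simp
  then show "\<tau> \<alpha> (\<tau> c (\<tau> \<alpha> (\<tau> c (\<tau> \<alpha> (\<tau> c x))))) = x" using x assms(1,3) by simp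
qed

sublocale left: icosahedral_pair "carrier G" "\<lambda>x. \<alpha> \<otimes> x" "\<lambda>x. c \<otimes> x"
  by (rule pair_of_action) (simp_all add: m_assoc)

lemma finite_carrier: "finite (carrier G)"
  using order_60 order_gt_0_iff_finite by simp

lemma left_mult:
  assumes "x \<in> carrier G" "g \<in> carrier G"
  shows "left.Q x \<otimes> g = left.Q (x \<otimes> g)" "left.Z x \<otimes> g = left.Z (x \<otimes> g)"
  using assms by (simp_all add: left.Z_def left.Q_def m_assoc)

lemma Q_one: "left.Q \<one> = inv c"
proof -
  have "left.Q \<one> \<otimes> c = left.Q (c \<otimes> \<one>)" by (simp add: left_mult)
  also have "\<dots> = \<one>" by (rule left.Q_P) simp
  finally show ?thesis by (metis c_closed inv_equality left.Q_closed one_closed)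
qed

lemma ord_c: "ord c = 5"
proof -
  have "ord c dvd 5" using c_5 by (simp add: pow_eq_id)
  moreover have "ord c \<noteq> 1" using c_ne_one ord_eq_1 by simp
  moreover have "Factorial_Ring.prime (5::nat)" by simp
  ultimately show ?thesis by (metis prime_nat_iff)
qed

lemma c_c_ne_one: "c \<otimes> c \<noteq> \<one>"
proof
  assume "c \<otimes> c = \<one>"
  then have "c [^] (2::nat) = \<one>" by (simp add: numeral_eq_Suc)
  then have "ord c dvd 2" by (simp add: pow_eq_id)
  then show False using ord_c by simp
qed

lemma alpha_c_ne_one: "\<alpha> \<otimes> c \<noteq> \<one>"
proof
  assume "\<alpha> \<otimes> c = \<one>"
  then have "c = \<alpha>" by (metis alpha_2 alpha_closed c_closed l_cancel)
  then show False using alpha_2 c_c_ne_one by simp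
qed

lemma ord_alpha_c: "ord (\<alpha> \<otimes> c) = 3"
proof -
  have "ord (\<alpha> \<otimes> c) dvd 3" using alpha_c_3 by (simp add: pow_eq_id)
  moreover have "ord (\<alpha> \<otimes> c) \<noteq> 1" using alpha_c_ne_one ord_eq_1 by simp
  moreover have "Factorial_Ring.prime (3::nat)" by simp
  ultimately show ?thesis by (metis prime_nat_iff)
qed

text \<open>The involution written \<open>Z\<close> for maps, as a group element.\<close>
definition z :: 'a where "z = left.Z \<one>"

lemma z_closed [simp]: "z \<in> carrier G"
  by (simp add: z_def left.Z_closed)

lemma z_mult: "x \<in> carrier G \<Longrightarrow> z \<otimes> x = left.Z x"
  by (simp add: z_def left_mult)

lemma z_z: "z \<otimes> z = \<one>"
proof -
  have "z \<otimes> z = left.Z (left.Z \<one>)" by (simp only: z_mult z_closed z_def[symmetric])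
  then show ?thesis by (simp add: left.Z_Z)
qed

lemma alpha_z: "\<alpha> \<otimes> z = z \<otimes> \<alpha>"
proof -
  have "\<alpha> \<otimes> z = left.Z (\<alpha> \<otimes> \<one>)" unfolding z_def by (rule left.A_Z) simp
  then show ?thesis by (simp add: z_mult)
qed

lemma z_c_z: "z \<otimes> c \<otimes> z = \<alpha> \<otimes> inv c \<otimes> \<alpha>"
proof -
  have "z \<otimes> c \<otimes> z = left.Z (c \<otimes> z)" 
    by (simp only: m_assoc z_closed c_closed) (simp only: z_mult m_closed z_closed c_closed)
  also have "\<dots> = \<alpha> \<otimes> left.Q (\<alpha> \<otimes> left.Z z)" by (rule left.Z_P) simp
  also have "left.Z z = \<one>" using z_z z_mult by simp
  also have "left.Q (\<alpha> \<otimes> \<one>) = inv c \<otimes> \<alpha>" by (simp add: left_mult flip: Q_one)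
  finally show ?thesis by (simp add: m_assoc)
qed

text \<open>
  A collapse of the Klein four-group would collapse the group: conjugation by \<open>z\<close> takes \<open>c\<close> to
  \<open>\<alpha> c\<^sup>-\<^sup>1 \<alpha>\<close>, so \<open>z = 1\<close> gives \<open>(\<alpha> c)\<^sup>2 = 1\<close>, and \<open>z = \<alpha>\<close> gives \<open>c\<^sup>2 = 1\<close>.
\<close>
lemma z_ne_one: "z \<noteq> \<one>"
proof
  assume "z = \<one>"
  then have "c = \<alpha> \<otimes> inv c \<otimes> \<alpha>" using z_c_z by simp
  then have "\<alpha> \<otimes> c = inv c \<otimes> \<alpha>" by (metis alpha_2 alpha_closed c_closed inv_closed l_one m_assoc m_closed)
  then have "c \<otimes> \<alpha> \<otimes> c = \<alpha>" by (metis alpha_closed c_closed inv_closed m_assoc m_closed r_inv l_one)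
  then have "\<alpha> \<otimes> c \<otimes> (\<alpha> \<otimes> c) = \<one>" by (metis alpha_2 alpha_closed c_closed m_assoc m_closed)
  then have "(\<alpha> \<otimes> c) [^] (2::nat) = \<one>" by (simp add: numeral_eq_Suc)
  then have "ord (\<alpha> \<otimes> c) dvd 2" by (simp add: pow_eq_id)
  then show False using ord_alpha_c by simp
qed

lemma z_ne_alpha: "z \<noteq> \<alpha>"
proof
  assume "z = \<alpha>"
  then have "\<alpha> \<otimes> c \<otimes> \<alpha> = \<alpha> \<otimes> inv c \<otimes> \<alpha>" using z_c_z by simp
  then have "c = inv c" by simp
  then have "c \<otimes> c = \<one>" by (metis c_closed r_inv)
  then show False using c_c_ne_one by simp
qed

lemma alpha_ne_one: "\<alpha> \<noteq> \<one>"
proof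
  assume "\<alpha> = \<one>"
  then have "ord c = 3" using ord_alpha_c by simp
  then show False using ord_c by simp
qed

lemma klein_subgroup: "subgroup {\<one>, \<alpha>, z, \<alpha> \<otimes> z} G"
proof
  have a: "\<alpha> \<otimes> (\<alpha> \<otimes> x) = x" "z \<otimes> (z \<otimes> x) = x" if "x \<in> carrier G" for x
    using that alpha_2 z_z by (simp_all flip: m_assoc)
  have az: "\<alpha> \<otimes> (z \<otimes> x) = z \<otimes> (\<alpha> \<otimes> x)" if "x \<in> carrier G" for x
    using that alpha_z by (simp flip: m_assoc)
  show "{\<one>, \<alpha>, z, \<alpha> \<otimes> z} \<subseteq> carrier G" by simp
  show "\<one> \<in> {\<one>, \<alpha>, z, \<alpha> \<otimes> z}" by simp
  fix x y assume xy: "x \<in> {\<one>, \<alpha>, z, \<alpha> \<otimes> z}" "y \<in> {\<one>, \<alpha>, z, \<alpha> \<otimes> z}"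
  then show "x \<otimes> y \<in> {\<one>, \<alpha>, z, \<alpha> \<otimes> z}"
    by (elim insertE emptyE) (simp_all add: m_assoc a az alpha_z alpha_2 z_z)
  have "x \<in> carrier G" "x \<otimes> x = \<one>"
    using xy(1) by (auto simp add: m_assoc a az alpha_z alpha_2 z_z)
  then have "inv x = x" by (metis inv_equality)
  then show "inv x \<in> {\<one>, \<alpha>, z, \<alpha> \<otimes> z}" using xy by simp
qed

lemma card_klein: "card {\<one>, \<alpha>, z, \<alpha> \<otimes> z} = 4"
proof -
  have "\<alpha> \<otimes> z \<noteq> \<one>" using z_ne_alpha alpha_2 by (metis alpha_closed l_cancel z_closed)
  moreover have "\<alpha> \<otimes> z \<noteq> \<alpha>" using z_ne_one by simp
  moreover have "\<alpha> \<otimes> z \<noteq> z" using alpha_ne_one by simp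
  ultimately show ?thesis
    using z_ne_one z_ne_alpha alpha_ne_one by (auto simp: card_insert_if)
qed

lemma card_subgroup_dvd:
  assumes "subgroup K G" "subgroup H G" "K \<subseteq> H"
  shows "card K dvd card H"
proof -
  interpret H: group "G\<lparr>carrier := H\<rparr>" using assms(2) by (rule subgroup_imp_group)
  have "subgroup K (G\<lparr>carrier := H\<rparr>)"
    using assms by (simp add: subgroup_incl)
  from H.lagrange[OF this] have "card H = card (rcosets\<^bsub>G\<lparr>carrier := H\<rparr>\<^esub> K) * card K"
    by (simp add: order_def)
  then show ?thesis by simp
qed

text \<open>
  A subgroup containing \<open>\<alpha>\<close> and \<open>c\<close> contains the Klein four-group and elements of orders 3 and 5, so
  60 divides its order.
\<close>
lemma subgroup_eq_carrier:
  assumes H: "subgroup H G" and "\<alpha> \<in> H" "c \<in> H"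
  shows "H = carrier G"
proof -
  have Q: "left.Q x \<in> H" if "x \<in> H" for x
    using that assms by (simp add: left.Q_def subgroup.m_closed)
  have "z \<in> H" unfolding z_def left.Z_def
    by (intro subgroup.m_closed[OF H] Q subgroup.one_closed[OF H] assms)
  then have "{\<one>, \<alpha>, z, \<alpha> \<otimes> z} \<subseteq> H"
    using assms by (simp add: subgroup.one_closed subgroup.m_closed)
  then have "4 dvd card H" using card_subgroup_dvd[OF klein_subgroup H] card_klein by simp
  moreover have "3 dvd card H"
    using card_subgroup_dvd[OF generate_is_subgroup[of "{\<alpha> \<otimes> c}"] H] generate_pow_card[of "\<alpha> \<otimes> c"]
      generate_subgroup_incl[OF _ H, of "{\<alpha> \<otimes> c}"] ord_alpha_c assms by (simp add: subgroup.m_closed)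
  moreover have "5 dvd card H"
    using card_subgroup_dvd[OF generate_is_subgroup[of "{c}"] H] generate_pow_card[of c]
      generate_subgroup_incl[OF _ H, of "{c}"] ord_c assms by simp
  ultimately have "60 dvd card H" by presburger
  moreover have "H \<subseteq> carrier G" using H by (rule subgroup.subset)
  moreover have "card H > 0"
    using H finite_carrier by (metis card_gt_0_iff empty_iff finite_subset subgroup.one_closed subgroup.subset)
  ultimately have "card (carrier G) \<le> card H" using order_60 by (simp add: order_def dvd_imp_le)
  then show ?thesis using \<open>H \<subseteq> carrier G\<close> finite_carrier by (metis card_seteq)
qed

lemma generate_eq_carrier: "generate G {\<alpha>, \<alpha> \<otimes> c} = carrier G"
proof (rule subgroup_eq_carrier)
  let ?H = "generate G {\<alpha>, \<alpha> \<otimes> c}"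
  show H: "subgroup ?H G" by (rule generate_is_subgroup) simp
  show a: "\<alpha> \<in> ?H" by (rule generate.incl) simp
  have "\<alpha> \<otimes> (\<alpha> \<otimes> c) \<in> ?H" by (rule generate.eng[OF a generate.incl]) simp
  then show "c \<in> ?H" by simp
qed

lemma carrier_induct [consumes 1, case_names one alpha c]:
  assumes g: "g \<in> carrier G" and one: "R \<one>"
    and alpha: "\<And>h. h \<in> carrier G \<Longrightarrow> R h \<Longrightarrow> R (\<alpha> \<otimes> h)"
    and c: "\<And>h. h \<in> carrier G \<Longrightarrow> R h \<Longrightarrow> R (c \<otimes> h)"
  shows "R g"
proof -
  \<comment> \<open>The equivalence, instead of the implication from \<open>R h\<close> to \<open>R (g \<otimes> h)\<close>, makes the set closed under
    inverses.\<close>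
  let ?H = "{g \<in> carrier G. \<forall>h\<in>carrier G. R h \<longleftrightarrow> R (g \<otimes> h)}"
  have Q: "R (left.Q h)" if "h \<in> carrier G" "R h" for h
    unfolding left.Q_def by (intro c that m_closed c_closed)
  have "subgroup ?H G"
  proof
    fix x assume x: "x \<in> ?H"
    have "R h \<longleftrightarrow> R (inv x \<otimes> h)" if "h \<in> carrier G" for h
    proof -
      have "inv x \<otimes> h \<in> carrier G" "x \<otimes> (inv x \<otimes> h) = h" using x that by (simp_all flip: m_assoc)
      then show ?thesis using x by fastforce
    qed
    then show "inv x \<in> ?H" using x by blast
  qed (auto simp: m_assoc)
  moreover have "\<alpha> \<in> ?H" using alpha by auto (metis left.A_A left.A_closed)
  moreover have "c \<in> ?H" using c by auto (metis Q left.P_closed left.Q_P)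
  ultimately have "?H = carrier G" by (rule subgroup_eq_carrier)
  with g have "\<forall>h\<in>carrier G. R h \<longleftrightarrow> R (g \<otimes> h)" by blast
  from bspec[OF this one_closed] show ?thesis using g one by simp
qed

lemma orbit_list_one: "set (left.orbit_list \<one>) = carrier G"
proof
  show "set (left.orbit_list \<one>) \<subseteq> carrier G" by (rule left.orbit_list_closed) simp
  show "carrier G \<subseteq> set (left.orbit_list \<one>)"
  proof
    fix g assume "g \<in> carrier G"
    then show "g \<in> set (left.orbit_list \<one>)"
    proof (induction rule: carrier_induct)
      case one show ?case by (rule left.start_in_orbit_list)
    next
      case (alpha h) then show ?case using bspec[OF left.orbit_list_A[OF one_closed]] by blast
    next
      case (c h) then show ?case using bspec[OF left.orbit_list_P[OF one_closed]] by blast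
    qed
  qed
qed

text \<open>A list of length 60 that exhausts a set of 60 elements has no repetitions.\<close>
lemma distinct_class_list_one: "distinct (left.class_list \<one>)"
proof (rule left.distinct_class_list)
  show "distinct (left.orbit_list \<one>)"
    by (rule card_distinct)
      (simp only: orbit_list_one left.length_orbit_list order_60[unfolded order_def])
qed simp

text \<open>
  The listed words are closed under conjugation by \<open>\<alpha>\<close> and \<open>c\<close>, and each of them is reached from \<open>c\<close> by
  conjugation with \<open>\<alpha>\<close>, \<open>c\<close> and \<open>z\<close>.  The element \<open>z\<close> serves to reach \<open>c\<^sup>-\<^sup>1\<close>.  Multiplication of a
  word by \<open>g\<close> from the right replaces its last letter \<open>\<one>\<close> by \<open>g\<close>.
\<close>
lemma conj_class_eq: "conj_class G c = set (left.class_list \<one>)"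
proof
  let ?E = "set (left.class_list \<one>)" and ?K = "conj_class G c"
  have inv_alpha: "inv \<alpha> = \<alpha>" using alpha_2 by (metis alpha_closed inv_equality)
  \<comment> \<open>A word that ends in the opaque constant \<open>u\<close> instead of \<open>\<one>\<close> keeps its shape under
    simplification, so that the rewrite rules for words still match it.\<close>
  obtain u where u: "u = \<one>" by blast
  then have u_closed [simp]: "u \<in> carrier G" and u_mult [simp]: "\<And>x. x \<in> carrier G \<Longrightarrow> u \<otimes> x = x"
    by simp_all
  have E_closed: "?E \<subseteq> carrier G" by (simp add: left.class_list_def)
  have E_conj: "\<forall>e\<in>?E. \<alpha> \<otimes> (e \<otimes> (\<alpha> \<otimes> \<one>)) \<in> ?E \<and> c \<otimes> (e \<otimes> left.Q \<one>) \<in> ?E"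
    unfolding u[symmetric] by (simp add: left.class_list_def m_assoc left_mult left.word_simps)
  have conj_E: "g \<otimes> e \<otimes> inv g \<in> ?E" if "g \<in> carrier G" "e \<in> ?E" for g e
    using that(1)
  proof (induction rule: carrier_induct)
    case one
    then show ?case using that E_closed by auto
  next
    case (alpha h)
    have "\<alpha> \<otimes> h \<otimes> e \<otimes> inv (\<alpha> \<otimes> h) = \<alpha> \<otimes> (h \<otimes> e \<otimes> inv h \<otimes> (\<alpha> \<otimes> \<one>))"
      using alpha that E_closed by (simp add: inv_mult_group inv_alpha m_assoc subset_iff)
    then show ?case using E_conj alpha by simp
  next
    case (c h)
    have "c \<otimes> h \<otimes> e \<otimes> inv (c \<otimes> h) = c \<otimes> (h \<otimes> e \<otimes> inv h \<otimes> left.Q \<one>)"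
      using c that E_closed by (simp add: inv_mult_group Q_one m_assoc subset_iff)
    then show ?case using E_conj c by simp
  qed
  have c_E: "c \<in> ?E" by (simp add: left.class_list_def)
  show "?K \<subseteq> ?E" unfolding conj_class_def using conj_E[OF _ c_E] by blast
  have K_closed: "?K \<subseteq> carrier G" by (auto simp: conj_class_def)
  have K_conj: "g \<otimes> e \<otimes> inv g \<in> ?K" if "g \<in> carrier G" "e \<in> ?K" for g e
  proof -
    obtain h where h: "h \<in> carrier G" "e = h \<otimes> c \<otimes> inv h" using \<open>e \<in> ?K\<close> by (auto simp: conj_class_def)
    then have "g \<otimes> e \<otimes> inv g = (g \<otimes> h) \<otimes> c \<otimes> inv (g \<otimes> h)"
      using \<open>g \<in> carrier G\<close> by (simp add: m_assoc inv_mult_group)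
    then show ?thesis using h \<open>g \<in> carrier G\<close> by (auto simp: conj_class_def)
  qed
  have K_alpha: "\<alpha> \<otimes> (e \<otimes> (\<alpha> \<otimes> u)) \<in> ?K" if "e \<in> ?K" for e
    using K_conj[OF alpha_closed that] that K_closed by (auto simp: u inv_alpha m_assoc subset_iff)
  have K_c: "c \<otimes> (e \<otimes> left.Q u) \<in> ?K" if "e \<in> ?K" for e
    using K_conj[OF c_closed that] that K_closed by (auto simp: u Q_one m_assoc subset_iff)
  have K_Q: "left.Q (e \<otimes> (c \<otimes> u)) \<in> ?K" if "e \<in> ?K" for e
  proof -
    have "left.Q (e \<otimes> (c \<otimes> u)) = inv c \<otimes> (e \<otimes> (c \<otimes> \<one>))"
      using that K_closed by (simp add: subset_iff u left_mult flip: Q_one)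
    then show ?thesis
      using K_conj[of "inv c" e] that K_closed by (auto simp: u m_assoc subset_iff)
  qed
  note word = m_assoc left_mult left.word_simps
  have "\<one> \<otimes> c \<otimes> inv \<one> \<in> ?K" unfolding conj_class_def by blast
  then have c0: "c \<otimes> u \<in> ?K" by (simp add: u)
  have c1: "\<alpha> \<otimes> (c \<otimes> (\<alpha> \<otimes> u)) \<in> ?K"
    using K_alpha[OF c0] by (simp add: word)
  have c2: "\<alpha> \<otimes> (left.Q (left.Q u)) \<in> ?K"
    using K_c[OF c1] by (simp add: word)
  have c3: "left.Q (left.Q (\<alpha> \<otimes> u)) \<in> ?K"
    using K_Q[OF c1] by (simp add: word)
  have c4: "c \<otimes> (\<alpha> \<otimes> (left.Q (\<alpha> \<otimes> u))) \<in> ?K"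
    using K_Q[OF c3] by (simp add: word)
  have c5: "\<alpha> \<otimes> (c \<otimes> (\<alpha> \<otimes> (left.Q u))) \<in> ?K"
    using K_alpha[OF c4] by (simp add: word)
  have "z \<otimes> c \<otimes> inv z \<in> ?K" unfolding conj_class_def using z_closed by blast
  moreover have "inv z = z" using z_z by (metis z_closed inv_equality)
  moreover have "\<alpha> \<otimes> left.Q (\<alpha> \<otimes> u) = \<alpha> \<otimes> inv c \<otimes> \<alpha>"
    by (simp add: u left_mult m_assoc flip: Q_one)
  ultimately have d1: "\<alpha> \<otimes> left.Q (\<alpha> \<otimes> u) \<in> ?K" using z_c_z by simp
  have d0: "left.Q u \<in> ?K"
    using K_alpha[OF d1] by (simp add: word)
  have d2: "\<alpha> \<otimes> (c \<otimes> (c \<otimes> u)) \<in> ?K"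
    using K_Q[OF d1] by (simp add: word)
  have d3: "c \<otimes> (c \<otimes> (\<alpha> \<otimes> u)) \<in> ?K"
    using K_c[OF d1] by (simp add: word)
  have d4: "left.Q (\<alpha> \<otimes> (c \<otimes> (\<alpha> \<otimes> u))) \<in> ?K"
    using K_c[OF d3] by (simp add: word)
  have d5: "\<alpha> \<otimes> (left.Q (\<alpha> \<otimes> (c \<otimes> u))) \<in> ?K"
    using K_alpha[OF d4] by (simp add: word)
  show "?E \<subseteq> ?K"
    unfolding u[symmetric] left.class_list_def
    using c0 c1 c2 c3 c4 c5 d0 d1 d2 d3 d4 d5 by simp
qed

text \<open>
  This is the statement that \<open>\<alpha>\<^sup>2 = c\<^sup>5 = (\<alpha>c)\<^sup>3 = 1\<close> is a presentation of the group.  The maps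
  \<open>(\<alpha> g, A x)\<close> and \<open>(c g, P x)\<close> on pairs satisfy the relations, so the orbit of \<open>(\<one>, x)\<close> has at most 60
  elements.  Its projection to the group is surjective, hence injective: the orbit is the graph of
  the function that sends \<open>g\<close> to \<open>g x\<close>.
\<close>
theorem action_of_pair:
  assumes "icosahedral_pair S A P"
  obtains \<tau> where "\<And>g x. g \<in> carrier G \<Longrightarrow> x \<in> S \<Longrightarrow> \<tau> g x \<in> S"
    and "\<And>x. x \<in> S \<Longrightarrow> \<tau> \<one> x = x"
    and "\<And>g h x. g \<in> carrier G \<Longrightarrow> h \<in> carrier G \<Longrightarrow> x \<in> S \<Longrightarrow> \<tau> (g \<otimes> h) x = \<tau> g (\<tau> h x)"
    and "\<And>x. x \<in> S \<Longrightarrow> \<tau> \<alpha> x = A x" and "\<And>x. x \<in> S \<Longrightarrow> \<tau> c x = P x"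
proof -
  interpret S: icosahedral_pair S A P by fact
  interpret both: icosahedral_pair "carrier G \<times> S"
    "\<lambda>(g, x). (\<alpha> \<otimes> g, A x)" "\<lambda>(g, x). (c \<otimes> g, P x)"
    by unfold_locales (auto simp: S.P_5 S.AP_3 left.P_5 left.AP_3)
  define graph where "graph x = set (both.orbit_list (\<one>, x))" for x
  have graph_closed: "(\<one>, x) \<in> graph x" "graph x \<subseteq> carrier G \<times> S"
    "(g, y) \<in> graph x \<Longrightarrow> (\<alpha> \<otimes> g, A y) \<in> graph x"
    "(g, y) \<in> graph x \<Longrightarrow> (c \<otimes> g, P y) \<in> graph x" if "x \<in> S" for x g y
    using that both.start_in_orbit_list[of "(\<one>, x)"] both.orbit_list_closed[of "(\<one>, x)"]
      both.orbit_list_A[of "(\<one>, x)"] both.orbit_list_P[of "(\<one>, x)"]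
    unfolding graph_def by auto
  have ex: "\<exists>y. (g, y) \<in> graph x" if "x \<in> S" "g \<in> carrier G" for x g
    using that(2) by (induction rule: carrier_induct) (use graph_closed[OF that(1)] in blast)+
  have inj: "inj_on fst (graph x)" if "x \<in> S" for x
  proof (rule eq_card_imp_inj_on)
    show "finite (graph x)" by (simp add: graph_def)
    have "fst ` graph x = carrier G" using ex[OF that] graph_closed(2)[OF that] by force
    moreover have "card (graph x) \<le> 60"
      unfolding graph_def by (metis both.length_orbit_list card_length)
    ultimately show "card (fst ` graph x) = card (graph x)"
      using order_60 card_image_le[OF \<open>finite (graph x)\<close>, of fst] by (simp add: order_def)
  qed
  define \<tau> where "\<tau> g x = (THE y. (g, y) \<in> graph x)" for g x
  have eq: "\<tau> g x = y" if "x \<in> S" "(g, y) \<in> graph x" for g x y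
    unfolding \<tau>_def using that inj_onD[OF inj[OF that(1)]] by (intro the_equality) force+
  have graph_tau: "(g, \<tau> g x) \<in> graph x" if "x \<in> S" "g \<in> carrier G" for g x
    using ex[OF that] eq[OF that(1)] by blast
  have step: "\<tau> (\<alpha> \<otimes> g) x = A (\<tau> g x)" "\<tau> (c \<otimes> g) x = P (\<tau> g x)" if "x \<in> S" "g \<in> carrier G" for g x
    using graph_closed(3,4)[OF that(1) graph_tau[OF that]] eq[OF that(1)] by simp_all
  have one: "\<tau> \<one> x = x" if "x \<in> S" for x
    using eq that graph_closed(1) by blast
  have closed: "\<tau> g x \<in> S" if "x \<in> S" "g \<in> carrier G" for g x
    using graph_tau[OF that] graph_closed(2)[OF that(1)] by blast
  have mult: "\<tau> (g \<otimes> h) x = \<tau> g (\<tau> h x)"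
    if "x \<in> S" "g \<in> carrier G" "h \<in> carrier G" for g h x
    using that(2) by (induction rule: carrier_induct)
      (use that(1,3) in \<open>simp_all add: one closed step m_assoc\<close>)
  show thesis
    by (rule that[of \<tau>]) (use closed one mult step[of _ \<one>] in simp_all)
qed

end

section \<open>Modules annihilated by the sum of a Klein four-group\<close>

text \<open>
  The maps \<open>A\<close>, \<open>P\<close>, \<open>Z\<close> are the actions of \<open>\<alpha>\<close>, \<open>c\<close>, \<open>z\<close>, and the comments below use the latter names.  The
  last hypothesis is what the dimension argument provides; it is kept separate from dimension, so
  that everything in this part is linear algebra over the group ring.
\<close>
locale icosahedral_module = comm_group V + icosahedral_pair "carrier V" A P
  for V :: "'a monoid" (structure) and A P +
  assumes A_mult [simp]: "\<lbrakk>x \<in> carrier V; y \<in> carrier V\<rbrakk> \<Longrightarrow> A (x \<otimes> y) = A x \<otimes> A y"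
    and P_mult [simp]: "\<lbrakk>x \<in> carrier V; y \<in> carrier V\<rbrakk> \<Longrightarrow> P (x \<otimes> y) = P x \<otimes> P y"
    and no_2_torsion: "\<lbrakk>x \<in> carrier V; x \<otimes> x = \<one>\<rbrakk> \<Longrightarrow> x = \<one>"
    and klein_sum: "x \<in> carrier V \<Longrightarrow> x \<otimes> A x \<otimes> Z x \<otimes> A (Z x) = \<one>"
begin

lemma A_inv [simp]: "x \<in> carrier V \<Longrightarrow> A (inv x) = inv (A x)"
  and P_inv [simp]: "x \<in> carrier V \<Longrightarrow> P (inv x) = inv (P x)"
proof -
  have "group_hom V V A" "group_hom V V P"
    by (unfold_locales) (auto simp: hom_def)
  then show "x \<in> carrier V \<Longrightarrow> A (inv x) = inv (A x)"
    and "x \<in> carrier V \<Longrightarrow> P (inv x) = inv (P x)"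
    by (simp_all add: group_hom.hom_inv)
qed

lemma Q_mult [simp]: "\<lbrakk>x \<in> carrier V; y \<in> carrier V\<rbrakk> \<Longrightarrow> Q (x \<otimes> y) = Q x \<otimes> Q y"
  and Q_inv [simp]: "x \<in> carrier V \<Longrightarrow> Q (inv x) = inv (Q x)"
  by (simp_all add: Q_def)

lemma Z_inv: "x \<in> carrier V \<Longrightarrow> Z (inv x) = inv (Z x)"
  by (simp add: Z_def)

text \<open>
  \<open>p\<close> is \<open>1 + \<alpha>\<close>, the trace of \<open>\<alpha>\<close>, and \<open>\<psi>\<close> turns out to be the action of \<open>\<phi>\<close> on \<open>L\<close>
  (\<open>\<psi>_\<psi>\<close>, \<open>class_sum\<close>).
\<close>
definition L :: "'a set" where "L = {x \<in> carrier V. A x = x}"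

definition p :: "'a \<Rightarrow> 'a" where "p x = x \<otimes> A x"

definition \<psi> :: "'a \<Rightarrow> 'a" where "\<psi> x = p (P x)"

lemma L_carrier: "x \<in> L \<Longrightarrow> x \<in> carrier V" and A_L: "x \<in> L \<Longrightarrow> A x = x"
  by (simp_all add: L_def)

lemma p_closed [simp]: "x \<in> carrier V \<Longrightarrow> p x \<in> carrier V"
  by (simp add: p_def)

lemma p_in_L: "x \<in> carrier V \<Longrightarrow> p x \<in> L"
  by (simp add: L_def p_def m_comm)

lemma p_mult: "\<lbrakk>x \<in> carrier V; y \<in> carrier V\<rbrakk> \<Longrightarrow> p (x \<otimes> y) = p x \<otimes> p y"
  by (simp add: p_def m_ac)

lemma p_inv: "x \<in> carrier V \<Longrightarrow> p (inv x) = inv (p x)"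
  by (simp add: p_def inv_mult)

lemma p_A: "x \<in> carrier V \<Longrightarrow> p (A x) = p x"
  by (simp add: p_def m_comm)

lemma \<psi>_closed [simp]: "x \<in> carrier V \<Longrightarrow> \<psi> x \<in> carrier V"
  and \<psi>_in_L: "x \<in> carrier V \<Longrightarrow> \<psi> x \<in> L"
  and \<psi>_mult: "\<lbrakk>x \<in> carrier V; y \<in> carrier V\<rbrakk> \<Longrightarrow> \<psi> (x \<otimes> y) = \<psi> x \<otimes> \<psi> y"
  by (simp_all add: \<psi>_def p_in_L p_mult)

lemma p_L: "x \<in> L \<Longrightarrow> p x = x \<otimes> x"
  by (simp add: p_def A_L)

lemma p_Z: assumes "x \<in> carrier V" shows "p (Z x) = inv (p x)"
proof -
  have "p (Z x) \<otimes> p x = \<one>"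
    using klein_sum[OF assms] assms by (simp add: p_def Z_closed m_ac)
  then show ?thesis using assms by (metis inv_equality Z_closed p_closed)
qed

lemma mult_inv_eq_one: "\<lbrakk>x \<in> carrier V; y \<in> carrier V\<rbrakk> \<Longrightarrow> x \<otimes> inv y = \<one> \<longleftrightarrow> x = y"
  using inv_solve_right[of \<one> x y] by auto

lemma square_cancel:
  assumes "x \<in> carrier V" "y \<in> carrier V" "x \<otimes> x = y \<otimes> y" shows "x = y"
proof -
  have "(x \<otimes> inv y) \<otimes> (x \<otimes> inv y) = (x \<otimes> x) \<otimes> inv (y \<otimes> y)"
    using assms(1,2) by (simp add: inv_mult m_ac)
  then have "(x \<otimes> inv y) \<otimes> (x \<otimes> inv y) = \<one>" using assms by simp
  then have "x \<otimes> inv y = \<one>" using assms(1,2) no_2_torsion[of "x \<otimes> inv y"] by blast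
  then show ?thesis using assms by (simp add: mult_inv_eq_one)
qed

text \<open>On \<open>L\<close> the vanishing sum reads \<open>2x + 2zx = 0\<close>.\<close>
lemma Z_L: assumes "x \<in> L" shows "Z x = inv x"
proof -
  have x: "x \<in> carrier V" using assms by (rule L_carrier)
  have "(Z x \<otimes> x) \<otimes> (Z x \<otimes> x) = \<one>"
    using klein_sum[OF x] x assms by (simp add: A_Z A_L Z_closed m_ac)
  then have "Z x \<otimes> x = \<one>" using no_2_torsion[of "Z x \<otimes> x"] x Z_closed by blast
  then show ?thesis using x Z_closed by (metis inv_equality)
qed

text \<open>
  The elements \<open>c\<close> and \<open>c\<^sup>-\<^sup>1\<close> lie in the same double coset of \<open>K\<close>, because \<open>\<alpha> c\<^sup>-\<^sup>1 \<alpha> = z c z\<close>; the two signs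
  that \<open>z\<close> contributes cancel.
\<close>
lemma p_Q: assumes "x \<in> L" shows "p (Q x) = \<psi> x"
proof -
  have x: "x \<in> carrier V" using assms by (rule L_carrier)
  have "A (Q (A x)) = Z (P (Z x))" using x by (simp add: Z_def word_simps)
  then have "A (Q x) = inv (Z (P x))"
    using x assms by (simp add: A_L Z_L Z_inv)
  then have "p (A (Q x)) = p (P x)"
    using x by (simp add: p_inv p_Z Z_closed)
  then show ?thesis using x by (simp add: p_A \<psi>_def)
qed

text \<open>Here \<open>c \<alpha> c\<^sup>-\<^sup>1 = z (\<alpha> c\<^sup>-\<^sup>1 \<alpha> c \<alpha>) z\<close>.\<close>
lemma p_PAQ: assumes "x \<in> L" shows "p (P (A (Q x))) = p (Q (A (P x)))"
proof -
  have x: "x \<in> carrier V" using assms by (rule L_carrier)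
  have "P (A (Q (Z x))) = Z (A (Q (A (P (A x)))))" using x by (simp add: Z_def word_simps)
  then have "inv (P (A (Q x))) = Z (A (Q (A (P x))))"
    using x assms by (simp add: A_L Z_L)
  then have "inv (p (P (A (Q x)))) = inv (p (Q (A (P x))))"
    using x p_inv[of "P (A (Q x))"] by (simp add: p_Z p_A)
  then have "inv (inv (p (P (A (Q x))))) = inv (inv (p (Q (A (P x)))))" by simp
  then show ?thesis using x by simp
qed

text \<open>
  The equation \<open>p c (1 + \<alpha> + z + \<alpha>z) c = 0\<close> on \<open>L\<close>, with its four terms brought into standard form by
  moving elements of \<open>K\<close> to the ends.
\<close>
lemma relation1: assumes "x \<in> L"
  shows "p (P (P x)) \<otimes> \<psi> x = p (Q (A (P x))) \<otimes> (x \<otimes> x)"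
proof -
  have x: "x \<in> carrier V" using assms by (rule L_carrier)
  have "p (P (P x \<otimes> A (P x) \<otimes> Z (P x) \<otimes> A (Z (P x)))) = p (P \<one>)"
    using klein_sum[of "P x"] x by simp
  moreover have "P \<one> = \<one>" "p \<one> = \<one>" using P_mult[of \<one> \<one>] A_mult[of \<one> \<one>] by (simp_all add: p_def)
  moreover have "P (A (P x)) = A (Q (A x))" "P (Z (P x)) = Z (A (Q (A (P x))))"
    "P (A (Z (P x))) = Z (A x)" using x by (simp_all add: Z_def word_simps)
  ultimately have "p (P (P x)) \<otimes> \<psi> x \<otimes> inv (p (Q (A (P x)))) \<otimes> inv (x \<otimes> x) = \<one>"
    using x assms by (simp add: p_mult Z_closed p_A p_Z A_L p_Q p_L)
  then have "p (P (P x)) \<otimes> \<psi> x \<otimes> inv (p (Q (A (P x))) \<otimes> (x \<otimes> x)) = \<one>"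
    using x by (simp add: inv_mult \<psi>_def m_ac)
  then show ?thesis using x by (simp add: mult_inv_eq_one \<psi>_def)
qed

text \<open>
  The equation \<open>p c (1 + \<alpha> + z + \<alpha>z) c\<^sup>-\<^sup>2 = 0\<close> on \<open>L\<close>.  The term \<open>p c \<alpha> c\<^sup>-\<^sup>2\<close> vanishes: \<open>c \<alpha> c\<^sup>-\<^sup>2\<close> normalises \<open>K\<close>
  and maps \<open>L\<close> to another eigenspace of \<open>K\<close>, on which \<open>\<alpha>\<close> is \<open>-1\<close>.
\<close>
lemma relation2: assumes "x \<in> L"
  shows "\<psi> x = p (Q (A (P x))) \<otimes> p (P (P x))"
proof -
  have x: "x \<in> carrier V" using assms by (rule L_carrier)
  have "p (P (Q (Q x) \<otimes> A (Q (Q x)) \<otimes> Z (Q (Q x)) \<otimes> A (Z (Q (Q x))))) = p (P \<one>)"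
    using klein_sum[of "Q (Q x)"] x by simp
  moreover have "P \<one> = \<one>" "p \<one> = \<one>" using P_mult[of \<one> \<one>] A_mult[of \<one> \<one>] by (simp_all add: p_def)
  moreover have "P (Z (Q (Q x))) = Z (P (A (Q x)))" "P (A (Z (Q (Q x)))) = Z (A (P (P x)))"
    using x by (simp_all add: Z_def word_simps)
  moreover have "p (P (A (Q (Q x)))) = \<one>"
  proof (rule no_2_torsion)
    have "P (A (Q (Q x))) = A (Z (P (A (Q (Q (A x))))))" using x by (simp add: Z_def word_simps)
    then have "p (P (A (Q (Q x)))) = inv (p (P (A (Q (Q x)))))"
      using x assms by (metis A_L A_closed P_closed Q_closed Z_closed p_A p_Z)
    then show "p (P (A (Q (Q x)))) \<otimes> p (P (A (Q (Q x)))) = \<one>"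
      using x by (metis A_closed P_closed Q_closed p_closed r_inv)
  qed (use x in simp)
  ultimately have "\<psi> x \<otimes> inv (p (P (A (Q x)))) \<otimes> inv (p (P (P x))) = \<one>"
    using x assms by (simp add: p_mult Z_closed p_A p_Z A_L p_Q p_L)
  then have "\<psi> x \<otimes> inv (p (Q (A (P x))) \<otimes> p (P (P x))) = \<one>"
    using x assms by (simp add: inv_mult \<psi>_def m_ac p_PAQ)
  then show ?thesis using x by (simp add: mult_inv_eq_one \<psi>_def)
qed

text \<open>Eliminating the third operator from both relations leaves \<open>2pc\<^sup>2 = 2\<close>.\<close>
lemma p_P_P: assumes "x \<in> L" shows "p (P (P x)) = x"
proof -
  have x: "x \<in> carrier V" using assms by (rule L_carrier)
  let ?u = "p (P (P x))" and ?w = "p (Q (A (P x)))"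
  have "?w \<otimes> (?u \<otimes> ?u) = ?w \<otimes> (x \<otimes> x)"
    using relation1[OF assms] relation2[OF assms] x by (simp add: m_ac)
  then have "?u \<otimes> ?u = x \<otimes> x" using x by simp
  from square_cancel[OF _ x this] x show ?thesis by simp
qed

text \<open>As for \<open>c\<close>, since \<open>\<alpha> c\<^sup>-\<^sup>2 \<alpha> = z c\<^sup>2 z\<close>.\<close>
lemma p_Q_Q: assumes "x \<in> L" shows "p (Q (Q x)) = x"
proof -
  have x: "x \<in> carrier V" using assms by (rule L_carrier)
  have "A (Q (Q (A x))) = Z (P (P (Z x)))" using x by (simp add: Z_def word_simps)
  then have "A (Q (Q x)) = inv (Z (P (P x)))"
    using x assms by (simp add: A_L Z_L Z_inv)
  then have "p (A (Q (Q x))) = p (P (P x))"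
    using x by (simp add: p_inv p_Z Z_closed)
  then show ?thesis using x assms by (simp add: p_A p_P_P)
qed

lemma p_QAP: assumes "x \<in> L" shows "p (Q (A (P x))) \<otimes> x = \<psi> x"
  using relation2[OF assms] by (simp add: p_P_P assms)

text \<open>\<open>\<psi>\<^sup>2 = p c (1 + \<alpha>) c = p c\<^sup>2 + p c \<alpha> c\<close>, and \<open>c \<alpha> c = \<alpha> c\<^sup>-\<^sup>1 \<alpha>\<close>.\<close>
lemma \<psi>_\<psi>: assumes "x \<in> L" shows "\<psi> (\<psi> x) = \<psi> x \<otimes> x"
proof -
  have x: "x \<in> carrier V" using assms by (rule L_carrier)
  have "\<psi> (\<psi> x) = p (P (P x)) \<otimes> p (P (A (P x)))"
    using x by (simp add: \<psi>_def p_mult p_def[of "P x"])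
  also have "P (A (P x)) = A (Q x)" using x AQA[of x] assms by (simp add: A_L)
  finally show ?thesis using x assms by (simp add: p_A p_Q p_P_P m_comm)
qed

text \<open>
  The class is made of the pairs \<open>g\<close>, \<open>\<alpha> g \<alpha>\<close> for \<open>g\<close> in \<open>c\<close>, \<open>c\<^sup>-\<^sup>1\<close>, \<open>c\<^sup>2\<alpha>\<close>, \<open>c\<^sup>-\<^sup>2\<alpha>\<close>, \<open>c \<alpha> c\<^sup>-\<^sup>1 \<alpha>\<close>, \<open>c\<^sup>-\<^sup>1 \<alpha> c \<alpha>\<close>,
  and \<open>g + \<alpha> g \<alpha> = p g\<close> on \<open>L\<close>.  So the class sum is \<open>2\<psi> + 2 + 2(\<psi> - 1)\<close>.
\<close>
lemma class_sum:
  assumes "x \<in> L"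
  shows "foldr (\<otimes>) (class_list x) \<one> = (\<psi> x \<otimes> \<psi> x) \<otimes> (\<psi> x \<otimes> \<psi> x)"
proof -
  have x: "x \<in> carrier V" using assms by (rule L_carrier)
  have "foldr (\<otimes>) (class_list x) \<one> =
      (p (P x) \<otimes> p (Q x)) \<otimes> (p (P (P x)) \<otimes> p (Q (Q x))) \<otimes> (p (P (A (Q x))) \<otimes> p (Q (A (P x))))"
    using x assms by (simp add: class_list_def p_def A_L m_assoc)
  also have "\<dots> = (\<psi> x \<otimes> \<psi> x) \<otimes> ((p (Q (A (P x))) \<otimes> x) \<otimes> (p (Q (A (P x))) \<otimes> x))"
    using x assms by (simp add: p_Q p_P_P p_Q_Q p_PAQ \<psi>_def[of x, symmetric] m_ac)
  finally show ?thesis by (simp add: p_QAP assms)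
qed

text \<open>\<open>B\<close> is the action of \<open>\<gamma> = \<alpha> c\<close>.\<close>
definition B :: "'a \<Rightarrow> 'a" where "B x = A (P x)"

definition \<theta> :: "'a \<Rightarrow> 'a \<Rightarrow> 'a \<Rightarrow> 'a" where "\<theta> x y w = B (B x) \<otimes> B y \<otimes> w"

lemma B_closed [simp]: "x \<in> carrier V \<Longrightarrow> B x \<in> carrier V"
  and B_mult [simp]: "\<lbrakk>x \<in> carrier V; y \<in> carrier V\<rbrakk> \<Longrightarrow> B (x \<otimes> y) = B x \<otimes> B y"
  and B_B_B [simp]: "x \<in> carrier V \<Longrightarrow> B (B (B x)) = x"
  by (simp_all add: B_def AP_3)

lemma B_inv [simp]: "x \<in> carrier V \<Longrightarrow> B (inv x) = inv (B x)"
  by (simp add: B_def)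

lemma \<psi>_inv: "x \<in> carrier V \<Longrightarrow> \<psi> (inv x) = inv (\<psi> x)"
  by (simp add: \<psi>_def p_inv)

lemma p_B: "x \<in> carrier V \<Longrightarrow> p (B x) = \<psi> x"
  by (simp add: B_def p_A \<psi>_def)

lemma p_B_B: assumes "x \<in> L" shows "p (B (B x)) = \<psi> x"
proof -
  have x: "x \<in> carrier V" using assms by (rule L_carrier)
  have "B (B x) = Q (A x)" using x by (simp add: B_def word_simps)
  then show ?thesis using assms by (simp add: A_L p_Q)
qed

lemma A_eq_p: "x \<in> carrier V \<Longrightarrow> A x = inv x \<otimes> p x"
  by (simp add: p_def flip: m_assoc)

lemma L_one: "\<one> \<in> L" and L_mult: "\<lbrakk>x \<in> L; y \<in> L\<rbrakk> \<Longrightarrow> x \<otimes> y \<in> L"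
  and L_inv: "x \<in> L \<Longrightarrow> inv x \<in> L"
  using A_mult[of \<one> \<one>] by (simp_all add: L_def)

lemma subgroup_L: "subgroup L V"
  by (rule subgroupI) (use L_one L_mult L_inv L_carrier in auto)

lemma B_\<theta>: "\<lbrakk>x \<in> carrier V; y \<in> carrier V; w \<in> carrier V\<rbrakk> \<Longrightarrow> B (\<theta> x y w) = \<theta> y w x"
  by (simp add: \<theta>_def m_ac)

text \<open>
  The matrix of \<open>\<alpha>\<close> in the definition of \<open>Icosa(R)\<close>, read off from \<open>\<alpha> v = -v + p v\<close> and from
  \<open>p \<gamma> = p \<gamma>\<^sup>2 = \<psi>\<close>.
\<close>
lemma A_\<theta>:
  assumes "x \<in> L" "y \<in> L" "w \<in> L"
  shows "A (\<theta> x y w) = \<theta> (inv x) (inv y) (\<psi> x \<otimes> \<psi> y \<otimes> w)"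
proof -
  have c: "x \<in> carrier V" "y \<in> carrier V" "w \<in> carrier V" using assms L_carrier by auto
  then show ?thesis using assms
    by (simp add: \<theta>_def A_eq_p[of "B (B x)"] A_eq_p[of "B y"] p_B[of y] p_B_B A_L[of w] m_ac)
qed

lemma \<theta>_closed: "\<lbrakk>x \<in> carrier V; y \<in> carrier V; w \<in> carrier V\<rbrakk> \<Longrightarrow> \<theta> x y w \<in> carrier V"
  by (simp add: \<theta>_def)

lemma \<theta>_mult:
  "\<lbrakk>x \<in> carrier V; y \<in> carrier V; w \<in> carrier V; x' \<in> carrier V; y' \<in> carrier V; w' \<in> carrier V\<rbrakk> \<Longrightarrow>
    \<theta> (x \<otimes> x') (y \<otimes> y') (w \<otimes> w') = \<theta> x y w \<otimes> \<theta> x' y' w'"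
  by (simp add: \<theta>_def m_ac)

lemma p_\<theta>: "\<lbrakk>x \<in> L; y \<in> L; w \<in> L\<rbrakk> \<Longrightarrow> p (\<theta> x y w) = \<psi> x \<otimes> \<psi> y \<otimes> (w \<otimes> w)"
  using L_carrier by (simp add: \<theta>_def p_mult p_B[of y] p_B_B p_L)

text \<open>
  Applying \<open>p\<close> to the three rotations of the equation gives \<open>\<psi> b + \<psi> d + 2 a = 0\<close> for all cyclic
  arrangements of \<open>x, y, w\<close>.  Subtracting two of them yields \<open>(2 - \<psi>)(a - b) = 0\<close>, and \<open>2 - \<psi>\<close> is
  invertible because \<open>\<psi>\<^sup>2 = \<psi> + 1\<close>.  So \<open>x = y = w\<close>, and then \<open>2(\<psi> + 1) w = 0\<close> with \<open>\<psi> + 1 = \<psi>\<^sup>2\<close> invertible.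
\<close>
lemma \<theta>_injective:
  assumes L: "x \<in> L" "y \<in> L" "w \<in> L" and "\<theta> x y w = \<one>"
  shows "x = \<one> \<and> y = \<one> \<and> w = \<one>"
proof -
  have c: "x \<in> carrier V" "y \<in> carrier V" "w \<in> carrier V" using L L_carrier by auto
  have one: "B \<one> = \<one>" "p \<one> = \<one>" using B_mult[of \<one> \<one>] A_mult[of \<one> \<one>] by (simp_all add: p_def)
  have "\<theta> y w x = \<one>" "\<theta> w x y = \<one>" using assms(4) B_\<theta> c one by metis+
  then have eq: "\<psi> x \<otimes> \<psi> y \<otimes> (w \<otimes> w) = \<one>" "\<psi> y \<otimes> \<psi> w \<otimes> (x \<otimes> x) = \<one>"
      "\<psi> w \<otimes> \<psi> x \<otimes> (y \<otimes> y) = \<one>"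
    using assms p_\<theta> one by metis+
  have step: "a = b" if ab: "a \<in> L" "b \<in> L" "d \<in> L"
      and e: "\<psi> b \<otimes> \<psi> d \<otimes> (a \<otimes> a) = \<one>" "\<psi> d \<otimes> \<psi> a \<otimes> (b \<otimes> b) = \<one>" for a b d
  proof -
    have c: "a \<in> carrier V" "b \<in> carrier V" "d \<in> carrier V" using ab L_carrier by auto
    have cancel: "b \<otimes> (inv b \<otimes> y) = y" if "y \<in> carrier V" for y
      using that c by (simp flip: m_assoc)
    define e where "e = a \<otimes> inv b"
    have eL: "e \<in> L" "e \<in> carrier V" using ab c by (simp_all add: e_def L_mult L_inv)
    have "(\<psi> b \<otimes> (a \<otimes> a)) \<otimes> \<psi> d = (\<psi> a \<otimes> (b \<otimes> b)) \<otimes> \<psi> d" using e c by (simp add: m_ac)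
    then have *: "\<psi> b \<otimes> (a \<otimes> a) = \<psi> a \<otimes> (b \<otimes> b)" using c by simp
    have "e \<otimes> e = (\<psi> b \<otimes> (a \<otimes> a)) \<otimes> (inv (\<psi> b) \<otimes> inv (b \<otimes> b))"
      using c by (simp add: e_def inv_mult m_ac)
    also have "\<dots> = \<psi> e"
      unfolding * using c by (simp add: e_def inv_mult \<psi>_mult \<psi>_inv m_ac cancel)
    finally have 1: "\<psi> e = e \<otimes> e" by simp
    then have "\<psi> e \<otimes> \<psi> e = \<psi> e \<otimes> e" using \<psi>_\<psi>[OF eL(1)] eL by (metis \<psi>_mult)
    then have "\<psi> e = e" using eL by simp
    then have "e = \<one>" using 1 eL by simp
    then show ?thesis using c by (simp add: e_def mult_inv_eq_one)
  qed
  have "x = y" and "y = w" using step[OF L(1,2,3)] step[OF L(2,3,1)] eq c by (simp_all add: m_ac)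
  then have "(\<psi> w \<otimes> w) \<otimes> (\<psi> w \<otimes> w) = \<one>" using eq c by (simp add: m_ac)
  then have "\<psi> w \<otimes> w = \<one>" 
    by (rule no_2_torsion[rotated]) (use c in simp)
  then have 2: "\<psi> (\<psi> w) = \<one>" using \<psi>_\<psi> L by simp
  have "\<psi> (\<psi> (\<psi> w)) = \<psi> (\<psi> w) \<otimes> \<psi> w" using \<psi>_\<psi>[of "\<psi> w"] c \<psi>_in_L by simp
  moreover have "\<psi> \<one> = \<one>" using \<psi>_mult[of \<one> \<one>] by simp
  ultimately have "\<psi> w = \<one>" using 2 c by simp
  then have "w = \<one>" using \<open>\<psi> w \<otimes> w = \<one>\<close> c by simp
  then show ?thesis using \<open>x = y\<close> \<open>y = w\<close> by simp
qed

definition \<theta>_image :: "'a set" where "\<theta>_image = {\<theta> x y w | x y w. x \<in> L \<and> y \<in> L \<and> w \<in> L}"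

lemma \<theta>_imageI: "\<lbrakk>x \<in> L; y \<in> L; w \<in> L\<rbrakk> \<Longrightarrow> \<theta> x y w \<in> \<theta>_image"
  unfolding \<theta>_image_def by blast

lemma \<theta>_image_A: "u \<in> \<theta>_image \<Longrightarrow> A u \<in> \<theta>_image"
proof -
  assume "u \<in> \<theta>_image"
  then obtain x y w where u: "u = \<theta> x y w" and L: "x \<in> L" "y \<in> L" "w \<in> L"
    unfolding \<theta>_image_def by blast
  have "\<theta> (inv x) (inv y) (\<psi> x \<otimes> \<psi> y \<otimes> w) \<in> \<theta>_image"
    by (intro \<theta>_imageI L_inv L_mult \<psi>_in_L L_carrier L)
  then show ?thesis using A_\<theta> u L by simp
qed

lemma \<theta>_image_B: "u \<in> \<theta>_image \<Longrightarrow> B u \<in> \<theta>_image"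
  unfolding \<theta>_image_def using B_\<theta> L_carrier by blast

lemma \<theta>_image_mult: "\<lbrakk>u \<in> \<theta>_image; v \<in> \<theta>_image\<rbrakk> \<Longrightarrow> u \<otimes> v \<in> \<theta>_image"
proof -
  assume "u \<in> \<theta>_image" "v \<in> \<theta>_image"
  then obtain x y w x' y' w' where u: "u = \<theta> x y w" and L: "x \<in> L" "y \<in> L" "w \<in> L"
    and v: "v = \<theta> x' y' w'" and L': "x' \<in> L" "y' \<in> L" "w' \<in> L"
    unfolding \<theta>_image_def by blast
  have "\<theta> (x \<otimes> x') (y \<otimes> y') (w \<otimes> w') \<in> \<theta>_image"
    by (intro \<theta>_imageI L_mult L L')
  then show ?thesis using u v L L' L_carrier \<theta>_mult by simp
qed

lemma \<theta>_image_closed: "u \<in> \<theta>_image \<Longrightarrow> u \<in> carrier V"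
  using \<theta>_closed L_carrier by (auto simp: \<theta>_image_def)

lemma \<theta>_image_P: assumes "u \<in> \<theta>_image" shows "P u \<in> \<theta>_image"
proof -
  have "P u = A (B u)" using \<theta>_image_closed[OF assms] by (simp add: B_def)
  then show ?thesis using assms \<theta>_image_A \<theta>_image_B by simp
qed

lemma \<theta>_image_T: "u \<in> \<theta>_image \<Longrightarrow> T u \<in> \<theta>_image"
  by (simp add: T_def Q_def \<theta>_image_A \<theta>_image_P)

lemma L_in_\<theta>_image: assumes "x \<in> L" shows "x \<in> \<theta>_image"
proof -
  have "B \<one> = \<one>" using B_mult[of \<one> \<one>] by simp
  then have "\<theta> \<one> \<one> x = x" using L_carrier[OF assms] by (simp add: \<theta>_def)
  then show ?thesis using \<theta>_imageI[OF L_one L_one assms] by simp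
qed

lemma T_closed: "x \<in> carrier V \<Longrightarrow> T x \<in> carrier V"
  and T_mult: "\<lbrakk>x \<in> carrier V; y \<in> carrier V\<rbrakk> \<Longrightarrow> T (x \<otimes> y) = T x \<otimes> T y"
  by (simp_all add: T_def)

text \<open>
  Because of the vanishing sum, \<open>2x = (1 + \<alpha>) x + (1 + z) x + (1 + \<alpha>z) x\<close>.  The three summands lie in
  \<open>L\<close>, \<open>T L\<close> and \<open>T\<^sup>2 L\<close>.
\<close>
lemma square_in_\<theta>_image: assumes x: "x \<in> carrier V" shows "x \<otimes> x \<in> \<theta>_image"
proof -
  have T: "T x \<in> carrier V" "T (T x) \<in> carrier V" using x T_closed by simp_all
  have "x \<otimes> Z x = T (p (T (T x)))"
    using x T by (simp add: p_def T_mult T_A T_T_T)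
  moreover have "x \<otimes> A (Z x) = T (T (p (T x)))"
    using x T by (simp add: p_def T_mult T_closed T_A T_Z T_T_T Z_closed)
  moreover have "x \<otimes> x = p x \<otimes> (x \<otimes> Z x) \<otimes> (x \<otimes> A (Z x))"
  proof -
    have "p x \<otimes> (x \<otimes> Z x) \<otimes> (x \<otimes> A (Z x)) = (x \<otimes> x) \<otimes> (x \<otimes> A x \<otimes> Z x \<otimes> A (Z x))"
      using x by (simp add: p_def Z_closed m_ac)
    then show ?thesis using klein_sum[OF x] x by simp
  qed
  moreover have "p y \<in> \<theta>_image" if "y \<in> carrier V" for y
    by (rule L_in_\<theta>_image[OF p_in_L[OF that]])
  ultimately show ?thesis using x T by (simp add: \<theta>_image_mult \<theta>_image_T)
qed

end

section \<open>The tensor product of \<open>Icosa(R)\<close> with \<open>L\<close>\<close>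

lemma Zphi_module_simps [simp]:
  "carrier (Zphi_module A f) = carrier A"
  "x \<oplus>\<^bsub>Zphi_module A f\<^esub> y = x \<otimes>\<^bsub>A\<^esub> y"
  "\<zero>\<^bsub>Zphi_module A f\<^esub> = \<one>\<^bsub>A\<^esub>"
  "(a, b) \<odot>\<^bsub>Zphi_module A f\<^esub> x = x [^]\<^bsub>A\<^esub> a \<otimes>\<^bsub>A\<^esub> f x [^]\<^bsub>A\<^esub> b"
  by (simp_all add: Zphi_module_def)

lemma Zphi_simps [simp]:
  "carrier Zphi = UNIV" "\<one>\<^bsub>Zphi\<^esub> = (1, 0)" "\<zero>\<^bsub>Zphi\<^esub> = (0, 0)"
  "(a, b) \<oplus>\<^bsub>Zphi\<^esub> (c, d) = (a + c, b + d)"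
  "(a, b) \<otimes>\<^bsub>Zphi\<^esub> (c, d) = (a * c + b * d, a * d + b * c + b * d)"
  by (simp_all add: Zphi_def)

lemma icosaR_simps [simp]:
  "carrier icosaR = UNIV" "\<zero>\<^bsub>icosaR\<^esub> = ((0, 0), (0, 0), (0, 0))"
  "(x, y, w) \<oplus>\<^bsub>icosaR\<^esub> (x', y', w') = (x \<oplus>\<^bsub>Zphi\<^esub> x', y \<oplus>\<^bsub>Zphi\<^esub> y', w \<oplus>\<^bsub>Zphi\<^esub> w')"
  "r \<odot>\<^bsub>icosaR\<^esub> (x, y, w) = (r \<otimes>\<^bsub>Zphi\<^esub> x, r \<otimes>\<^bsub>Zphi\<^esub> y, r \<otimes>\<^bsub>Zphi\<^esub> w)"
  by (simp_all add: icosaR_def)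

lemma module_Zphi_module:
  assumes "comm_group A" and f: "f \<in> hom A A"
    and ff: "\<And>x. x \<in> carrier A \<Longrightarrow> f (f x) = f x \<otimes>\<^bsub>A\<^esub> x"
  shows "module Zphi (Zphi_module A f)"
proof -
  interpret A: comm_group A by fact
  have f_closed [simp]: "x \<in> carrier A \<Longrightarrow> f x \<in> carrier A" for x using f by (auto simp: hom_def)
  have f_mult: "\<lbrakk>x \<in> carrier A; y \<in> carrier A\<rbrakk> \<Longrightarrow> f (x \<otimes>\<^bsub>A\<^esub> y) = f x \<otimes>\<^bsub>A\<^esub> f y" for x y
    using f by (auto simp: hom_def)
  have f_pow: "f (x [^]\<^bsub>A\<^esub> n) = f x [^]\<^bsub>A\<^esub> n" if "x \<in> carrier A" for x and n :: int
    using hom_int_pow[OF f that A.is_group A.is_group] by simp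
  show ?thesis
  proof (rule moduleI)
    show "cring Zphi" by (rule cring_Zphi)
    show "abelian_group (Zphi_module A f)"
    proof (rule abelian_groupI)
      fix x assume "x \<in> carrier (Zphi_module A f)"
      then show "\<exists>y\<in>carrier (Zphi_module A f). y \<oplus>\<^bsub>Zphi_module A f\<^esub> x = \<zero>\<^bsub>Zphi_module A f\<^esub>"
        by (intro bexI[of _ "inv\<^bsub>A\<^esub> x"]) simp_all
    qed (simp_all add: A.m_ac)
  next
    fix r s :: "int \<times> int" and x assume "x \<in> carrier (Zphi_module A f)"
    then have x: "x \<in> carrier A" by simp
    obtain a b c d where [simp]: "r = (a, b)" "s = (c, d)" by (metis surj_pair)
    show "(r \<oplus>\<^bsub>Zphi\<^esub> s) \<odot>\<^bsub>Zphi_module A f\<^esub> x =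
        r \<odot>\<^bsub>Zphi_module A f\<^esub> x \<oplus>\<^bsub>Zphi_module A f\<^esub> s \<odot>\<^bsub>Zphi_module A f\<^esub> x"
      using x by (simp add: A.int_pow_mult A.m_ac)
    show "(r \<otimes>\<^bsub>Zphi\<^esub> s) \<odot>\<^bsub>Zphi_module A f\<^esub> x =
        r \<odot>\<^bsub>Zphi_module A f\<^esub> (s \<odot>\<^bsub>Zphi_module A f\<^esub> x)"
      using x by (simp add: f_mult f_pow ff A.int_pow_mult A.int_pow_distrib A.int_pow_pow A.m_ac mult.commute)
  next
    fix r :: "int \<times> int" and x y assume "x \<in> carrier (Zphi_module A f)" "y \<in> carrier (Zphi_module A f)"
    then show "r \<odot>\<^bsub>Zphi_module A f\<^esub> (x \<oplus>\<^bsub>Zphi_module A f\<^esub> y) =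
        r \<odot>\<^bsub>Zphi_module A f\<^esub> x \<oplus>\<^bsub>Zphi_module A f\<^esub> r \<odot>\<^bsub>Zphi_module A f\<^esub> y"
      by (cases r) (simp add: f_mult A.int_pow_distrib A.m_ac)
  qed (auto simp: split_paired_all)
qed

context icosahedral_module
begin

abbreviation "LG \<equiv> V\<lparr>carrier := L\<rparr>"
abbreviation "M \<equiv> Zphi_module LG \<psi>"

lemma comm_group_LG: "comm_group LG"
  using subgroup_imp_group[OF subgroup_L] L_carrier
  by (intro group.group_comm_groupI) (simp_all add: m_comm)

lemma \<psi>_hom: "\<psi> \<in> hom LG LG"
  using \<psi>_in_L \<psi>_mult L_carrier by (auto simp: hom_def)

lemma module_M: "module Zphi M"
  by (rule module_Zphi_module[OF comm_group_LG \<psi>_hom]) (simp add: \<psi>_\<psi>)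

abbreviation smultM (infixl "\<cdot>" 75) where "r \<cdot> x \<equiv> r \<odot>\<^bsub>M\<^esub> x"

lemma smultM:
  assumes "x \<in> L"
  shows "r \<cdot> x \<in> L" "(r \<oplus>\<^bsub>Zphi\<^esub> s) \<cdot> x = r \<cdot> x \<otimes> s \<cdot> x" "(r \<otimes>\<^bsub>Zphi\<^esub> s) \<cdot> x = r \<cdot> (s \<cdot> x)"
    "y \<in> L \<Longrightarrow> r \<cdot> (x \<otimes> y) = r \<cdot> x \<otimes> r \<cdot> y"
    "(1, 0) \<cdot> x = x" "(0, 0) \<cdot> x = \<one>" "phi \<cdot> x = \<psi> x" "(-1, 0) \<cdot> x = inv x"
proof -
  interpret M: module Zphi M by (rule module_M)
  interpret LG: comm_group LG by (rule comm_group_LG)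
  have x: "x \<in> carrier LG" "\<psi> x \<in> carrier LG" using assms \<psi>_in_L L_carrier by simp_all
  show "r \<cdot> x \<in> L" using M.smult_closed[of r x] assms by simp
  show "(r \<oplus>\<^bsub>Zphi\<^esub> s) \<cdot> x = r \<cdot> x \<otimes> s \<cdot> x" using M.smult_l_distr[of r s x] assms by simp
  show "(r \<otimes>\<^bsub>Zphi\<^esub> s) \<cdot> x = r \<cdot> (s \<cdot> x)" using M.smult_assoc1[of r s x] assms by simp
  show "r \<cdot> (x \<otimes> y) = r \<cdot> x \<otimes> r \<cdot> y" if "y \<in> L" using M.smult_r_distr[of r x y] assms that by simp
  show "(1, 0) \<cdot> x = x" "(0, 0) \<cdot> x = \<one>" "phi \<cdot> x = \<psi> x"
    using LG.int_pow_1[OF x(1)] LG.int_pow_1[OF x(2)] L_carrier[OF assms]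
    by (simp_all add: phi_def)
  have "x [^]\<^bsub>LG\<^esub> (-1 :: int) = inv\<^bsub>LG\<^esub> x"
    using LG.int_pow_neg[OF x(1), of 1] LG.int_pow_1[OF x(1)] by simp
  then show "(-1, 0) \<cdot> x = inv x"
    using L_carrier[OF assms] subgroup_L assms by simp
qed

text \<open>
  The bilinear map \<open>(r, x) \<mapsto> \<gamma>\<^sup>2 (r\<^sub>1 x) + \<gamma> (r\<^sub>2 x) + r\<^sub>3 x\<close> that induces the isomorphism from the tensor
  product to \<open>V\<close>; the coefficients fit because \<open>e\<^sub>1 = \<gamma>\<^sup>2 e\<^sub>3\<close> and \<open>e\<^sub>2 = \<gamma> e\<^sub>3\<close> in \<open>Icosa(R)\<close>.
\<close>
definition ev :: "zphi3 \<Rightarrow> 'a \<Rightarrow> 'a" where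
  "ev r x = (case r of (r1, r2, r3) \<Rightarrow> \<theta> (r1 \<cdot> x) (r2 \<cdot> x) (r3 \<cdot> x))"

lemma ev_closed: "x \<in> L \<Longrightarrow> ev r x \<in> carrier V"
  by (cases r) (simp add: ev_def \<theta>_closed L_carrier smultM(1) del: Zphi_module_simps)

lemma ev_add: "x \<in> L \<Longrightarrow> ev (r \<oplus>\<^bsub>icosaR\<^esub> s) x = ev r x \<otimes> ev s x"
  by (cases r; cases s)
    (simp add: ev_def smultM(2) \<theta>_mult L_carrier smultM(1) del: Zphi_module_simps Zphi_simps(4))

lemma ev_mult: "\<lbrakk>x \<in> L; y \<in> L\<rbrakk> \<Longrightarrow> ev r (x \<otimes> y) = ev r x \<otimes> ev r y"
  by (cases r) (simp add: ev_def smultM(4) \<theta>_mult L_carrier smultM(1) del: Zphi_module_simps)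

lemma Zphi_commute: "r \<otimes>\<^bsub>Zphi\<^esub> s = s \<otimes>\<^bsub>Zphi\<^esub> r"
  by (cases r; cases s) (simp add: algebra_simps)

lemma ev_smult: "x \<in> L \<Longrightarrow> ev (r \<odot>\<^bsub>icosaR\<^esub> s) x = ev s (r \<cdot> x)"
  by (cases s) (simp add: ev_def smultM(3)[symmetric] Zphi_commute[of r] del: Zphi_module_simps Zphi_simps(5))

lemma ev_basis:
  assumes "x \<in> L"
  shows "ev e1 x = \<theta> x \<one> \<one>" "ev e2 x = \<theta> \<one> x \<one>" "ev e3 x = \<theta> \<one> \<one> x"
  using assms by (simp_all add: ev_def e1_def e2_def e3_def smultM del: Zphi_module_simps)

abbreviation "F \<equiv> free_Abelian_group (carrier icosaR \<times> carrier M)"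
abbreviation "N \<equiv> tensor_kernel Zphi icosaR M"

lemma obtain_\<Theta>:
  obtains \<Theta> where "\<Theta> \<in> hom F V" "\<And>r x. x \<in> L \<Longrightarrow> \<Theta> (frag_of (r, x)) = ev r x"
proof -
  have "(\<lambda>(r, x). ev r x) ` (carrier icosaR \<times> carrier M) \<subseteq> carrier V"
    using ev_closed by auto
  then obtain h where "h \<in> hom F V"
    "\<And>x. x \<in> carrier icosaR \<times> carrier M \<Longrightarrow> h (frag_of x) = (\<lambda>(r, x). ev r x) x"
    by (rule free_Abelian_group_universal) blast
  then show thesis by (intro that[of h]) auto
qed

lemma tensor_relations_closed: "tensor_relations Zphi icosaR M \<subseteq> carrier F"
proof -
  interpret M: module Zphi M by (rule module_M)
  have diff: "frag_of a - frag_of b \<in> carrier (free_Abelian_group (UNIV \<times> carrier M))"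
    if "snd a \<in> carrier M" "snd b \<in> carrier M" for a b :: "zphi3 \<times> 'a"
    using that keys_diff[of "frag_of a" "frag_of b"]
    by (cases a; cases b) (auto simp del: Zphi_module_simps)
  have diff': "u - frag_of b \<in> carrier (free_Abelian_group (UNIV \<times> carrier M))"
    if "u \<in> carrier (free_Abelian_group (UNIV \<times> carrier M))" "snd b \<in> carrier M"
    for u and b :: "zphi3 \<times> 'a"
    using that keys_diff[of u "frag_of b"] by (cases b) (auto simp del: Zphi_module_simps)
  show ?thesis
    unfolding tensor_relations_def
    using M.smult_closed M.add.m_closed
    by (auto simp del: Zphi_module_simps carrier_free_Abelian_group_iff intro!: diff diff')
qed

lemma subgroup_N: "subgroup N F"
  unfolding tensor_kernel_def
  by (rule group.generate_is_subgroup[OF group_free_Abelian_group tensor_relations_closed])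

lemma N_diff: "\<lbrakk>a \<in> N; b \<in> N\<rbrakk> \<Longrightarrow> a - b \<in> N" and N_add: "\<lbrakk>a \<in> N; b \<in> N\<rbrakk> \<Longrightarrow> a + b \<in> N"
  and N_zero: "0 \<in> N"
proof -
  show add: "a + b \<in> N" if "a \<in> N" "b \<in> N" for a b
    using subgroup.m_closed[OF subgroup_N that] by simp
  show "0 \<in> N" using subgroup.one_closed[OF subgroup_N] by simp
  show "a - b \<in> N" if "a \<in> N" "b \<in> N"
    using add[OF that(1), of "-b"] subgroup.m_inv_closed[OF subgroup_N that(2)] that(2) subgroup.subset[OF subgroup_N]
    by (auto simp: subset_iff)
qed

lemma N_add_left:
  assumes "x \<in> L"
  shows "frag_of (r \<oplus>\<^bsub>icosaR\<^esub> s, x) - frag_of (r, x) - frag_of (s, x) \<in> N"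
  unfolding tensor_kernel_def
proof (rule generate.incl)
  have "r \<in> carrier icosaR \<and> s \<in> carrier icosaR \<and> x \<in> carrier M" using assms by simp
  then show "frag_of (r \<oplus>\<^bsub>icosaR\<^esub> s, x) - frag_of (r, x) - frag_of (s, x) \<in> tensor_relations Zphi icosaR M"
    unfolding tensor_relations_def by blast
qed

lemma N_add_right:
  assumes "x \<in> L" "y \<in> L"
  shows "frag_of (r, x \<otimes> y) - frag_of (r, x) - frag_of (r, y) \<in> N"
proof -
  have "r \<in> carrier icosaR \<and> x \<in> carrier M \<and> y \<in> carrier M" using assms by simp
  then have "frag_of (r, x \<oplus>\<^bsub>M\<^esub> y) - frag_of (r, x) - frag_of (r, y) \<in> tensor_relations Zphi icosaR M"
    unfolding tensor_relations_def by blast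
  moreover have "x \<oplus>\<^bsub>M\<^esub> y = x \<otimes> y" by simp
  ultimately show ?thesis unfolding tensor_kernel_def by (metis generate.incl)
qed

lemma N_smult:
  assumes "x \<in> L"
  shows "frag_of (q \<odot>\<^bsub>icosaR\<^esub> r, x) - frag_of (r, q \<cdot> x) \<in> N"
  unfolding tensor_kernel_def
proof (rule generate.incl)
  have "q \<in> carrier Zphi \<and> r \<in> carrier icosaR \<and> x \<in> carrier M" using assms by simp
  then show "frag_of (q \<odot>\<^bsub>icosaR\<^esub> r, x) - frag_of (r, q \<cdot> x) \<in> tensor_relations Zphi icosaR M"
    unfolding tensor_relations_def by blast
qed

lemmas N_relations = N_add_left N_add_right N_smult

lemma N_one: "frag_of (r, \<one>) \<in> N"
  using N_diff[OF N_zero N_add_right[OF L_one L_one, of r]] by simp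

text \<open>Modulo the relations, scalars move from \<open>Icosa(R)\<close> to \<open>L\<close> and generators over the same \<open>e\<^sub>i\<close> add up.\<close>
lemma normal_form:
  assumes "Poly_Mapping.keys u \<subseteq> carrier icosaR \<times> carrier M"
  shows "\<exists>x\<in>L. \<exists>y\<in>L. \<exists>w\<in>L. u - (frag_of (e1, x) + frag_of (e2, y) + frag_of (e3, w)) \<in> N"
  using assms
proof (induction u rule: free_Abelian_group_induct[consumes 1, case_names zero diff of])
  case zero
  have "0 - (frag_of (e1, \<one>) + frag_of (e2, \<one>) + frag_of (e3, \<one>)) \<in> N"
    by (intro N_diff N_add N_zero N_one)
  then show ?case using L_one by blast
next
  case (diff u v)
  obtain x y w where u: "x \<in> L" "y \<in> L" "w \<in> L"
    "u - (frag_of (e1, x) + frag_of (e2, y) + frag_of (e3, w)) \<in> N" using diff by blast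
  obtain x' y' w' where v: "x' \<in> L" "y' \<in> L" "w' \<in> L"
    "v - (frag_of (e1, x') + frag_of (e2, y') + frag_of (e3, w')) \<in> N" using diff by blast
  have d: "frag_of (e, a) - frag_of (e, a \<otimes> inv b) - frag_of (e, b) \<in> N" if "a \<in> L" "b \<in> L" for e a b
  proof -
    have "a \<otimes> inv b \<otimes> b = a" using that L_carrier by (simp add: m_assoc)
    then show ?thesis using N_relations(2)[of "a \<otimes> inv b" b e] that L_mult L_inv by simp
  qed
  have "(u - (frag_of (e1, x) + frag_of (e2, y) + frag_of (e3, w))) -
     (v - (frag_of (e1, x') + frag_of (e2, y') + frag_of (e3, w'))) +
     (frag_of (e1, x) - frag_of (e1, x \<otimes> inv x') - frag_of (e1, x')) +
     (frag_of (e2, y) - frag_of (e2, y \<otimes> inv y') - frag_of (e2, y')) +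
     (frag_of (e3, w) - frag_of (e3, w \<otimes> inv w') - frag_of (e3, w')) \<in> N"
    by (intro N_add N_diff d u v)
  then have "(u - v) - (frag_of (e1, x \<otimes> inv x') + frag_of (e2, y \<otimes> inv y') + frag_of (e3, w \<otimes> inv w')) \<in> N"
    by (simp add: algebra_simps)
  then show ?case
    by - (rule bexI[of _ "x \<otimes> inv x'"], rule bexI[of _ "y \<otimes> inv y'"],
        rule bexI[of _ "w \<otimes> inv w'"], assumption, (intro L_mult L_inv u v)+)
next
  case (of a)
  then obtain r1 r2 r3 x where a: "a = ((r1, r2, r3), x)" and x: "x \<in> L" by (cases a) auto
  let ?a = "r1 \<odot>\<^bsub>icosaR\<^esub> e1" and ?b = "r2 \<odot>\<^bsub>icosaR\<^esub> e2" and ?c = "r3 \<odot>\<^bsub>icosaR\<^esub> e3"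
  have sum: "(r1, r2, r3) = (?a \<oplus>\<^bsub>icosaR\<^esub> ?b) \<oplus>\<^bsub>icosaR\<^esub> ?c"
    by (cases r1; cases r2; cases r3) (simp add: e1_def e2_def e3_def)
  have "(frag_of ((r1, r2, r3), x) - frag_of (?a \<oplus>\<^bsub>icosaR\<^esub> ?b, x) - frag_of (?c, x)) +
     (frag_of (?a \<oplus>\<^bsub>icosaR\<^esub> ?b, x) - frag_of (?a, x) - frag_of (?b, x)) +
     (frag_of (?a, x) - frag_of (e1, r1 \<cdot> x)) + (frag_of (?b, x) - frag_of (e2, r2 \<cdot> x)) +
     (frag_of (?c, x) - frag_of (e3, r3 \<cdot> x)) \<in> N"
    unfolding sum by (intro N_add N_relations x)
  then have "frag_of a - (frag_of (e1, r1 \<cdot> x) + frag_of (e2, r2 \<cdot> x) + frag_of (e3, r3 \<cdot> x)) \<in> N"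
    unfolding a by (simp add: algebra_simps del: Zphi_module_simps)
  then show ?case
    by - (rule bexI[of _ "r1 \<cdot> x"], rule bexI[of _ "r2 \<cdot> x"], rule bexI[of _ "r3 \<cdot> x"],
        assumption, (rule smultM(1)[OF x])+)
qed

text \<open>
  The kernel contains the relations by bilinearity.  Conversely, an element of the kernel has normal
  form \<open>e\<^sub>1 \<otimes> x + e\<^sub>2 \<otimes> y + e\<^sub>3 \<otimes> w\<close> with \<open>\<theta>(x, y, w) = 0\<close>, and \<open>\<theta>\<close> is injective.
\<close>
lemma kernel_eq_N:
  assumes hom: "\<Theta> \<in> hom F V" and of: "\<And>r x. x \<in> L \<Longrightarrow> \<Theta> (frag_of (r, x)) = ev r x"
  shows "kernel F V \<Theta> = N"
proof -
  interpret \<Theta>: group_hom F V \<Theta>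
    using hom by (simp add: group_hom_def group_hom_axioms_def)
  have add: "\<Theta> (u + v) = \<Theta> u \<otimes> \<Theta> v" if "u \<in> carrier F" "v \<in> carrier F" for u v
    using \<Theta>.hom_mult[OF that] by simp
  have diff: "\<Theta> (u - v) = \<Theta> u \<otimes> inv (\<Theta> v)" if "u \<in> carrier F" "v \<in> carrier F" for u v
  proof -
    have "- v \<in> carrier F" "\<Theta> (- v) = inv (\<Theta> v)" using that(2) \<Theta>.hom_inv[OF that(2)] by simp_all
    then show ?thesis using add[OF that(1), of "- v"] by simp
  qed
  have diff_closed: "u - v \<in> carrier F" if "u \<in> carrier F" "v \<in> carrier F" for u v
    using that keys_diff[of u v] by auto
  have gen: "frag_of (r, x) \<in> carrier F" if "x \<in> L" for r x using that by simp
  have relation: "\<Theta> (frag_of (r, x) - frag_of (s, y) - frag_of (t, w)) = \<one>"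
    if "x \<in> L" "y \<in> L" "w \<in> L" "ev r x = ev s y \<otimes> ev t w" for r s t x y w
  proof -
    have "\<Theta> (frag_of (r, x) - frag_of (s, y) - frag_of (t, w)) = ev r x \<otimes> inv (ev s y) \<otimes> inv (ev t w)"
      by (simp only: diff diff_closed gen that of)
    also have "\<dots> = (ev s y \<otimes> ev t w) \<otimes> inv (ev s y \<otimes> ev t w)"
      using that ev_closed by (simp add: inv_mult m_assoc)
    finally show ?thesis using that ev_closed by simp
  qed
  have "tensor_relations Zphi icosaR M \<subseteq> kernel F V \<Theta>"
  proof
    fix u assume u: "u \<in> tensor_relations Zphi icosaR M"
    then have "\<Theta> u = \<one>"
      unfolding tensor_relations_def
    proof (elim UnE CollectE exE conjE)
      fix r s x assume "u = frag_of (r \<oplus>\<^bsub>icosaR\<^esub> s, x) - frag_of (r, x) - frag_of (s, x)" "x \<in> carrier M"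
      then show ?thesis using relation ev_add by simp
    next
      fix r x y assume "u = frag_of (r, x \<oplus>\<^bsub>M\<^esub> y) - frag_of (r, x) - frag_of (r, y)"
        "x \<in> carrier M" "y \<in> carrier M"
      then show ?thesis using relation ev_mult L_mult by simp
    next
      fix q r x assume u: "u = frag_of (q \<odot>\<^bsub>icosaR\<^esub> r, x) - frag_of (r, q \<cdot> x)" and "x \<in> carrier M"
      then have x: "x \<in> L" by simp
      have "\<Theta> u = ev (q \<odot>\<^bsub>icosaR\<^esub> r) x \<otimes> inv (ev r (q \<cdot> x))"
        unfolding u by (simp only: diff gen of x smultM(1)[OF x])
      then show ?thesis using ev_smult[OF x] ev_closed[OF smultM(1)[OF x]] by simp
    qed
    then show "u \<in> kernel F V \<Theta>" using u tensor_relations_closed by (auto simp: kernel_def simp del: carrier_free_Abelian_group_iff)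
  qed
  then have N_sub: "N \<subseteq> kernel F V \<Theta>"
    unfolding tensor_kernel_def
    by (rule group.generate_subgroup_incl[OF group_free_Abelian_group _ \<Theta>.subgroup_kernel])
  moreover have "u \<in> N" if "u \<in> kernel F V \<Theta>" for u
  proof -
    have u: "u \<in> carrier F" "\<Theta> u = \<one>" using that by (simp_all add: kernel_def)
    obtain x y w where L: "x \<in> L" "y \<in> L" "w \<in> L"
      and N: "u - (frag_of (e1, x) + frag_of (e2, y) + frag_of (e3, w)) \<in> N"
      using normal_form u(1) by (metis carrier_free_Abelian_group_iff)
    let ?v = "frag_of (e1, x) + frag_of (e2, y) + frag_of (e3, w)"
    have sum_closed: "a + b \<in> carrier F" if "a \<in> carrier F" "b \<in> carrier F" for a b
      using that keys_add[of a b] by auto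
    have v: "?v \<in> carrier F" by (intro sum_closed gen L)
    have "\<Theta> ?v = ev e1 x \<otimes> ev e2 y \<otimes> ev e3 w"
      by (simp only: add sum_closed gen L of)
    also have "\<dots> = \<theta> x y w"
      using L L_carrier by (simp add: ev_basis L_one \<theta>_mult[symmetric] \<theta>_closed)
    finally have "\<Theta> u \<otimes> inv (\<theta> x y w) = \<one>"
      using N N_sub diff[OF u(1) v] by (auto simp: kernel_def)
    then have "\<theta> x y w = \<one>" using u L L_carrier \<theta>_closed by (simp add: inv_eq_1_iff)
    from \<theta>_injective[OF L this] have "?v \<in> N" by (simp add: N_add N_one)
    with N show "u \<in> N" using N_add[of "u - ?v" ?v] by simp
  qed
  ultimately show ?thesis by blast
qed

text \<open>
  The kernel of \<open>\<Theta>\<close> is the group of relations, so \<open>\<Theta>\<close> induces an isomorphism from the tensor product;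
  \<open>\<eta>\<close> is its inverse.  Equivariance is checked on the generators of the free group, where it is the
  hypothesis on \<open>\<sigma>\<close>.
\<close>
theorem equivariant_iso_tensor:
  assumes div: "\<And>v. v \<in> carrier V \<Longrightarrow> \<exists>w\<in>carrier V. v = w \<otimes> w"
    and hom: "\<And>g. g \<in> carrier G \<Longrightarrow> \<rho> g \<in> hom V V"
    and equi: "\<And>g r x. g \<in> carrier G \<Longrightarrow> x \<in> L \<Longrightarrow> \<rho> g (ev r x) = ev (\<sigma> g r) x"
  shows "equivariant_iso G V \<rho> (tensor Zphi icosaR M) (\<lambda>g. tensor_map Zphi icosaR M (\<sigma> g))"
proof -
  obtain \<Theta> where \<Theta>_hom: "\<Theta> \<in> hom F V" and "\<forall>r. \<forall>x\<in>L. \<Theta> (frag_of (r, x)) = ev r x"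
    by (rule obtain_\<Theta>) blast
  then have of: "\<Theta> (frag_of (r, x)) = ev r x" if "x \<in> L" for r x using that by blast
  interpret \<Theta>: group_hom F V \<Theta>
    using \<Theta>_hom by (simp add: group_hom_def group_hom_axioms_def)
  have N: "kernel F V \<Theta> = N" by (rule kernel_eq_N[OF \<Theta>_hom of])
  have diff: "\<Theta> (u - v) = \<Theta> u \<otimes> inv (\<Theta> v)" if "u \<in> carrier F" "v \<in> carrier F" for u v
  proof -
    have "- v \<in> carrier F" "\<Theta> (- v) = inv (\<Theta> v)" using that(2) \<Theta>.hom_inv[OF that(2)] by simp_all
    then show ?thesis using \<Theta>.hom_mult[OF that(1), of "- v"] by simp
  qed
  have gen: "frag_of (r, x) \<in> carrier F" if "x \<in> L" for r x using that by simp
  have surj: "\<Theta> ` carrier F = carrier V"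
  proof
    show "carrier V \<subseteq> \<Theta> ` carrier F"
    proof
      fix v assume "v \<in> carrier V"
      then have "v \<in> \<theta>_image" using div square_in_\<theta>_image by blast
      then obtain x y w where v: "v = \<theta> x y w" and L: "x \<in> L" "y \<in> L" "w \<in> L"
        unfolding \<theta>_image_def by blast
      let ?u = "frag_of (e1, x) \<otimes>\<^bsub>F\<^esub> frag_of (e2, y) \<otimes>\<^bsub>F\<^esub> frag_of (e3, w)"
      have "\<Theta> ?u = ev e1 x \<otimes> ev e2 y \<otimes> ev e3 w"
        by (simp only: \<Theta>.hom_mult \<Theta>.G.m_closed gen L of)
      also have "\<dots> = v"
        using L L_carrier by (simp add: v ev_basis L_one \<theta>_mult[symmetric] \<theta>_closed)
      finally have eq: "\<Theta> ?u = v" .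
      have "?u \<in> carrier F" by (intro \<Theta>.G.m_closed gen L)
      then have "\<Theta> ?u \<in> \<Theta> ` carrier F" by (rule imageI)
      then show "v \<in> \<Theta> ` carrier F" unfolding eq .
    qed
  qed auto
  let ?\<xi> = "\<lambda>T. the_elem (\<Theta> ` T)"
  have iso: "?\<xi> \<in> iso (F Mod N) V" using \<Theta>.FactGroup_iso_set[OF surj] unfolding N .
  define \<eta> where "\<eta> = inv_into (carrier (F Mod N)) ?\<xi>"
  have "group (F Mod N)" using normal.factorgroup_is_group[OF \<Theta>.normal_kernel] unfolding N .
  then have \<eta>: "\<eta> \<in> iso V (F Mod N)" unfolding \<eta>_def using iso by (rule group.iso_set_sym)
  have coset: "c \<in> carrier F" "\<Theta> c = \<Theta> d" if c: "c \<in> N #>\<^bsub>F\<^esub> d" and d: "d \<in> carrier F" for c d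
  proof -
    obtain n where n: "n \<in> kernel F V \<Theta>" "c = n \<otimes>\<^bsub>F\<^esub> d" using c unfolding N r_coset_def by blast
    then have "n \<in> carrier F" "\<Theta> n = \<one>" by (simp_all add: kernel_def)
    then show "c \<in> carrier F" "\<Theta> c = \<Theta> d"
      using n(2) d by (simp_all only: \<Theta>.hom_mult \<Theta>.G.m_closed l_one \<Theta>.hom_closed)
  qed
  have self: "d \<in> N #>\<^bsub>F\<^esub> d" if "d \<in> carrier F" for d
    using \<Theta>.G.rcos_self[OF that subgroup_N] .
  have \<eta>_\<Theta>: "\<eta> (\<Theta> d) = N #>\<^bsub>F\<^esub> d" if "d \<in> carrier F" for d
  proof -
    have "\<Theta> ` (N #>\<^bsub>F\<^esub> d) = {\<Theta> d}" using coset[OF _ that] self[OF that] by blast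
    then have "?\<xi> (N #>\<^bsub>F\<^esub> d) = \<Theta> d" by simp
    moreover have "N #>\<^bsub>F\<^esub> d \<in> carrier (F Mod N)"
      using that unfolding FactGroup_def RCOSETS_def by auto
    moreover have "inj_on ?\<xi> (carrier (F Mod N))" using iso by (simp add: iso_def bij_betw_def)
    ultimately show ?thesis unfolding \<eta>_def using inv_into_f_f[of ?\<xi>] by fastforce
  qed
  have "\<eta> (\<rho> g v) = tensor_map Zphi icosaR M (\<sigma> g) (\<eta> v)" if g: "g \<in> carrier G" and v: "v \<in> carrier V" for g v
  proof -
    define E where "E = frag_extend (\<lambda>(r, x :: 'a). frag_of (\<sigma> g r, x))"
    interpret \<rho>: group_hom V V "\<rho> g" using hom[OF g] by unfold_locales
    have E: "E u \<in> carrier F \<and> \<Theta> (E u) = \<rho> g (\<Theta> u)" if "u \<in> carrier F" for u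
      using that unfolding carrier_free_Abelian_group_iff
    proof (induction u rule: free_Abelian_group_induct[consumes 1, case_names zero minus generator])
      case zero
      then show ?case using \<Theta>.hom_one \<rho>.hom_one by (simp add: E_def)
    next
      case (minus u v)
      have uv: "u \<in> carrier F" "v \<in> carrier F" "E u \<in> carrier F" "E v \<in> carrier F" using minus by simp_all
      have "E (u - v) = E u - E v" by (simp add: E_def frag_extend_diff)
      moreover have "E u - E v \<in> carrier F" using minus keys_diff[of "E u" "E v"] by auto
      moreover have "\<Theta> (E u - E v) = \<rho> g (\<Theta> (u - v))"
        using minus uv by (simp only: diff \<rho>.hom_mult \<rho>.hom_inv \<Theta>.hom_closed inv_closed)
      ultimately show ?case by simp
    next
      case (generator a)
      then obtain r x where "a = (r, x)" "x \<in> L" by (cases a) auto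
      then show ?case using equi[OF g] of by (simp add: E_def)
    qed
    obtain d where d: "d \<in> carrier F" "v = \<Theta> d" using surj v by blast
    have same: "N #>\<^bsub>F\<^esub> E c = N #>\<^bsub>F\<^esub> E d" if "c \<in> N #>\<^bsub>F\<^esub> d" for c
    proof -
      have "c \<in> carrier F" "\<Theta> c = \<Theta> d" using coset[OF that d(1)] by blast+
      then show ?thesis using E d(1) \<eta>_\<Theta> by metis
    qed
    have "tensor_map Zphi icosaR M (\<sigma> g) (\<eta> v) = (\<Union>c\<in>N #>\<^bsub>F\<^esub> d. N #>\<^bsub>F\<^esub> E c)"
      unfolding tensor_map_def E_def d(2) \<eta>_\<Theta>[OF d(1)] ..
    also have "\<dots> = N #>\<^bsub>F\<^esub> E d" using same self[OF d(1)] by blast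
    also have "\<dots> = \<eta> (\<rho> g v)" using E d \<eta>_\<Theta> by metis
    finally show ?thesis by simp
  qed
  then show ?thesis using \<eta> unfolding equivariant_iso_def tensor_def by blast
qed

end

section \<open>The action on \<open>Icosa(R)\<close>\<close>

text \<open>The actions of \<open>\<alpha>\<close> and \<open>\<gamma>\<close> on coordinate triples.\<close>
definition icosa_A :: "zphi3 \<Rightarrow> zphi3" where
  "icosa_A = (\<lambda>(x, y, w). ((-1, 0) \<otimes>\<^bsub>Zphi\<^esub> x, (-1, 0) \<otimes>\<^bsub>Zphi\<^esub> y, phi \<otimes>\<^bsub>Zphi\<^esub> x \<oplus>\<^bsub>Zphi\<^esub> phi \<otimes>\<^bsub>Zphi\<^esub> y \<oplus>\<^bsub>Zphi\<^esub> w))"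

definition icosa_B :: "zphi3 \<Rightarrow> zphi3" where
  "icosa_B = (\<lambda>(x, y, w). (y, w, x))"

lemma icosa_pair: "icosahedral_pair UNIV icosa_A (\<lambda>r. icosa_A (icosa_B r))"
proof
  fix r :: zphi3
  obtain a b c d e f where r: "r = ((a, b), (c, d), (e, f))" by (metis surj_pair)
  show "icosa_A (icosa_A r) = r"
    by (simp add: r icosa_A_def phi_def)
  show "icosa_A (icosa_B (icosa_A (icosa_B (icosa_A (icosa_B (icosa_A (icosa_B (icosa_A (icosa_B r))))))))) = r"
    by (simp add: r icosa_A_def icosa_B_def phi_def)
  show "icosa_A (icosa_A (icosa_B (icosa_A (icosa_A (icosa_B (icosa_A (icosa_A (icosa_B r)))))))) = r"
    by (simp add: r icosa_A_def icosa_B_def phi_def)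
qed simp_all

definition Zphi_linear :: "(zphi3 \<Rightarrow> zphi3) \<Rightarrow> bool" where
  "Zphi_linear f \<longleftrightarrow> (\<forall>x y. f (x \<oplus>\<^bsub>icosaR\<^esub> y) = f x \<oplus>\<^bsub>icosaR\<^esub> f y) \<and> (\<forall>r x. f (r \<odot>\<^bsub>icosaR\<^esub> x) = r \<odot>\<^bsub>icosaR\<^esub> f x)"

lemma Zphi_linear_eqI:
  assumes "Zphi_linear f" "Zphi_linear g" "f e1 = g e1" "f e2 = g e2" "f e3 = g e3"
  shows "f = g"
proof
  fix r :: zphi3
  obtain r1 r2 r3 where r: "r = (r1, r2, r3)" by (metis surj_pair)
  let ?s = "(r1 \<odot>\<^bsub>icosaR\<^esub> e1 \<oplus>\<^bsub>icosaR\<^esub> r2 \<odot>\<^bsub>icosaR\<^esub> e2) \<oplus>\<^bsub>icosaR\<^esub> r3 \<odot>\<^bsub>icosaR\<^esub> e3"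
  have "r = ?s"
    unfolding r by (cases r1; cases r2; cases r3) (simp add: e1_def e2_def e3_def)
  moreover have "f ?s = g ?s" using assms unfolding Zphi_linear_def by (simp only:)
  ultimately show "f r = g r" by (simp only:)
qed

lemma Zphi_linear_icosa_A: "Zphi_linear icosa_A" and Zphi_linear_icosa_B: "Zphi_linear icosa_B"
  by (auto simp: Zphi_linear_def icosa_A_def icosa_B_def phi_def algebra_simps)

lemma Zphi_linear_comp: "\<lbrakk>Zphi_linear f; Zphi_linear g\<rbrakk> \<Longrightarrow> Zphi_linear (\<lambda>r. f (g r))"
  unfolding Zphi_linear_def by metis

lemma minus_e: "\<ominus>\<^bsub>icosaR\<^esub> e1 = ((-1, 0), (0, 0), (0, 0))" "\<ominus>\<^bsub>icosaR\<^esub> e2 = ((0, 0), (-1, 0), (0, 0))"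
proof -
  interpret module Zphi icosaR by (rule module_icosaR)
  show "\<ominus>\<^bsub>icosaR\<^esub> e1 = ((-1, 0), (0, 0), (0, 0))" "\<ominus>\<^bsub>icosaR\<^esub> e2 = ((0, 0), (-1, 0), (0, 0))"
    by (rule minus_equality; simp add: e1_def e2_def)+
qed

lemma icosa_A_e:
  "icosa_A e1 = \<ominus>\<^bsub>icosaR\<^esub> e1 \<oplus>\<^bsub>icosaR\<^esub> phi \<odot>\<^bsub>icosaR\<^esub> e3"
  "icosa_A e2 = \<ominus>\<^bsub>icosaR\<^esub> e2 \<oplus>\<^bsub>icosaR\<^esub> phi \<odot>\<^bsub>icosaR\<^esub> e3"
  "icosa_A e3 = e3"
  unfolding minus_e by (simp_all add: icosa_A_def e1_def e2_def e3_def phi_def)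

lemma icosa_B_e: "icosa_B e1 = e3" "icosa_B e2 = e1" "icosa_B e3 = e2"
  by (simp_all add: icosa_B_def e1_def e2_def e3_def)

text \<open>A linear map is determined by its values on \<open>e\<^sub>1\<close>, \<open>e\<^sub>2\<close>, \<open>e\<^sub>3\<close>.\<close>
lemma is_icosa_action_iff:
  "is_icosa_action \<alpha> \<gamma> \<sigma> \<longleftrightarrow> \<sigma> \<in> extensional (carrier Alt5) \<and> group_action Alt5 UNIV \<sigma> \<and>
    (\<forall>g\<in>carrier Alt5. Zphi_linear (\<sigma> g)) \<and> \<sigma> \<alpha> = icosa_A \<and> \<sigma> \<gamma> = icosa_B"
  if "\<alpha> \<in> carrier Alt5" "\<gamma> \<in> carrier Alt5"
proof
  assume l: "is_icosa_action \<alpha> \<gamma> \<sigma>"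
  then have lin: "\<forall>g\<in>carrier Alt5. Zphi_linear (\<sigma> g)"
    unfolding is_icosa_action_def Zphi_linear_def icosaR_simps(1) Zphi_simps(1) ball_UNIV by blast
  have "\<sigma> \<alpha> = icosa_A"
    using l lin that by (intro Zphi_linear_eqI Zphi_linear_icosa_A) (simp_all only: is_icosa_action_def icosa_A_e)
  moreover have "\<sigma> \<gamma> = icosa_B"
    using l lin that by (intro Zphi_linear_eqI Zphi_linear_icosa_B) (simp_all only: is_icosa_action_def icosa_B_e)
  ultimately show "\<sigma> \<in> extensional (carrier Alt5) \<and> group_action Alt5 UNIV \<sigma> \<and>
    (\<forall>g\<in>carrier Alt5. Zphi_linear (\<sigma> g)) \<and> \<sigma> \<alpha> = icosa_A \<and> \<sigma> \<gamma> = icosa_B"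
    using l lin unfolding is_icosa_action_def icosaR_simps(1) by blast
next
  assume "\<sigma> \<in> extensional (carrier Alt5) \<and> group_action Alt5 UNIV \<sigma> \<and>
    (\<forall>g\<in>carrier Alt5. Zphi_linear (\<sigma> g)) \<and> \<sigma> \<alpha> = icosa_A \<and> \<sigma> \<gamma> = icosa_B"
  then show "is_icosa_action \<alpha> \<gamma> \<sigma>"
    unfolding is_icosa_action_def Zphi_linear_def icosaR_simps(1) Zphi_simps(1) ball_UNIV
    by (elim conjE) (intro conjI; (assumption | simp only: icosa_A_e icosa_B_e))
qed

lemma group_actionI:
  assumes "group G"
    and closed: "\<And>g x. g \<in> carrier G \<Longrightarrow> x \<in> S \<Longrightarrow> \<tau> g x \<in> S"
    and one: "\<And>x. x \<in> S \<Longrightarrow> \<tau> \<one>\<^bsub>G\<^esub> x = x"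
    and mult: "\<And>g h x. g \<in> carrier G \<Longrightarrow> h \<in> carrier G \<Longrightarrow> x \<in> S \<Longrightarrow> \<tau> (g \<otimes>\<^bsub>G\<^esub> h) x = \<tau> g (\<tau> h x)"
  shows "group_action G S (\<lambda>g\<in>carrier G. \<lambda>x\<in>S. \<tau> g x)"
proof -
  interpret group G by fact
  have Bij: "(\<lambda>x\<in>S. \<tau> g x) \<in> Bij S" if g: "g \<in> carrier G" for g
  proof -
    have "bij_betw (\<tau> g) S S"
      by (rule bij_betw_byWitness[of _ "\<tau> (inv\<^bsub>G\<^esub> g)"])
        (use g closed one mult[of "inv\<^bsub>G\<^esub> g" g] mult[of g "inv\<^bsub>G\<^esub> g"] in auto)
    then show ?thesis by (simp add: Bij_def bij_betw_restrict_eq)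
  qed
  show ?thesis
  proof (intro group_action.intro group_hom.intro group_hom_axioms.intro)
    show "(\<lambda>g\<in>carrier G. \<lambda>x\<in>S. \<tau> g x) \<in> hom G (BijGroup S)"
    proof (rule homI)
      fix g h assume "g \<in> carrier G" "h \<in> carrier G"
      then show "(\<lambda>g\<in>carrier G. \<lambda>x\<in>S. \<tau> g x) (g \<otimes>\<^bsub>G\<^esub> h) =
          (\<lambda>g\<in>carrier G. \<lambda>x\<in>S. \<tau> g x) g \<otimes>\<^bsub>BijGroup S\<^esub> (\<lambda>g\<in>carrier G. \<lambda>x\<in>S. \<tau> g x) h"
        using Bij mult closed by (auto simp: BijGroup_def compose_def fun_eq_iff)
    qed (simp add: BijGroup_def Bij)
  qed (rule is_group group_BijGroup)+
qed

lemma order_Alt5: "order Alt5 = 60"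
  using alt_group_card_carrier[of 5] by (simp add: order_def fact_numeral)

lemma (in group) icosahedral_groupI:
  assumes "order G = 60" and gens: "\<alpha> \<in> carrier G" "\<gamma> \<in> carrier G"
    and ord: "ord \<alpha> = 2" "ord \<gamma> = 3" "ord (\<alpha> \<otimes> \<gamma>) = 5"
  shows "icosahedral_group G \<alpha> (\<alpha> \<otimes> \<gamma>)"
proof -
  have 2: "\<alpha> \<otimes> \<alpha> = \<one>"
    using pow_ord_eq_1[OF gens(1)] gens ord(1) by (simp add: numeral_eq_Suc)
  then have "\<alpha> \<otimes> (\<alpha> \<otimes> \<gamma>) = \<gamma>" using gens by (simp flip: m_assoc)
  then show ?thesis
    using assms 2 pow_ord_eq_1[of "\<alpha> \<otimes> \<gamma>"] pow_ord_eq_1[of \<gamma>] ord_eq_1[of "\<alpha> \<otimes> \<gamma>"]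
    by unfold_locales simp_all
qed

lemma icosahedral_group_Alt5:
  assumes "icosa_generators \<alpha> \<gamma>"
  shows "icosahedral_group Alt5 \<alpha> (\<alpha> \<otimes>\<^bsub>Alt5\<^esub> \<gamma>)"
  using assms group.icosahedral_groupI[OF alt_group_is_group order_Alt5]
  by (simp add: icosa_generators_def)

text \<open>
  Existence comes from \<open>action_of_pair\<close>, since the two matrices satisfy the relations; uniqueness holds
  because \<open>\<alpha>\<close> and \<open>\<alpha>\<gamma>\<close> generate the group.
\<close>
lemma icosa_action:
  assumes "icosa_generators \<alpha> \<gamma>"
  shows "is_icosa_action \<alpha> \<gamma> (icosa_action \<alpha> \<gamma>)"
proof -
  have gens: "\<alpha> \<in> carrier Alt5" "\<gamma> \<in> carrier Alt5" using assms by (simp_all add: icosa_generators_def)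
  interpret I: icosahedral_group Alt5 \<alpha> "\<alpha> \<otimes>\<^bsub>Alt5\<^esub> \<gamma>"
    using assms by (rule icosahedral_group_Alt5)
  have \<gamma>: "\<alpha> \<otimes>\<^bsub>Alt5\<^esub> (\<alpha> \<otimes>\<^bsub>Alt5\<^esub> \<gamma>) = \<gamma>" using gens I.alpha_2 by (simp flip: I.m_assoc)
  obtain \<tau> :: "_ \<Rightarrow> zphi3 \<Rightarrow> zphi3" where \<tau>_one: "\<And>r. \<tau> \<one>\<^bsub>Alt5\<^esub> r = r"
    and mult: "\<And>g h r. g \<in> carrier Alt5 \<Longrightarrow> h \<in> carrier Alt5 \<Longrightarrow> \<tau> (g \<otimes>\<^bsub>Alt5\<^esub> h) r = \<tau> g (\<tau> h r)"
    and \<tau>_\<alpha>: "\<And>r. \<tau> \<alpha> r = icosa_A r" and \<tau>_c: "\<And>r. \<tau> (\<alpha> \<otimes>\<^bsub>Alt5\<^esub> \<gamma>) r = icosa_A (icosa_B r)"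
    using I.action_of_pair[OF icosa_pair] by (metis UNIV_I)
  have lin: "Zphi_linear (\<tau> g)" if "g \<in> carrier Alt5" for g
    using that
  proof (induction rule: I.carrier_induct)
    case one
    have "\<tau> \<one>\<^bsub>Alt5\<^esub> = (\<lambda>r. r)" using \<tau>_one by blast
    then show ?case by (simp add: Zphi_linear_def)
  next
    case (alpha h)
    then have "\<tau> (\<alpha> \<otimes>\<^bsub>Alt5\<^esub> h) = (\<lambda>r. icosa_A (\<tau> h r))" by (intro ext) (simp add: mult gens \<tau>_\<alpha>)
    with alpha show ?case using Zphi_linear_comp[OF Zphi_linear_icosa_A] by metis
  next
    case (c h)
    then have "\<tau> (\<alpha> \<otimes>\<^bsub>Alt5\<^esub> \<gamma> \<otimes>\<^bsub>Alt5\<^esub> h) = (\<lambda>r. icosa_A (icosa_B (\<tau> h r)))"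
      by (intro ext) (simp add: mult gens \<tau>_c)
    with c show ?case
      using Zphi_linear_comp[OF Zphi_linear_icosa_A Zphi_linear_comp[OF Zphi_linear_icosa_B]] by metis
  qed
  have \<tau>\<gamma>: "\<tau> \<gamma> = icosa_B"
  proof
    fix r
    have "\<tau> (\<alpha> \<otimes>\<^bsub>Alt5\<^esub> (\<alpha> \<otimes>\<^bsub>Alt5\<^esub> \<gamma>)) r = \<tau> \<alpha> (\<tau> (\<alpha> \<otimes>\<^bsub>Alt5\<^esub> \<gamma>) r)"
      by (rule mult) (use gens in simp_all)
    then show "\<tau> \<gamma> r = icosa_B r"
      unfolding \<gamma> \<tau>_\<alpha> \<tau>_c by (simp only: icosahedral_pair.A_A[OF icosa_pair UNIV_I])
  qed
  let ?\<tau> = "restrict \<tau> (carrier Alt5)"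
  have "group_action Alt5 UNIV (\<lambda>g\<in>carrier Alt5. \<lambda>r\<in>UNIV. \<tau> g r)"
    using group_actionI[OF alt_group_is_group, of 5 UNIV \<tau>] \<tau>_one mult by simp
  then have "group_action Alt5 UNIV ?\<tau>" by (simp add: restrict_UNIV)
  then have is_\<tau>: "is_icosa_action \<alpha> \<gamma> ?\<tau>"
    using lin \<tau>\<gamma> \<tau>_\<alpha> gens by (simp add: is_icosa_action_iff ext)
  have "\<sigma> = ?\<tau>" if "is_icosa_action \<alpha> \<gamma> \<sigma>" for \<sigma>
  proof -
    have \<sigma>: "\<sigma> \<in> extensional (carrier Alt5)" "group_action Alt5 UNIV \<sigma>" "\<sigma> \<alpha> = icosa_A" "\<sigma> \<gamma> = icosa_B"
      using that gens by (simp_all add: is_icosa_action_iff)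
    interpret \<sigma>: group_action Alt5 UNIV \<sigma> by (rule \<sigma>(2))
    have "\<sigma> g r = \<tau> g r" if "g \<in> carrier Alt5" for g r
      using that
    proof (induction rule: I.carrier_induct)
      case one
      then show ?case using \<sigma>.id_eq_one by (metis \<tau>_one restrict_UNIV)
    next
      case (alpha h)
      then show ?case by (simp add: mult \<sigma>.composition_rule gens \<tau>_\<alpha> \<sigma>)
    next
      case (c h)
      then show ?case by (simp add: mult \<sigma>.composition_rule gens \<tau>_c \<sigma>)
    qed
    then show ?thesis by (intro extensionalityI[OF \<sigma>(1)]) auto
  qed
  then show ?thesis unfolding icosa_action_def by (rule theI[of "is_icosa_action \<alpha> \<gamma>", OF is_\<tau>])
qed

context icosahedral_module
begin

lemma ev_icosa_B: "x \<in> L \<Longrightarrow> B (ev r x) = ev (icosa_B r) x"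
  by (cases r) (simp add: ev_def icosa_B_def B_\<theta> L_carrier smultM(1) del: Zphi_module_simps)

lemma ev_icosa_A: "x \<in> L \<Longrightarrow> A (ev r x) = ev (icosa_A r) x"
  by (cases r)
    (simp add: ev_def icosa_A_def A_\<theta> L_carrier smultM del: Zphi_module_simps Zphi_simps)

lemma ev_icosa_action:
  assumes gen: "icosa_generators \<alpha> \<gamma>" and "group_action Alt5 (carrier V) \<rho>"
    and A: "\<rho> \<alpha> = A" and P: "\<rho> (\<alpha> \<otimes>\<^bsub>Alt5\<^esub> \<gamma>) = P"
    and g: "g \<in> carrier Alt5" and x: "x \<in> L"
  shows "\<rho> g (ev r x) = ev (icosa_action \<alpha> \<gamma> g r) x"
proof -
  have gens: "\<alpha> \<in> carrier Alt5" "\<gamma> \<in> carrier Alt5" using gen by (simp_all add: icosa_generators_def)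
  interpret I: icosahedral_group Alt5 \<alpha> "\<alpha> \<otimes>\<^bsub>Alt5\<^esub> \<gamma>"
    using gen by (rule icosahedral_group_Alt5)
  interpret \<rho>: group_action Alt5 "carrier V" \<rho> by fact
  have \<sigma>: "group_action Alt5 UNIV (icosa_action \<alpha> \<gamma>)" "icosa_action \<alpha> \<gamma> \<alpha> = icosa_A"
    "icosa_action \<alpha> \<gamma> \<gamma> = icosa_B"
    using icosa_action[OF gen] gens by (simp_all add: is_icosa_action_iff)
  interpret \<sigma>: group_action Alt5 UNIV "icosa_action \<alpha> \<gamma>" by (rule \<sigma>(1))
  have P_eq: "P v = A (B v)" if "v \<in> carrier V" for v using that by (simp add: B_def)
  show ?thesis
    using g
  proof (induction rule: I.carrier_induct)
    case one
    show ?case using \<rho>.id_eq_one \<sigma>.id_eq_one ev_closed[OF x] by (metis restrict_UNIV restrict_apply')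
  next
    case (alpha h)
    then show ?case using x gens ev_closed
      by (simp add: \<rho>.composition_rule \<sigma>.composition_rule A \<sigma> ev_icosa_A)
  next
    case (c h)
    then show ?case using x gens ev_closed
      by (simp add: \<rho>.composition_rule \<sigma>.composition_rule P P_eq \<sigma> ev_icosa_A ev_icosa_B)
  qed
qed

end

section \<open>Dimension\<close>

context modular_universe
begin

lemma arr_closed: "\<lbrakk>f \<in> Arr U V W; x \<in> carrier V\<rbrakk> \<Longrightarrow> f x \<in> carrier W"
  using arr_hom[of f V W] by (auto simp: hom_def)

lemma pdecode_pcode:
  assumes "V \<in> Obj U" "W \<in> Obj U" "x \<in> carrier V" "y \<in> carrier W"
  shows "pdecode U V W (pcode U V W (x, y)) = (x, y)"
  unfolding pdecode_def using pcode_iso[OF assms(1,2)] assms(3,4)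
  by (intro inv_into_f_f) (auto simp: iso_def bij_betw_def)

text \<open>The pointwise sum of two endomorphisms is the diagonal, followed by their product and the sum map.\<close>
lemma arr_mult:
  assumes f: "f \<in> Arr U V V" and g: "g \<in> Arr U V V"
  shows "(\<lambda>x. f x \<otimes>\<^bsub>V\<^esub> g x) \<in> Arr U V V"
proof -
  have V: "V \<in> Obj U" using arr_obj[OF f] by simp
  let ?diag = "diag_map U V 1"
  let ?prod = "\<lambda>q. case pdecode U V V q of (x, y) \<Rightarrow> pcode U V V (f x, g y)"
  let ?sum = "\<lambda>q. case pdecode U V V q of (x, y) \<Rightarrow> x \<otimes>\<^bsub>V\<^esub> y"
  have "?diag \<in> Arr U V (Prd U V V)" using diagonal[OF V, of 1] by simp
  then have "?sum \<circ> (?prod \<circ> ?diag) \<in> Arr U V V"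
    using prd_arr[OF f g] sum_map[OF V] by (intro arr_comp)
  then show ?thesis
    by (rule arr_cong) (simp add: pdecode_pcode V arr_closed[OF f] arr_closed[OF g])
qed

end

locale connected_module = modular_universe +
  fixes dm V
  assumes additive: "additive_dimension U dm"
    and connected: "dim_connected U dm V"
    and no_2_torsion: "without_2_torsion V"
begin

lemma V_obj: "V \<in> Obj U"
  using connected by (simp add: dim_connected_def)

sublocale V: comm_group V
  by (rule obj_group[OF V_obj])

abbreviation d :: "'a set \<Rightarrow> nat" where "d H \<equiv> dm (V\<lparr>carrier := H\<rparr>)"

text \<open>
  All subgroups of \<open>V\<close> in the proof are kernels and images of restricted endomorphisms, and as records
  they are \<open>V\<close> with another carrier.  So dimension can be treated as a function of carriers.
\<close>
definition definable :: "'a set \<Rightarrow> bool" where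
  "definable H \<longleftrightarrow> subgroup H V \<and> V\<lparr>carrier := H\<rparr> \<in> Obj U"

lemma subgrp: "subgroup H V \<Longrightarrow> subgrp (V\<lparr>carrier := H\<rparr>) V"
  by (simp add: subgrp_def)

lemma definable_carrier: "definable (carrier V)"
  using V_obj V.subgroup_self by (simp add: definable_def)

lemma dim_kernel_image:
  assumes H: "definable H" and f: "f \<in> Arr U V V"
  shows "definable {x \<in> H. f x = \<one>\<^bsub>V\<^esub>}" "definable (f ` H)"
    "d H = d {x \<in> H. f x = \<one>\<^bsub>V\<^esub>} + d (f ` H)"
proof -
  let ?H = "V\<lparr>carrier := H\<rparr>"
  have sub: "subgroup H V" "?H \<in> Obj U" using H by (simp_all add: definable_def)
  have "f \<circ> (\<lambda>x. x) \<in> Arr U ?H V"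
    by (rule arr_comp[OF inclusion[OF V_obj sub(2) subgrp[OF sub(1)]] f])
  then have arr: "f \<in> Arr U ?H V" by (rule arr_cong) simp
  have ker: "ker_obj ?H V f = V\<lparr>carrier := {x \<in> H. f x = \<one>\<^bsub>V\<^esub>}\<rparr>"
    by (simp add: ker_obj_def kernel_def)
  have im: "im_obj ?H V f = V\<lparr>carrier := f ` H\<rparr>" by (simp add: im_obj_def)
  interpret f: group_hom V V f
    using arr_hom[OF f] by unfold_locales
  have "{x \<in> H. f x = \<one>\<^bsub>V\<^esub>} = H \<inter> kernel V V f"
    using subgroup.subset[OF sub(1)] by (auto simp: kernel_def)
  then have "subgroup {x \<in> H. f x = \<one>\<^bsub>V\<^esub>} V"
    using V.subgroups_Inter_pair[OF sub(1) f.subgroup_kernel] by simp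
  then show "definable {x \<in> H. f x = \<one>\<^bsub>V\<^esub>}"
    using ker_in_obj[OF arr] by (simp add: definable_def ker)
  show "definable (f ` H)"
    using im_in_obj[OF arr] f.subgroup_img_is_subgroup[OF sub(1)] by (simp add: definable_def im)
  show "d H = d {x \<in> H. f x = \<one>\<^bsub>V\<^esub>} + d (f ` H)"
    using additive arr by (auto simp: additive_dimension_def ker im)
qed

text \<open>The identity of the trivial group has trivial kernel and image, so the dimension is twice itself.\<close>
lemma dim_trivial: "d {\<one>\<^bsub>V\<^esub>} = 0"
proof -
  have id: "(\<lambda>x. x) \<in> Arr U V V" by (rule arr_id[OF V_obj])
  have "{x \<in> carrier V. x = \<one>\<^bsub>V\<^esub>} = {\<one>\<^bsub>V\<^esub>}" by auto
  then have "definable {\<one>\<^bsub>V\<^esub>}" using dim_kernel_image(1)[OF definable_carrier id] by simp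
  from dim_kernel_image(3)[OF this id] show ?thesis by (simp add: Collect_conv_if)
qed

lemma dim_injective_image:
  assumes H: "definable H" and f: "f \<in> Arr U V V" and inj: "\<And>x. x \<in> H \<Longrightarrow> f x = \<one>\<^bsub>V\<^esub> \<Longrightarrow> x = \<one>\<^bsub>V\<^esub>"
  shows "d (f ` H) = d H"
proof -
  interpret f: group_hom V V f
    using arr_hom[OF f] by unfold_locales
  have "{x \<in> H. f x = \<one>\<^bsub>V\<^esub>} = {\<one>\<^bsub>V\<^esub>}"
  proof
    show "{x \<in> H. f x = \<one>\<^bsub>V\<^esub>} \<subseteq> {\<one>\<^bsub>V\<^esub>}" using inj by blast
    show "{\<one>\<^bsub>V\<^esub>} \<subseteq> {x \<in> H. f x = \<one>\<^bsub>V\<^esub>}"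
      using H by (simp add: definable_def subgroup.one_closed f.hom_one)
  qed
  then show ?thesis using dim_kernel_image(3)[OF H f] dim_trivial by simp
qed

lemma full_dim: assumes "definable H" "d H = dm V" shows "H = carrier V"
  using assms connected subgrp unfolding dim_connected_def definable_def by fastforce

lemma square_trivial: "\<lbrakk>x \<in> carrier V; x \<otimes>\<^bsub>V\<^esub> x = \<one>\<^bsub>V\<^esub>\<rbrakk> \<Longrightarrow> x = \<one>\<^bsub>V\<^esub>"
  using no_2_torsion unfolding without_2_torsion_def
  by (elim ballE[of _ _ x]) (auto simp: numeral_eq_Suc)

lemma square_cancel:
  assumes "x \<in> carrier V" "y \<in> carrier V" "x \<otimes>\<^bsub>V\<^esub> x = y \<otimes>\<^bsub>V\<^esub> y" shows "x = y"
proof -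
  have "(x \<otimes>\<^bsub>V\<^esub> inv\<^bsub>V\<^esub> y) \<otimes>\<^bsub>V\<^esub> (x \<otimes>\<^bsub>V\<^esub> inv\<^bsub>V\<^esub> y) = (x \<otimes>\<^bsub>V\<^esub> x) \<otimes>\<^bsub>V\<^esub> inv\<^bsub>V\<^esub> (y \<otimes>\<^bsub>V\<^esub> y)"
    using assms(1,2) by (simp add: V.inv_mult V.m_ac)
  also have "\<dots> = \<one>\<^bsub>V\<^esub>" using assms by simp
  finally have "x \<otimes>\<^bsub>V\<^esub> inv\<^bsub>V\<^esub> y = \<one>\<^bsub>V\<^esub>" by (rule square_trivial[rotated]) (use assms in simp)
  then show ?thesis using assms V.inv_solve_right[of "\<one>\<^bsub>V\<^esub>" x y] by simp
qed

lemma square_root: assumes "x \<in> carrier V" shows "\<exists>w\<in>carrier V. x = w \<otimes>\<^bsub>V\<^esub> w"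
proof -
  let ?f = "\<lambda>x. x \<otimes>\<^bsub>V\<^esub> x"
  have f: "?f \<in> Arr U V V" using arr_mult[OF arr_id arr_id] V_obj by simp
  have "d (?f ` carrier V) = d (carrier V)"
    by (rule dim_injective_image[OF definable_carrier f square_trivial])
  then have "?f ` carrier V = carrier V"
    by (intro full_dim dim_kernel_image(2)[OF definable_carrier f]) simp
  then show ?thesis using assms by blast
qed

lemma uniquely_2_divisible: "uniquely_2_divisible V"
  unfolding uniquely_2_divisible_def
proof
  fix v assume "v \<in> carrier V"
  then obtain w where w: "w \<in> carrier V" "v = w \<otimes>\<^bsub>V\<^esub> w" using square_root by blast
  show "\<exists>!w. w \<in> carrier V \<and> v = w [^]\<^bsub>V\<^esub> (2::nat)"
  proof (rule ex1I)
    show "w \<in> carrier V \<and> v = w [^]\<^bsub>V\<^esub> (2::nat)" using w by (simp add: numeral_eq_Suc)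
    fix u assume "u \<in> carrier V \<and> v = u [^]\<^bsub>V\<^esub> (2::nat)"
    then have "u \<in> carrier V" "u \<otimes>\<^bsub>V\<^esub> u = w \<otimes>\<^bsub>V\<^esub> w" using w by (simp_all add: numeral_eq_Suc)
    then show "u = w" using square_cancel w(1) by blast
  qed
qed

text \<open>
  Divisibility of a subgroup makes the trace of an involution surjective onto the fixed points, and
  uniqueness of halves passes divisibility on to the two eigenspaces.
\<close>
definition divisible :: "'a set \<Rightarrow> bool" where
  "divisible H \<longleftrightarrow> definable H \<and> (\<forall>x\<in>H. \<exists>w\<in>H. x = w \<otimes>\<^bsub>V\<^esub> w)"

lemma divisible_carrier: "divisible (carrier V)"
  unfolding divisible_def using definable_carrier square_root by blast

lemma divisible_closed: "divisible H \<Longrightarrow> x \<in> H \<Longrightarrow> x \<in> carrier V"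
  using subgroup.subset by (auto simp: divisible_def definable_def)

text \<open>The endomorphism \<open>1 + s\<close> has kernel the \<open>-1\<close>-eigenspace and, by divisibility, image the fixed points.\<close>
lemma involution_split:
  assumes H: "divisible H" and s: "s \<in> Arr U V V"
    and sH: "\<And>x. x \<in> H \<Longrightarrow> s x \<in> H" and ss: "\<And>x. x \<in> H \<Longrightarrow> s (s x) = x"
  shows "divisible {x \<in> H. s x = x}" "divisible {x \<in> H. s x = inv\<^bsub>V\<^esub> x}"
    "d H = d {x \<in> H. s x = x} + d {x \<in> H. s x = inv\<^bsub>V\<^esub> x}"
proof -
  interpret s: group_hom V V s
    using arr_hom[OF s] by unfold_locales
  have sub: "subgroup H V" using H by (simp add: divisible_def definable_def)
  note closed = divisible_closed[OF H]
  have root: "\<exists>w\<in>H. x = w \<otimes>\<^bsub>V\<^esub> w" if "x \<in> H" for x using H that by (simp add: divisible_def)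
  have plus: "\<exists>w\<in>{x \<in> H. s x = x}. x = w \<otimes>\<^bsub>V\<^esub> w" if x: "x \<in> {x \<in> H. s x = x}" for x
  proof -
    obtain w where w: "w \<in> H" "x = w \<otimes>\<^bsub>V\<^esub> w" using x root by blast
    have "s w \<otimes>\<^bsub>V\<^esub> s w = s x" using w closed by simp
    also have "\<dots> = w \<otimes>\<^bsub>V\<^esub> w" using x w by simp
    finally have "s w = w" using square_cancel w(1) closed sH by blast
    then show ?thesis using w by blast
  qed
  have minus: "\<exists>w\<in>{x \<in> H. s x = inv\<^bsub>V\<^esub> x}. x = w \<otimes>\<^bsub>V\<^esub> w" if x: "x \<in> {x \<in> H. s x = inv\<^bsub>V\<^esub> x}" for x
  proof -
    obtain w where w: "w \<in> H" "x = w \<otimes>\<^bsub>V\<^esub> w" using x root by blast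
    have "s w \<otimes>\<^bsub>V\<^esub> s w = s x" using w closed by simp
    also have "\<dots> = inv\<^bsub>V\<^esub> w \<otimes>\<^bsub>V\<^esub> inv\<^bsub>V\<^esub> w" using x w closed by (simp add: V.inv_mult)
    finally have "s w = inv\<^bsub>V\<^esub> w" using square_cancel w(1) closed sH V.inv_closed by blast
    then show ?thesis using w by blast
  qed
  let ?f = "\<lambda>x. x \<otimes>\<^bsub>V\<^esub> s x"
  have f: "?f \<in> Arr U V V" using arr_mult[OF arr_id s] V_obj by simp
  have ker: "{x \<in> H. ?f x = \<one>\<^bsub>V\<^esub>} = {x \<in> H. s x = inv\<^bsub>V\<^esub> x}"
  proof (intro Collect_cong conj_cong refl)
    fix x assume "x \<in> H"
    then have "x \<in> carrier V" "s x \<in> carrier V" using closed sH by blast+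
    then show "x \<otimes>\<^bsub>V\<^esub> s x = \<one>\<^bsub>V\<^esub> \<longleftrightarrow> s x = inv\<^bsub>V\<^esub> x"
      using V.inv_equality[of "s x" x] by (auto simp: V.m_comm)
  qed
  have im: "?f ` H = {x \<in> H. s x = x}"
  proof
    show "?f ` H \<subseteq> {x \<in> H. s x = x}"
      using sH closed ss subgroup.m_closed[OF sub] by (auto simp: V.m_comm)
    show "{x \<in> H. s x = x} \<subseteq> ?f ` H"
    proof
      fix x assume "x \<in> {x \<in> H. s x = x}"
      then obtain w where "w \<in> H" "s w = w" "x = w \<otimes>\<^bsub>V\<^esub> w" using plus by blast
      then show "x \<in> ?f ` H" by force
    qed
  qed
  have def_H: "definable H" using H by (simp add: divisible_def)
  show "divisible {x \<in> H. s x = x}" "divisible {x \<in> H. s x = inv\<^bsub>V\<^esub> x}"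
    "d H = d {x \<in> H. s x = x} + d {x \<in> H. s x = inv\<^bsub>V\<^esub> x}"
    using dim_kernel_image[OF def_H f] plus minus unfolding ker im divisible_def by auto
qed

lemma endo_comp: "\<lbrakk>g \<in> Arr U V V; f \<in> Arr U V V\<rbrakk> \<Longrightarrow> g \<circ> f \<in> Arr U V V"
  by (rule arr_comp)

text \<open>
  The signs in the names \<open>Hpp\<close>, \<open>Hpm\<close>, \<open>Hmp\<close>, \<open>Hmm\<close> are the eigenvalues of \<open>A\<close> and \<open>Z\<close>.  The map \<open>T\<close> permutes
  the last three cyclically, so \<open>3 = d Hpp + 3 d Hpm\<close>.  If \<open>d Hpp = 3\<close>, then \<open>Hpp\<close> is everything and
  \<open>A\<close> is trivial.  Otherwise \<open>d Hpp = 0\<close>; as \<open>Hpp\<close> is the image of the sum of the four-group, the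
  kernel of this sum has full dimension.
\<close>
theorem klein_decomposition:
  assumes "icosahedral_pair (carrier V) A P" and A: "A \<in> Arr U V V" and P: "P \<in> Arr U V V"
    and dim: "dm V = 3" and nontrivial: "\<exists>x\<in>carrier V. A x \<noteq> x"
  shows "d {x \<in> carrier V. A x = x} = 1"
    and "x \<in> carrier V \<Longrightarrow> x \<otimes>\<^bsub>V\<^esub> A x \<otimes>\<^bsub>V\<^esub> icosahedral_pair.Z A P x \<otimes>\<^bsub>V\<^esub> A (icosahedral_pair.Z A P x) = \<one>\<^bsub>V\<^esub>"
proof -
  interpret icosahedral_pair "carrier V" A P by fact
  interpret A: group_hom V V A using arr_hom[OF A] by unfold_locales
  have "P \<circ> (P \<circ> (P \<circ> P)) \<in> Arr U V V" by (intro endo_comp P)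
  then have Q: "Q \<in> Arr U V V" by (rule arr_cong) (simp add: Q_def)
  have "P \<circ> (P \<circ> (A \<circ> (Q \<circ> (Q \<circ> (A \<circ> (P \<circ> P)))))) \<in> Arr U V V" by (intro endo_comp P A Q)
  then have Z: "Z \<in> Arr U V V" by (rule arr_cong) (simp add: Z_def)
  have "P \<circ> (P \<circ> (A \<circ> Q)) \<in> Arr U V V" by (intro endo_comp P A Q)
  then have T: "T \<in> Arr U V V" by (rule arr_cong) (simp add: T_def)
  interpret Z: group_hom V V Z using arr_hom[OF Z] by unfold_locales
  interpret T: group_hom V V T using arr_hom[OF T] by unfold_locales
  define Hp Hm where "Hp = {x \<in> carrier V. A x = x}" and "Hm = {x \<in> carrier V. A x = inv\<^bsub>V\<^esub> x}"
  have H: "divisible Hp" "divisible Hm" "d (carrier V) = d Hp + d Hm"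
    unfolding Hp_def Hm_def using involution_split[OF divisible_carrier A] by simp_all
  define Hpp Hpm where "Hpp = {x \<in> Hp. Z x = x}" and "Hpm = {x \<in> Hp. Z x = inv\<^bsub>V\<^esub> x}"
  define Hmp Hmm where "Hmp = {x \<in> Hm. Z x = x}" and "Hmm = {x \<in> Hm. Z x = inv\<^bsub>V\<^esub> x}"
  have Hp2: "divisible Hpp" "divisible Hpm" "d Hp = d Hpp + d Hpm"
    unfolding Hpp_def Hpm_def using involution_split[OF H(1) Z]
    by (simp_all add: Hp_def Z_Z A_Z Z_closed)
  have Hm2: "divisible Hmp" "divisible Hmm" "d Hm = d Hmp + d Hmm"
    unfolding Hmp_def Hmm_def using involution_split[OF H(2) Z]
    by (simp_all add: Hm_def Z_Z A_Z Z_closed Z.hom_inv)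
  have T1: "T x \<in> Hmp" if "x \<in> Hpm" for x
    using that T_A[of x] T_Z[of x] T.hom_closed[of x] by (auto simp: Hpm_def Hp_def Hmp_def Hm_def)
  have T2: "T x \<in> Hmm" if "x \<in> Hmp" for x
  proof -
    have x: "x \<in> carrier V" "A x = inv\<^bsub>V\<^esub> x" "Z x = x" using that by (simp_all add: Hmp_def Hm_def)
    then have ZT: "Z (T x) = inv\<^bsub>V\<^esub> (T x)" using T_A[of x] by simp
    then have "T x = inv\<^bsub>V\<^esub> (A (T x))" using T_Z[of x] x by simp
    then have "A (T x) = inv\<^bsub>V\<^esub> (T x)" using x by (metis A.hom_closed T.hom_closed V.inv_inv)
    with ZT x show ?thesis by (simp add: Hmm_def Hm_def)
  qed
  have T3: "T x \<in> Hpm" if "x \<in> Hmm" for x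
  proof -
    have x: "x \<in> carrier V" "A x = inv\<^bsub>V\<^esub> x" "Z x = inv\<^bsub>V\<^esub> x" using that by (simp_all add: Hmm_def Hm_def)
    then have ZT: "Z (T x) = inv\<^bsub>V\<^esub> (T x)" using T_A[of x] by simp
    then have "inv\<^bsub>V\<^esub> (T x) = inv\<^bsub>V\<^esub> (A (T x))" using T_Z[of x] x by simp
    then have "A (T x) = T x" using x by (metis A.hom_closed T.hom_closed V.inv_inv)
    with ZT x show ?thesis by (simp add: Hpm_def Hp_def)
  qed
  have T_inj: "x = \<one>\<^bsub>V\<^esub>" if "x \<in> carrier V" "T x = \<one>\<^bsub>V\<^esub>" for x
    using T_T_T[OF that(1)] that(2) T.hom_one by simp
  have T_image: "T ` Hpm = Hmp" "T ` Hmp = Hmm"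
  proof -
    have "x \<in> T ` Hpm" if "x \<in> Hmp" for x
      using T3[OF T2[OF that]] T_T_T[of x] that by (metis (no_types, lifting) Hm_def Hmp_def imageI mem_Collect_eq)
    then show "T ` Hpm = Hmp" using T1 by blast
    have "x \<in> T ` Hmp" if "x \<in> Hmm" for x
      using T1[OF T3[OF that]] T_T_T[of x] that by (metis (no_types, lifting) Hm_def Hmm_def imageI mem_Collect_eq)
    then show "T ` Hmp = Hmm" using T2 by blast
  qed
  have "d Hmp = d Hpm" "d Hmm = d Hmp"
    unfolding T_image[symmetric]
    using dim_injective_image[OF _ T T_inj] divisible_closed Hp2(2) Hm2(1) T_image
    by (metis divisible_def)+
  then have sum: "3 = d Hpp + 3 * d Hpm" using H(3) Hp2(3) Hm2(3) dim by simp
  have "d Hpp \<noteq> 3"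
  proof
    assume "d Hpp = 3"
    then have "Hpp = carrier V" using full_dim Hp2(1) dim by (simp add: divisible_def)
    then show False using nontrivial by (auto simp: Hpp_def Hp_def)
  qed
  then have dims: "d Hpp = 0" "d Hpm = 1" using sum by presburger+
  then show "d {x \<in> carrier V. A x = x} = 1" using Hp2(3) by (simp add: Hp_def)
  let ?f = "\<lambda>x. (x \<otimes>\<^bsub>V\<^esub> A x) \<otimes>\<^bsub>V\<^esub> Z x \<otimes>\<^bsub>V\<^esub> A (Z x)"
  have "A \<circ> Z \<in> Arr U V V" by (intro endo_comp A Z)
  then have f: "?f \<in> Arr U V V"
    by (intro arr_mult arr_id V_obj A Z) (simp add: comp_def)
  have "?f ` carrier V = Hpp"
  proof
    show "?f ` carrier V \<subseteq> Hpp"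
      by (auto simp: Hpp_def Hp_def Z_Z A_Z Z_closed V.m_ac)
    show "Hpp \<subseteq> ?f ` carrier V"
    proof
      fix x assume "x \<in> Hpp"
      then obtain w where w: "w \<in> Hpp" "x = w \<otimes>\<^bsub>V\<^esub> w" using Hp2(1) by (auto simp: divisible_def)
      then obtain u where u: "u \<in> Hpp" "w = u \<otimes>\<^bsub>V\<^esub> u" using Hp2(1) by (auto simp: divisible_def)
      then have "x = ?f u" using w by (simp add: Hpp_def Hp_def V.m_assoc)
      then show "x \<in> ?f ` carrier V" using divisible_closed[OF Hp2(1) u(1)] by blast
    qed
  qed
  then have "d {x \<in> carrier V. ?f x = \<one>\<^bsub>V\<^esub>} = dm V"
    using dim_kernel_image(3)[OF definable_carrier f] dims by simp
  then have "{x \<in> carrier V. ?f x = \<one>\<^bsub>V\<^esub>} = carrier V"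
    by (rule full_dim[OF dim_kernel_image(1)[OF definable_carrier f]])
  then show "x \<in> carrier V \<Longrightarrow> ?f x = \<one>\<^bsub>V\<^esub>" by blast
qed

end

section \<open>Involutions and five-cycles in \<open>Alt(5)\<close>\<close>

lemma (in icosahedral_group) ord_alpha: "ord \<alpha> = 2"
proof -
  have "\<alpha> [^] (2::nat) = \<one>" using alpha_2 by (simp add: numeral_eq_Suc)
  then have "ord \<alpha> dvd 2" by (simp add: pow_eq_id)
  moreover have "ord \<alpha> \<noteq> 1" using alpha_ne_one ord_eq_1 by simp
  moreover have "Factorial_Ring.prime (2::nat)" by simp
  ultimately show ?thesis by (metis prime_nat_iff)
qed

lemma alt_group_pow: "x [^]\<^bsub>alt_group n\<^esub> (k::nat) = x ^^ k"
  by (induction k) (simp_all add: nat_pow_def alt_group_mult alt_group_one funpow_Suc_right del: funpow.simps(2))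

lemma icosa_generators_of_points:
  assumes d: "distinct [p, q, r, s, t]" and set: "{p, q, r, s, t} = {1..5::nat}"
  defines "\<alpha> \<equiv> transpose p q \<circ> transpose r s" and "\<gamma> \<equiv> cycle_of_list [p, r, t]"
  shows "icosa_generators \<alpha> \<gamma>" "\<alpha> \<otimes>\<^bsub>Alt5\<^esub> \<gamma> = cycle_of_list [p, s, r, t, q]"
proof -
  interpret group Alt5 by (rule alt_group_is_group)
  have mem: "p \<in> {1..5}" "q \<in> {1..5}" "r \<in> {1..5}" "s \<in> {1..5}" "t \<in> {1..5}"
    unfolding set[symmetric] by simp_all
  have \<alpha>: "\<alpha> \<in> carrier Alt5"
    using d mem unfolding \<alpha>_def alt_group_carrier
    by (intro conjI permutes_compose permutes_swap_id)
      (simp_all add: evenperm_comp permutation_swap_id evenperm_swap)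
  have "\<gamma> permutes {1..5}"
    unfolding \<gamma>_def by (rule permutes_subset[OF cycle_permutes]) (use mem in simp)
  then have \<gamma>: "\<gamma> \<in> carrier Alt5"
    using d unfolding \<gamma>_def alt_group_carrier
    by (simp add: evenperm_comp permutation_swap_id evenperm_swap permutation_compose)
  show c: "\<alpha> \<otimes>\<^bsub>Alt5\<^esub> \<gamma> = cycle_of_list [p, s, r, t, q]"
  proof
    fix x
    consider "x \<in> {p, q, r, s, t}" | "x \<notin> {p, q, r, s, t}" by blast
    then show "(\<alpha> \<otimes>\<^bsub>Alt5\<^esub> \<gamma>) x = cycle_of_list [p, s, r, t, q] x"
      using d by cases (auto simp: alt_group_mult \<alpha>_def \<gamma>_def transpose_def)
  qed
  have \<alpha>2: "\<alpha> \<otimes>\<^bsub>Alt5\<^esub> \<alpha> = \<one>\<^bsub>Alt5\<^esub>"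
    using d by (auto simp: alt_group_mult alt_group_one \<alpha>_def transpose_def fun_eq_iff)
  have \<gamma>_eq: "\<alpha> \<otimes>\<^bsub>Alt5\<^esub> (\<alpha> \<otimes>\<^bsub>Alt5\<^esub> \<gamma>) = \<gamma>" using \<alpha> \<gamma> \<alpha>2 by (simp flip: m_assoc)
  have length: "length [p, r, t] = 3" "length [p, s, r, t, q] = 5" by simp_all
  have "\<gamma> [^]\<^bsub>Alt5\<^esub> length [p, r, t] = \<one>\<^bsub>Alt5\<^esub>"
    unfolding alt_group_pow alt_group_one \<gamma>_def by (rule cycle_is_id_root) (use d in simp)
  then have "\<gamma> [^]\<^bsub>Alt5\<^esub> (3::nat) = \<one>\<^bsub>Alt5\<^esub>" unfolding length .
  moreover have "(\<alpha> \<otimes>\<^bsub>Alt5\<^esub> \<gamma>) [^]\<^bsub>Alt5\<^esub> length [p, s, r, t, q] = \<one>\<^bsub>Alt5\<^esub>"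
    unfolding alt_group_pow alt_group_one c by (rule cycle_is_id_root) (use d in auto)
  then have "(\<alpha> \<otimes>\<^bsub>Alt5\<^esub> \<gamma>) [^]\<^bsub>Alt5\<^esub> (5::nat) = \<one>\<^bsub>Alt5\<^esub>" unfolding length .
  moreover have "\<alpha> \<otimes>\<^bsub>Alt5\<^esub> \<gamma> \<noteq> \<one>\<^bsub>Alt5\<^esub>"
  proof
    assume "\<alpha> \<otimes>\<^bsub>Alt5\<^esub> \<gamma> = \<one>\<^bsub>Alt5\<^esub>"
    then have "cycle_of_list [p, s, r, t, q] p = p" unfolding c by (simp add: alt_group_one)
    then show False using d by (auto simp: transpose_def split: if_splits)
  qed
  ultimately interpret I: icosahedral_group Alt5 \<alpha> "\<alpha> \<otimes>\<^bsub>Alt5\<^esub> \<gamma>"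
    using \<alpha> \<gamma> \<alpha>2 order_Alt5 by unfold_locales (simp_all add: \<gamma>_eq)
  show "icosa_generators \<alpha> \<gamma>"
    using I.generate_eq_carrier I.ord_alpha I.ord_alpha_c I.ord_c \<alpha> \<gamma>
    unfolding icosa_generators_def \<gamma>_eq by simp
qed

text \<open>
  A relabelling takes the given 5-cycle to \<open>(p s r t q)\<close>.  If it is odd, following it by the
  transposition of \<open>p\<close> and \<open>q\<close> makes it even.
\<close>
lemma five_cycles_conjugate:
  assumes "distinct cs" "length cs = 5" "set cs = {1..5::nat}"
    and d: "distinct [p, s, r, t, q]" and set: "{p, s, r, t, q} = {1..5::nat}"
  shows "cycle_of_list [p, s, r, t, q] \<in> conj_class Alt5 (cycle_of_list cs) \<or>
    cycle_of_list [q, s, r, t, p] \<in> conj_class Alt5 (cycle_of_list cs)"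
proof -
  have conj: "cycle_of_list (map h cs) \<in> conj_class Alt5 (cycle_of_list cs)"
    if "h permutes {1..5}" "evenperm h" for h
  proof -
    have h: "h \<in> carrier Alt5" using that by (simp add: alt_group_carrier)
    then have "h \<otimes>\<^bsub>Alt5\<^esub> cycle_of_list cs \<otimes>\<^bsub>Alt5\<^esub> inv\<^bsub>Alt5\<^esub> h = cycle_of_list (map h cs)"
      using conjugation_of_cycle[OF assms(1) permutes_bij[OF that(1)]]
      by (simp add: alt_group_mult alt_group_inv_equality)
    with h show ?thesis unfolding conj_class_def by (intro CollectI exI[of _ h]) simp
  qed
  obtain a1 a2 a3 a4 a5 where cs: "cs = [a1, a2, a3, a4, a5]"
    using assms(2) by (auto simp: length_Suc_conv numeral_eq_Suc)
  define h where "h = id(a1 := p, a2 := s, a3 := r, a4 := t, a5 := q)"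
  have map_h: "map h cs = [p, s, r, t, q]" using assms(1) by (simp add: cs h_def)
  have "h permutes {1..5}"
  proof (rule bij_imp_permutes)
    have "h ` {1..5} = {1..5}"
      using arg_cong[OF map_h, of set] assms(3) set by simp
    then show "bij_betw h {1..5} {1..5}" by (simp add: bij_betw_def finite_surj_inj)
    fix x :: nat assume "x \<notin> {1..5}"
    then show "h x = x" unfolding assms(3)[symmetric] cs by (simp add: h_def)
  qed
  then have h: "h permutes {1..5}" "permutation h" by (auto simp: permutation_permutes)
  have pq: "p \<in> {1..5}" "q \<in> {1..5}" unfolding set[symmetric] by simp_all
  have h': "transpose p q \<circ> h permutes {1..5}"
    using h pq by (intro permutes_compose permutes_swap_id)
  have "map (transpose p q \<circ> h) cs = [q, s, r, t, p]"
    using d unfolding list.map_comp[symmetric] map_h by (auto simp: transpose_def)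
  moreover have "evenperm (transpose p q \<circ> h) \<longleftrightarrow> \<not> evenperm h"
    using d h by (simp add: evenperm_comp permutation_swap_id evenperm_swap)
  ultimately show ?thesis
    using conj[OF h(1)] conj[OF h'] map_h by auto
qed

text \<open>
  An involution moves some \<open>p\<close>.  It is even, so it is not a transposition, and a second pair \<open>r\<close>, \<open>s\<close>
  is interchanged; one point is left over and must be fixed.
\<close>
lemma involution_Alt5:
  assumes \<alpha>: "\<alpha> \<in> carrier Alt5" and ord: "group.ord Alt5 \<alpha> = 2"
  obtains p q r s t where "distinct [p, q, r, s, t]" "{p, q, r, s, t} = {1..5::nat}"
    "\<alpha> = transpose p q \<circ> transpose r s"
proof -
  interpret group Alt5 by (rule alt_group_is_group)
  have perm: "\<alpha> permutes {1..5}" "evenperm \<alpha>" using \<alpha> by (simp_all add: alt_group_carrier)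
  have "\<alpha> ^^ 2 = id" using pow_ord_eq_1[OF \<alpha>] ord by (simp add: alt_group_pow alt_group_one)
  then have inv: "\<alpha> (\<alpha> x) = x" for x by (simp add: numeral_2_eq_2 fun_eq_iff)
  have outside: "\<alpha> x = x" if "x \<notin> {1..5}" for x using perm(1) that by (simp add: permutes_def)
  have "\<alpha> \<noteq> id" using ord by (metis alt_group_one ord_id numeral_eq_one_iff semiring_norm(85))
  then obtain p where p: "\<alpha> p \<noteq> p" by (auto simp: fun_eq_iff)
  define q where "q = \<alpha> p"
  have "\<alpha> \<noteq> transpose p q"
  proof
    assume "\<alpha> = transpose p q"
    with perm(2) have "evenperm (transpose p q)" by simp
    with p show False by (simp add: evenperm_swap q_def)
  qed
  then obtain r where r: "\<alpha> r \<noteq> transpose p q r" by (auto simp: fun_eq_iff)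
  define s where "s = \<alpha> r"
  have rs: "r \<noteq> p" "r \<noteq> q" "s \<noteq> r" "s \<noteq> p" "s \<noteq> q" "p \<noteq> q" "\<alpha> q = p" "\<alpha> s = r"
    using r p inv by (auto simp: transpose_def q_def s_def split: if_splits) (metis inv)+
  have mem: "{p, q, r, s} \<subseteq> {1..5}"
    using outside rs p unfolding q_def s_def by (metis empty_subsetI insert_subset)
  have "card {p, q, r, s} = 4" using rs by (simp add: card_insert_if) 
  then have "card ({1..5} - {p, q, r, s}) = 1" using mem by (simp add: card_Diff_subset)
  then obtain t where t: "{1..5} - {p, q, r, s} = {t}" by (auto simp: card_1_singleton_iff)
  have "{1..5} = {p, q, r, s} \<union> {t}" using t mem by blast
  then have set: "{p, q, r, s, t} = {1..5}" by blast
  have "t \<notin> {p, q, r, s}" using t by blast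
  then have dist: "distinct [p, q, r, s, t]" using rs by auto
  have "\<alpha> t \<in> {p, q, r, s, t}"
    using permutes_in_image[OF perm(1), of t] unfolding set[symmetric] by simp
  moreover have "\<alpha> t \<noteq> x" if "x \<in> {p, q, r, s}" for x
  proof
    assume "\<alpha> t = x"
    then have "t = \<alpha> x" using inv[of t] by simp
    moreover have "\<alpha> x \<in> {p, q, r, s}" using that rs by (auto simp: inv)
    ultimately show False using \<open>t \<notin> {p, q, r, s}\<close> by simp
  qed
  ultimately have "\<alpha> t = t" by blast
  have "\<alpha> x = (transpose p q \<circ> transpose r s) x" for x
  proof (cases "x \<in> {p, q, r, s, t}")
    case True
    then show ?thesis using dist rs \<open>\<alpha> t = t\<close> by (auto simp: transpose_def q_def[symmetric] s_def[symmetric])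
  next
    case False
    then have "\<alpha> x = x" using outside unfolding set by blast
    then show ?thesis using False by (simp add: transpose_def)
  qed
  then have "\<alpha> = transpose p q \<circ> transpose r s" by blast
  then show thesis using that dist set by blast
qed

text \<open>
  For \<open>\<alpha> = (p q)(r s)\<close> with fixed point \<open>t\<close>, both \<open>(p r t)\<close> and \<open>(q r t)\<close> can serve as \<open>\<gamma>\<close>, and the
  products \<open>\<alpha>\<gamma>\<close> lie in different classes of 5-cycles.
\<close>
theorem exists_icosa_generators:
  assumes \<alpha>: "\<alpha> \<in> carrier Alt5" "group.ord Alt5 \<alpha> = 2" and C: "C \<in> five_cycle_classes"
  shows "\<exists>\<gamma>. icosa_generators \<alpha> \<gamma> \<and> \<alpha> \<otimes>\<^bsub>Alt5\<^esub> \<gamma> \<in> C"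
proof -
  obtain p q r s t where d: "distinct [p, q, r, s, t]" and set: "{p, q, r, s, t} = {1..5::nat}"
    and eq: "\<alpha> = transpose p q \<circ> transpose r s" using involution_Alt5[OF \<alpha>] .
  obtain cs where cs: "distinct cs" "length cs = 5" "set cs = {1..5::nat}" "C = conj_class Alt5 (cycle_of_list cs)"
    using C unfolding five_cycle_classes_def by blast
  have "cycle_of_list [p, s, r, t, q] \<in> C \<or> cycle_of_list [q, s, r, t, p] \<in> C"
    unfolding cs(4) using d set by (intro five_cycles_conjugate cs) auto
  moreover have "distinct [q, p, r, s, t]" "{q, p, r, s, t} = {1..5::nat}" "\<alpha> = transpose q p \<circ> transpose r s"
    using d set eq by (auto simp: transpose_commute)
  ultimately show ?thesis
    using icosa_generators_of_points[OF d set] icosa_generators_of_points[of q p r s t] eq by metis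
qed

lemma (in group) conj_class_eqI:
  assumes "c \<in> carrier G" "c' \<in> conj_class G c" shows "conj_class G c' = conj_class G c"
proof -
  have "\<exists>h\<in>carrier G. c' = h \<otimes> c \<otimes> inv h" using assms by (auto simp: conj_class_def)
  then obtain h where h: "h \<in> carrier G" "c' = h \<otimes> c \<otimes> inv h" by blast
  have sub: "conj_class G (h \<otimes> x \<otimes> inv h) \<subseteq> conj_class G x" if "h \<in> carrier G" "x \<in> carrier G" for h x
  proof
    fix y assume "y \<in> conj_class G (h \<otimes> x \<otimes> inv h)"
    then obtain k where "k \<in> carrier G" "y = k \<otimes> (h \<otimes> x \<otimes> inv h) \<otimes> inv k" by (auto simp: conj_class_def)
    then have "y = (k \<otimes> h) \<otimes> x \<otimes> inv (k \<otimes> h)" "k \<otimes> h \<in> carrier G"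
      using that by (simp_all add: m_assoc inv_mult_group)
    then show "y \<in> conj_class G x" unfolding conj_class_def by blast
  qed
  have "inv h \<otimes> c' \<otimes> inv (inv h) = c" using h assms(1) by (simp add: m_assoc flip: m_assoc[of "inv h" h])
  then show ?thesis using sub[of h c] sub[of "inv h" c'] h assms(1) by auto
qed

lemma five_cycle_class_eq:
  assumes "C \<in> five_cycle_classes" "c \<in> C"
  shows "C = conj_class Alt5 c"
proof -
  obtain cs :: "nat list" where cs: "distinct cs" "length cs = 5" "set cs = {1..5}"
    and C: "C = conj_class Alt5 (cycle_of_list cs)"
    using assms(1) unfolding five_cycle_classes_def by blast
  have "evenperm (cycle_of_list cs)"
    using cs(1,2) by (auto simp: length_Suc_conv numeral_eq_Suc evenperm_comp permutation_swap_id
        evenperm_swap permutation_compose)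
  then have "cycle_of_list cs \<in> carrier Alt5"
    using cycle_permutes[of cs] cs(3) by (simp add: alt_group_carrier)
  then show ?thesis
    using group.conj_class_eqI[OF alt_group_is_group] assms(2) unfolding C by blast
qed

section \<open>Faithful modules of dimension 3\<close>

lemma (in comm_monoid) finprod_distinct_list:
  "\<lbrakk>distinct xs; \<And>x. x \<in> set xs \<Longrightarrow> f x \<in> carrier G\<rbrakk> \<Longrightarrow>
    finprod G f (set xs) = foldr (\<otimes>) (map f xs) \<one>"
  by (induction xs) (auto simp: finprod_insert Pi_def)

text \<open>
  A quarter of the class sum agrees with \<open>\<psi>\<close> on \<open>L\<close> only, so the two module structures on \<open>L\<close> are different records;
  the tensor product sees only their common values.
\<close>
lemma tensor_relations_Zphi_module_cong:
  assumes "\<And>x. x \<in> carrier A \<Longrightarrow> f x = g x"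
  shows "tensor_relations Zphi icosaR (Zphi_module A f) = tensor_relations Zphi icosaR (Zphi_module A g)"
proof -
  have "r \<odot>\<^bsub>Zphi_module A f\<^esub> x = r \<odot>\<^bsub>Zphi_module A g\<^esub> x" if "x \<in> carrier A" for r x
    using assms that by (cases r) simp
  then show ?thesis
    unfolding tensor_relations_def Zphi_module_simps(1-2)
    by (intro arg_cong2[where f = union] refl Collect_cong ex_cong1) auto
qed

lemma Icosa_cong:
  assumes "\<And>x. x \<in> carrier A \<Longrightarrow> f x = g x"
  shows "Icosa (Zphi_module A f) = Icosa (Zphi_module A g)"
    "Icosa_action \<alpha> \<gamma> (Zphi_module A f) = Icosa_action \<alpha> \<gamma> (Zphi_module A g)"
  using tensor_relations_Zphi_module_cong[of A f g, OF assms]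
  by (simp_all add: fun_eq_iff Icosa_def Icosa_action_def tensor_def tensor_map_def tensor_kernel_def)

context icosahedral_module
begin

lemma half_square: assumes "x \<in> carrier V" shows "half V (x \<otimes> x) = x"
  unfolding half_def
proof (rule the_equality)
  show "x \<in> carrier V \<and> x \<otimes> x = x [^] (2::nat)" using assms by (simp add: numeral_eq_Suc)
  fix w assume "w \<in> carrier V \<and> x \<otimes> x = w [^] (2::nat)"
  then have "w \<in> carrier V" "w \<otimes> w = x \<otimes> x" by (simp_all add: numeral_eq_Suc)
  then show "w = x" using square_cancel assms by blast
qed

lemma quarter_class_sum:
  assumes gen: "icosa_generators \<alpha> \<gamma>" and "group_action Alt5 (carrier V) \<rho>"
    and A: "\<rho> \<alpha> = A" and P: "\<rho> (\<alpha> \<otimes>\<^bsub>Alt5\<^esub> \<gamma>) = P" and x: "x \<in> L"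
  shows "quarter_class_sum V \<rho> (conj_class Alt5 (\<alpha> \<otimes>\<^bsub>Alt5\<^esub> \<gamma>)) x = \<psi> x"
proof -
  interpret I: icosahedral_group Alt5 \<alpha> "\<alpha> \<otimes>\<^bsub>Alt5\<^esub> \<gamma>" using gen by (rule icosahedral_group_Alt5)
  interpret \<rho>: group_action Alt5 "carrier V" \<rho> by fact
  have xV: "x \<in> carrier V" using x by (rule L_carrier)
  have \<rho>_A: "\<rho> (\<alpha> \<otimes>\<^bsub>Alt5\<^esub> g) x = A (\<rho> g x)" if "g \<in> carrier Alt5" for g
    using that \<rho>.composition_rule[OF xV] A by simp
  have \<rho>_P: "\<rho> (\<alpha> \<otimes>\<^bsub>Alt5\<^esub> \<gamma> \<otimes>\<^bsub>Alt5\<^esub> g) x = P (\<rho> g x)" if "g \<in> carrier Alt5" for g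
    using that \<rho>.composition_rule[OF xV] P by simp
  have \<rho>_Q: "\<rho> (I.left.Q g) x = Q (\<rho> g x)" if "g \<in> carrier Alt5" for g
    using that by (simp add: I.left.Q_def Q_def \<rho>_P)
  have \<rho>_one: "\<rho> \<one>\<^bsub>Alt5\<^esub> x = x" using \<rho>.id_eq_one xV by (metis restrict_apply')
  have map: "map (\<lambda>g. \<rho> g x) (I.left.class_list \<one>\<^bsub>Alt5\<^esub>) = class_list x"
    by (simp only: I.left.class_list_def class_list_def list.map \<rho>_A \<rho>_P \<rho>_Q \<rho>_one
        I.left.A_closed I.left.P_closed I.left.Q_closed I.one_closed)
  have closed: "set (I.left.class_list \<one>\<^bsub>Alt5\<^esub>) \<subseteq> carrier Alt5"
    by (simp add: I.left.class_list_def)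
  have "finprod V (\<lambda>g. \<rho> g x) (conj_class Alt5 (\<alpha> \<otimes>\<^bsub>Alt5\<^esub> \<gamma>)) = foldr (\<otimes>) (class_list x) \<one>"
    unfolding I.conj_class_eq map[symmetric]
    by (rule finprod_distinct_list[OF I.distinct_class_list_one])
      (use closed \<rho>.element_image xV in blast)
  also have "\<dots> = (\<psi> x \<otimes> \<psi> x) \<otimes> (\<psi> x \<otimes> \<psi> x)" using x by (rule class_sum)
  finally show ?thesis using xV by (simp add: quarter_class_sum_def half_square)
qed

end

text \<open>
  Faithfulness enters through \<open>\<rho> \<alpha> \<noteq> 1\<close>, which excludes that the Klein four-group acts trivially.
\<close>
lemma (in connected_module) icosahedral_module:
  assumes action: "module_in U Alt5 V \<rho>" and faithful: "faithful_action Alt5 (carrier V) \<rho>"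
    and dim: "dm V = 3" and gen: "icosa_generators \<alpha> \<gamma>"
  shows "icosahedral_module V (\<rho> \<alpha>) (\<rho> (\<alpha> \<otimes>\<^bsub>Alt5\<^esub> \<gamma>))"
    and "d {x \<in> carrier V. \<rho> \<alpha> x = x} = 1"
proof -
  interpret I: icosahedral_group Alt5 \<alpha> "\<alpha> \<otimes>\<^bsub>Alt5\<^esub> \<gamma>" using gen by (rule icosahedral_group_Alt5)
  interpret \<rho>: faithful_action Alt5 "carrier V" \<rho> by fact
  have arr: "\<rho> g \<in> Arr U V V" if "g \<in> carrier Alt5" for g
    using action that by (simp add: module_in_def)
  have pair: "icosahedral_pair (carrier V) (\<rho> \<alpha>) (\<rho> (\<alpha> \<otimes>\<^bsub>Alt5\<^esub> \<gamma>))"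
  proof (rule I.pair_of_action)
    show "\<rho> \<one>\<^bsub>Alt5\<^esub> x = x" if "x \<in> carrier V" for x
      using \<rho>.id_eq_one that by (metis restrict_apply')
  qed (use \<rho>.element_image \<rho>.composition_rule in blast)+
  have nontrivial: "\<exists>x\<in>carrier V. \<rho> \<alpha> x \<noteq> x"
  proof (rule ccontr)
    assume "\<not> ?thesis"
    then have "\<rho> \<alpha> = (\<lambda>x\<in>carrier V. x)"
      using \<rho>.bij_prop0[OF I.alpha_closed]
      by (intro extensionalityI[of _ "carrier V"]) (auto simp: Bij_def)
    then have "\<rho> \<alpha> = \<rho> \<one>\<^bsub>Alt5\<^esub>" using \<rho>.id_eq_one by simp
    then have "\<alpha> = \<one>\<^bsub>Alt5\<^esub>" using \<rho>.faithful by (simp add: inj_on_def)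
    then show False using I.alpha_ne_one by simp
  qed
  note klein = klein_decomposition[OF pair arr[OF I.alpha_closed] arr[OF I.c_closed] dim nontrivial]
  show "d {x \<in> carrier V. \<rho> \<alpha> x = x} = 1" by (rule klein(1))
  interpret pair: icosahedral_pair "carrier V" "\<rho> \<alpha>" "\<rho> (\<alpha> \<otimes>\<^bsub>Alt5\<^esub> \<gamma>)" by (rule pair)
  show "icosahedral_module V (\<rho> \<alpha>) (\<rho> (\<alpha> \<otimes>\<^bsub>Alt5\<^esub> \<gamma>))"
  proof (intro icosahedral_module.intro icosahedral_module_axioms.intro V.comm_group_axioms pair)
    show "\<rho> \<alpha> (x \<otimes>\<^bsub>V\<^esub> y) = \<rho> \<alpha> x \<otimes>\<^bsub>V\<^esub> \<rho> \<alpha> y" if "x \<in> carrier V" "y \<in> carrier V" for x y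
      using hom_mult[OF arr_hom[OF arr[OF I.alpha_closed]] that] .
    show "\<rho> (\<alpha> \<otimes>\<^bsub>Alt5\<^esub> \<gamma>) (x \<otimes>\<^bsub>V\<^esub> y) = \<rho> (\<alpha> \<otimes>\<^bsub>Alt5\<^esub> \<gamma>) x \<otimes>\<^bsub>V\<^esub> \<rho> (\<alpha> \<otimes>\<^bsub>Alt5\<^esub> \<gamma>) y"
      if "x \<in> carrier V" "y \<in> carrier V" for x y
      using hom_mult[OF arr_hom[OF arr[OF I.c_closed]] that] .
  qed (fact square_trivial klein(2))+
qed

lemma (in connected_module) group_trace_image:
  assumes action: "group_action Alt5 (carrier V) \<rho>" "\<rho> \<alpha> \<in> Arr U V V"
    and \<alpha>: "\<alpha> \<in> carrier Alt5" "group.ord Alt5 \<alpha> = 2"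
  shows "im_obj V V (group_trace Alt5 V \<rho> \<alpha>) = V\<lparr>carrier := {x \<in> carrier V. \<rho> \<alpha> x = x}\<rparr>"
    and "V\<lparr>carrier := {x \<in> carrier V. \<rho> \<alpha> x = x}\<rparr> \<in> Obj U"
proof -
  interpret G: group Alt5 by (rule alt_group_is_group)
  interpret \<rho>: group_action Alt5 "carrier V" \<rho> by fact
  interpret h: group_hom V V "\<rho> \<alpha>" using arr_hom[OF action(2)] by unfold_locales
  have one: "\<rho> \<one>\<^bsub>Alt5\<^esub> x = x" if "x \<in> carrier V" for x
    using \<rho>.id_eq_one that by (metis restrict_apply')
  have "\<alpha> [^]\<^bsub>Alt5\<^esub> (2::nat) = \<one>\<^bsub>Alt5\<^esub>" using G.pow_ord_eq_1[OF \<alpha>(1)] \<alpha>(2) by simp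
  then have "\<alpha> \<otimes>\<^bsub>Alt5\<^esub> \<alpha> = \<one>\<^bsub>Alt5\<^esub>" using \<alpha>(1) G.nat_pow_Suc[of \<alpha> 1] by (simp add: numeral_2_eq_2)
  then have inv: "\<rho> \<alpha> (\<rho> \<alpha> x) = x" if "x \<in> carrier V" for x
    using \<rho>.composition_rule[OF that \<alpha>(1) \<alpha>(1)] one[OF that] by simp
  have trace: "group_trace Alt5 V \<rho> \<alpha> x = x \<otimes>\<^bsub>V\<^esub> \<rho> \<alpha> x" if "x \<in> carrier V" for x
  proof -
    have "{..<2::nat} = {0, 1}" by auto
    then show ?thesis
      using that one \<alpha>(1) unfolding group_trace_def \<alpha>(2) by (simp add: V.finprod_insert V.m_comm)
  qed
  have divisible: "divisible {x \<in> carrier V. \<rho> \<alpha> x = x}"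
    by (rule involution_split(1)[OF divisible_carrier action(2)]) (use inv in auto)
  then show "V\<lparr>carrier := {x \<in> carrier V. \<rho> \<alpha> x = x}\<rparr> \<in> Obj U"
    by (simp add: divisible_def definable_def)
  have "group_trace Alt5 V \<rho> \<alpha> ` carrier V = {x \<in> carrier V. \<rho> \<alpha> x = x}"
  proof
    show "group_trace Alt5 V \<rho> \<alpha> ` carrier V \<subseteq> {x \<in> carrier V. \<rho> \<alpha> x = x}"
      using trace inv by (auto simp: V.m_comm)
    show "{x \<in> carrier V. \<rho> \<alpha> x = x} \<subseteq> group_trace Alt5 V \<rho> \<alpha> ` carrier V"
    proof
      fix x assume "x \<in> {x \<in> carrier V. \<rho> \<alpha> x = x}"
      then obtain w where "w \<in> carrier V" "\<rho> \<alpha> w = w" "x = w \<otimes>\<^bsub>V\<^esub> w"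
        using divisible unfolding divisible_def by blast
      then show "x \<in> group_trace Alt5 V \<rho> \<alpha> ` carrier V" using trace by (intro image_eqI[of _ _ w]) simp_all
    qed
  qed
  then show "im_obj V V (group_trace Alt5 V \<rho> \<alpha>) = V\<lparr>carrier := {x \<in> carrier V. \<rho> \<alpha> x = x}\<rparr>"
    by (simp add: im_obj_def)
qed

theorem corollary2p2:
  fixes U :: "'a universe" and dm :: "'a monoid \<Rightarrow> nat"
    and V :: "'a monoid" and \<rho> :: "(nat \<Rightarrow> nat) \<Rightarrow> 'a \<Rightarrow> 'a"
  assumes "modular_universe U"
    and "additive_dimension U dm"
    and "module_in U Alt5 V \<rho>"
    and "faithful_action Alt5 (carrier V) \<rho>"
    and "dim_connected U dm V"
    and "dm V = 3"
    and "without_2_torsion V"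
  shows "uniquely_2_divisible V \<and>
    (\<forall>\<alpha> C. \<alpha> \<in> carrier Alt5 \<and> group.ord Alt5 \<alpha> = 2 \<and> C \<in> five_cycle_classes \<longrightarrow>
      (let L = im_obj V V (group_trace Alt5 V \<rho> \<alpha>);
           \<phi> = quarter_class_sum V \<rho> C;
           M = Zphi_module L \<phi>
       in \<phi> \<in> hom L L \<and>
          (\<forall>x\<in>carrier L. \<phi> (\<phi> x) = \<phi> x \<otimes>\<^bsub>L\<^esub> x) \<and>
          module Zphi M \<and>
          (\<exists>\<gamma>. icosa_generators \<alpha> \<gamma> \<and> \<alpha> \<otimes>\<^bsub>Alt5\<^esub> \<gamma> \<in> C) \<and>
          (\<forall>\<gamma>. icosa_generators \<alpha> \<gamma> \<and> \<alpha> \<otimes>\<^bsub>Alt5\<^esub> \<gamma> \<in> C \<longrightarrow>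
             equivariant_iso Alt5 V \<rho> (Icosa M) (Icosa_action \<alpha> \<gamma> M)) \<and>
          L \<in> Obj U \<and> dm L = 1))"
proof -
  interpret connected_module U dm V
    using assms(1,2,5,7) by (simp add: connected_module_def connected_module_axioms_def)
  have arr: "\<rho> g \<in> Arr U V V" if "g \<in> carrier Alt5" for g
    using assms(3) that by (simp add: module_in_def)
  have action: "group_action Alt5 (carrier V) \<rho>" using assms(3) by (simp add: module_in_def)
  have main: "\<phi> \<in> hom L L \<and> (\<forall>x\<in>carrier L. \<phi> (\<phi> x) = \<phi> x \<otimes>\<^bsub>L\<^esub> x) \<and> module Zphi (Zphi_module L \<phi>) \<and>
      (\<exists>\<gamma>. icosa_generators \<alpha> \<gamma> \<and> \<alpha> \<otimes>\<^bsub>Alt5\<^esub> \<gamma> \<in> C) \<and>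
      (\<forall>\<gamma>. icosa_generators \<alpha> \<gamma> \<and> \<alpha> \<otimes>\<^bsub>Alt5\<^esub> \<gamma> \<in> C \<longrightarrow>
        equivariant_iso Alt5 V \<rho> (Icosa (Zphi_module L \<phi>)) (Icosa_action \<alpha> \<gamma> (Zphi_module L \<phi>))) \<and>
      L \<in> Obj U \<and> dm L = 1"
    if \<alpha>: "\<alpha> \<in> carrier Alt5" "group.ord Alt5 \<alpha> = 2" and C: "C \<in> five_cycle_classes"
      and L_def: "L = im_obj V V (group_trace Alt5 V \<rho> \<alpha>)" and \<phi>_def: "\<phi> = quarter_class_sum V \<rho> C"
    for \<alpha> C L \<phi>
  proof -
    have L: "L = V\<lparr>carrier := {x \<in> carrier V. \<rho> \<alpha> x = x}\<rparr>" "L \<in> Obj U"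
      using group_trace_image[OF action arr[OF \<alpha>(1)] \<alpha>] by (simp_all add: L_def)
    have icosa: "\<phi> \<in> hom L L \<and> (\<forall>x\<in>carrier L. \<phi> (\<phi> x) = \<phi> x \<otimes>\<^bsub>L\<^esub> x) \<and> module Zphi (Zphi_module L \<phi>) \<and>
        equivariant_iso Alt5 V \<rho> (Icosa (Zphi_module L \<phi>)) (Icosa_action \<alpha> \<gamma> (Zphi_module L \<phi>)) \<and> dm L = 1"
      if gen: "icosa_generators \<alpha> \<gamma>" and c: "\<alpha> \<otimes>\<^bsub>Alt5\<^esub> \<gamma> \<in> C" for \<gamma>
    proof -
      note module = icosahedral_module[OF assms(3,4,6) gen]
      interpret W: icosahedral_module V "\<rho> \<alpha>" "\<rho> (\<alpha> \<otimes>\<^bsub>Alt5\<^esub> \<gamma>)" by (rule module(1))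
      have LG: "L = W.LG" by (simp add: L(1) W.L_def)
      have eq: "\<phi> x = W.\<psi> x" if "x \<in> carrier L" for x
        using W.quarter_class_sum[OF gen action refl refl, of x] that
        by (simp add: LG \<phi>_def five_cycle_class_eq[OF C c])
      have hom: "\<phi> \<in> hom L L"
        using W.\<psi>_hom eq unfolding LG hom_def by (auto simp: W.L_mult)
      have square: "\<phi> (\<phi> x) = \<phi> x \<otimes>\<^bsub>L\<^esub> x" if "x \<in> carrier L" for x
      proof -
        have "W.\<psi> x \<in> carrier L" "x \<in> W.L" using that W.\<psi>_in_L W.L_carrier by (simp_all add: LG)
        then show ?thesis using that eq W.\<psi>_\<psi> by (simp add: LG)
      qed
      have "equivariant_iso Alt5 V \<rho> (Icosa W.M) (Icosa_action \<alpha> \<gamma> W.M)"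
        unfolding Icosa_def Icosa_action_def
      proof (rule W.equivariant_iso_tensor)
        show "\<rho> g \<in> hom V V" if "g \<in> carrier Alt5" for g using arr_hom[OF arr[OF that]] .
        show "\<rho> g (W.ev r x) = W.ev (icosa_action \<alpha> \<gamma> g r) x" if "g \<in> carrier Alt5" "x \<in> W.L" for g r x
          using W.ev_icosa_action[OF gen action refl refl that] .
      qed (rule square_root)
      then have "equivariant_iso Alt5 V \<rho> (Icosa (Zphi_module L \<phi>)) (Icosa_action \<alpha> \<gamma> (Zphi_module L \<phi>))"
        using Icosa_cong[of L \<phi> W.\<psi>] eq unfolding LG by simp
      moreover have "module Zphi (Zphi_module L \<phi>)"
        using W.comm_group_LG hom square unfolding LG by (rule module_Zphi_module)
      moreover have "dm L = 1" using module(2) by (simp add: L(1))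
      ultimately show ?thesis using hom square by blast
    qed
    obtain \<gamma> where "icosa_generators \<alpha> \<gamma>" "\<alpha> \<otimes>\<^bsub>Alt5\<^esub> \<gamma> \<in> C"
      using exists_icosa_generators[OF \<alpha> C] by blast
    with icosa L(2) show ?thesis by blast
  qed
  show ?thesis
    unfolding Let_def using uniquely_2_divisible main by blast
qed

end
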